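(* Let $M$ be a pointed metric space and let $Y$ be a Banach space such that $\mathrm{LipSNA}_K(M,Y)$ is dense in $\mathrm{Lip}_{0K}(M,Y)$. (1) $\mathrm{LipSNA}_K(M,C(K,Y))$ is dense in $\mathrm{Lip}_{0K}(M,C(K,Y))$ for every compact Hausdorff topological space $K$. (2) For $1\leq p<\infty$, if $\mathrm{LipSNA}_K(M,\ell_p(Y))$ is dense in $\mathrm{Lip}_{0K}(M,\ell_p(Y))$, then $\mathrm{LipSNA}_K(M,L_p(\mu,Y))$ is dense in $\mathrm{Lip}_{0K}(M,L_p(\mu,Y))$ for every positive measure $\mu$. (3) $\mathrm{LipSNA}_K(M,L_\infty(\mu,Y))$ is dense in $\mathrm{Lip}_{0K}(M,L_\infty(\mu,Y))$ for every $\sigma$-finite positive measure $\mu$.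
   Context: All metric spaces are complete and all Banach spaces are real. A pointed metric space is a metric space $(M,d)$ with a distinguished point $0\in M$. $\mathrm{Lip}_0(M,Y)$ is the Banach space of Lipschitz maps $F\colon M\to Y$ with $F(0)=0$, with norm $\|F\|_L=\sup\{\|F(p)-F(q)\|/d(p,q)\colon p\neq q\}$. $F\in\mathrm{Lip}_0(M,Y)$ is Lipschitz compact if $\{(F(p)-F(q))/d(p,q)\colon p\neq q\}$ is relatively compact in $Y$; $\mathrm{Lip}_{0K}(M,Y)$ is the space of such maps. $F$ strongly attains its norm if there are $p\neq q$ in $M$ with $\|F(p)-F(q)\|/d(p,q)=\|F\|_L$; $\mathrm{LipSNA}_K(M,Y)$ is the set of maps in $\mathrm{Lip}_{0K}(M,Y)$ which strongly attain their norm. Density is with respect to $\|\cdot\|_L$. $C(K,Y)$ is the space of continuous functions $K\to Y$ with the supremum norm; $\ell_p(Y)$ is the space of $p$-summable sequences in $Y$ with its usual norm; $L_p(\mu,Y)$ and $L_\infty(\mu,Y)$ are the usual Lebesgue–Bochner spaces of (classes of) strongly measurable $Y$-valued functions. *)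

theory Defs
  imports "HOL-Probability.Essential_Supremum"
begin

text \<open>
  The target spaces of the Lipschitz maps depend on terms (a topology, a measure, an exponent),
  so they cannot all be types of class \<open>banach\<close>. A normed space is therefore given by an explicit
  carrier together with its operations.
\<close>

record 'v normed_sp =
  ns_carrier :: "'v set"
  ns_zero :: 'v
  ns_add :: "'v \<Rightarrow> 'v \<Rightarrow> 'v"
  ns_scale :: "real \<Rightarrow> 'v \<Rightarrow> 'v"
  ns_norm :: "'v \<Rightarrow> real"

definition ns_diff :: "'v normed_sp \<Rightarrow> 'v \<Rightarrow> 'v \<Rightarrow> 'v" where
  "ns_diff V x y = ns_add V x (ns_scale V (-1) y)"

text \<open>
  The locale \<open>Metric_space\<close> asks for nonnegativity and symmetry also outside the carrier, where the
  norm is meaningless; the distance is set to 0 there.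
\<close>

definition ns_dist :: "'v normed_sp \<Rightarrow> 'v \<Rightarrow> 'v \<Rightarrow> real" where
  "ns_dist V x y =
     (if x \<in> ns_carrier V \<and> y \<in> ns_carrier V then ns_norm V (ns_diff V x y) else 0)"

definition ns_topology :: "'v normed_sp \<Rightarrow> 'v topology" where
  "ns_topology V = Metric_space.mtopology (ns_carrier V) (ns_dist V)"

definition ns_of_type :: "'y::real_normed_vector normed_sp" where
  "ns_of_type = \<lparr>ns_carrier = UNIV, ns_zero = 0, ns_add = (+), ns_scale = (*\<^sub>R), ns_norm = norm\<rparr>"


section \<open>Lipschitz maps\<close>

text \<open>
  All maps are defined on a metric space \<open>'m\<close> (given as a type) with distinguished point \<open>z\<close>.
  Adjoining 0 to the set of difference quotients only matters for a one-point domain, where the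
  set of quotients is empty and the norm has to be 0.
\<close>

definition lip_norm :: "'v normed_sp \<Rightarrow> ('m::metric_space \<Rightarrow> 'v) \<Rightarrow> real" where
  "lip_norm V F = Sup (insert 0 {ns_norm V (ns_diff V (F p) (F q)) / dist p q | p q. p \<noteq> q})"

definition Lip0 :: "'m::metric_space \<Rightarrow> 'v normed_sp \<Rightarrow> ('m \<Rightarrow> 'v) normed_sp" where
  "Lip0 z V = \<lparr>
     ns_carrier = {F. range F \<subseteq> ns_carrier V \<and> F z = ns_zero V \<and>
       (\<exists>L. \<forall>p q. ns_norm V (ns_diff V (F p) (F q)) \<le> L * dist p q)},
     ns_zero = (\<lambda>p. ns_zero V),
     ns_add = (\<lambda>F G p. ns_add V (F p) (G p)),
     ns_scale = (\<lambda>c F p. ns_scale V c (F p)),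
     ns_norm = lip_norm V\<rparr>"

definition relatively_compactin :: "'v topology \<Rightarrow> 'v set \<Rightarrow> bool" where
  "relatively_compactin X S \<longleftrightarrow> S \<subseteq> topspace X \<and> compactin X (X closure_of S)"

definition Lip0K :: "'m::metric_space \<Rightarrow> 'v normed_sp \<Rightarrow> ('m \<Rightarrow> 'v) set" where
  "Lip0K z V = {F \<in> ns_carrier (Lip0 z V).
     relatively_compactin (ns_topology V)
       {ns_scale V (1 / dist p q) (ns_diff V (F p) (F q)) | p q. p \<noteq> q}}"

definition strongly_attains_norm :: "'v normed_sp \<Rightarrow> ('m::metric_space \<Rightarrow> 'v) \<Rightarrow> bool" where
  "strongly_attains_norm V F \<longleftrightarrow>
     (\<exists>p q. p \<noteq> q \<and> ns_norm V (ns_diff V (F p) (F q)) / dist p q = lip_norm V F)"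

definition LipSNAK :: "'m::metric_space \<Rightarrow> 'v normed_sp \<Rightarrow> ('m \<Rightarrow> 'v) set" where
  "LipSNAK z V = {F \<in> Lip0K z V. strongly_attains_norm V F}"

definition LipSNAK_dense :: "'m::metric_space \<Rightarrow> 'v normed_sp \<Rightarrow> bool" where
  "LipSNAK_dense z V \<longleftrightarrow> Lip0K z V \<subseteq> ns_topology (Lip0 z V) closure_of LipSNAK z V"


section \<open>Vector-valued function spaces\<close>

text \<open>
  Elements of \<open>C(K,Y)\<close> are functions with the fixed value \<open>undefined\<close> outside \<open>topspace K\<close>. The 0
  in the supremum covers the empty space \<open>K\<close>.
\<close>

definition C_space :: "'k topology \<Rightarrow> ('k \<Rightarrow> 'y::real_normed_vector) normed_sp" where
  "C_space K = \<lparr>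
     ns_carrier = {f \<in> extensional (topspace K). continuous_map K euclidean f},
     ns_zero = (\<lambda>x\<in>topspace K. 0),
     ns_add = (\<lambda>f g. \<lambda>x\<in>topspace K. f x + g x),
     ns_scale = (\<lambda>c f. \<lambda>x\<in>topspace K. c *\<^sub>R f x),
     ns_norm = (\<lambda>f. Sup (insert 0 ((\<lambda>x. norm (f x)) ` topspace K)))\<rparr>"

definition lp_space :: "real \<Rightarrow> (nat \<Rightarrow> 'y::real_normed_vector) normed_sp" where
  "lp_space p = \<lparr>
     ns_carrier = {x. summable (\<lambda>n. norm (x n) powr p)},
     ns_zero = (\<lambda>n. 0),
     ns_add = (\<lambda>x y n. x n + y n),
     ns_scale = (\<lambda>c x n. c *\<^sub>R x n),
     ns_norm = (\<lambda>x. (\<Sum>n. norm (x n) powr p) powr (1 / p))\<rparr>"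

text \<open>
  The value space need not be separable, so strong measurability is not the same as Borel
  measurability. Limits are required at every point of the space; requiring them only almost
  everywhere gives the same spaces of classes, since every function which is an almost everywhere
  limit of simple functions agrees almost everywhere with an everywhere limit.
\<close>

definition strongly_measurable ::
    "'b measure \<Rightarrow> ('b \<Rightarrow> 'y::real_normed_vector) \<Rightarrow> bool" where
  "strongly_measurable \<mu> f \<longleftrightarrow>
     (\<exists>s. (\<forall>i. simple_function \<mu> (s i)) \<and> (\<forall>x\<in>space \<mu>. (\<lambda>i. s i x) \<longlonglongrightarrow> f x))"

definition ae_rel ::
    "'b measure \<Rightarrow> ('b \<Rightarrow> 'y) set \<Rightarrow> (('b \<Rightarrow> 'y) \<times> ('b \<Rightarrow> 'y)) set" where
  "ae_rel \<mu> V = {(f, g). f \<in> V \<and> g \<in> V \<and> (AE x in \<mu>. f x = g x)}"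

text \<open>
  The space of almost everywhere classes of the functions in \<open>V\<close>, with the norm induced by a
  seminorm \<open>N\<close> on \<open>V\<close> which does not distinguish almost everywhere equal functions.
\<close>

definition ae_classes ::
    "'b measure \<Rightarrow> ('b \<Rightarrow> 'y::real_normed_vector) set \<Rightarrow> (('b \<Rightarrow> 'y) \<Rightarrow> real)
      \<Rightarrow> ('b \<Rightarrow> 'y) set normed_sp" where
  "ae_classes \<mu> V N = \<lparr>
     ns_carrier = V // ae_rel \<mu> V,
     ns_zero = ae_rel \<mu> V `` {\<lambda>x. 0},
     ns_add = (\<lambda>A B. \<Union>f\<in>A. \<Union>g\<in>B. ae_rel \<mu> V `` {\<lambda>x. f x + g x}),
     ns_scale = (\<lambda>c A. \<Union>f\<in>A. ae_rel \<mu> V `` {\<lambda>x. c *\<^sub>R f x}),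
     ns_norm = (\<lambda>A. N (SOME f. f \<in> A))\<rparr>"

definition Lp_space ::
    "real \<Rightarrow> 'b measure \<Rightarrow> ('b \<Rightarrow> 'y::real_normed_vector) set normed_sp" where
  "Lp_space p \<mu> = ae_classes \<mu>
     {f. strongly_measurable \<mu> f \<and> (\<integral>\<^sup>+x. ennreal (norm (f x) powr p) \<partial>\<mu>) < \<infinity>}
     (\<lambda>f. enn2real (\<integral>\<^sup>+x. ennreal (norm (f x) powr p) \<partial>\<mu>) powr (1 / p))"

definition Linf_space ::
    "'b measure \<Rightarrow> ('b \<Rightarrow> 'y::real_normed_vector) set normed_sp" where
  "Linf_space \<mu> = ae_classes \<mu>
     {f. strongly_measurable \<mu> f \<and> esssup \<mu> (\<lambda>x. ennreal (norm (f x))) < \<infinity>}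
     (\<lambda>f. enn2real (esssup \<mu> (\<lambda>x. ennreal (norm (f x)))))"

end

theory Submission
  imports Defs
begin

text \<open>
  Let \<open>F\<close> be a Lipschitz compact map into one of the function spaces \<open>V\<close>. Up to a small error its
  difference quotients are finitely many vectors, and these are compressed by a linear contraction
  \<open>E\<close> into \<open>Y\<close> (evaluation at a point for \<open>C(K,Y)\<close>, the average over a set on which the vectors are almost
  constant for \<open>L\<^sub>\<infinity>\<close>) or into \<open>\<ell>\<^sub>p(Y)\<close> (averages over finitely many blocks for \<open>L\<^sub>p\<close>). A strongly norm
  attaining map close to \<open>E \<circ> F\<close> is put back in place of the compressed part of \<open>F\<close>, and it is arranged
  that the new map attains its norm at the same pair of points. Norming functionals, hence the
  Hahn-Banach theorem, are avoided by correcting with a real Lipschitz function on \<open>M\<close> instead.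

  All five target spaces consist of functions into \<open>Y\<close>, or of classes of such functions. The density
  statements are therefore transferred to functions (\<open>fun_space_repr\<close>), where the algebra is
  pointwise and only a seminorm is left. The base point disappears as well, since only difference
  quotients matter.
\<close>

text \<open>A norm attaining map close to the compressed one may stop attaining its norm once it is
  put back. Under a supremum norm the untouched rest of \<open>f\<close> competes with the new part.
  The compressed map is therefore first multiplied by a factor slightly above 1: the attaining slope
  then reaches the supremum of all slopes of \<open>f\<close>, and the maximum is decided in the
  small space. In L_p the parts of a function add up instead of competing, so the rest of
  \<open>f\<close> is dropped; this is a small change because the slopes of \<open>f\<close> are
  nearly constant on finitely many blocks. There the obstacle comes from the hypothesis: the
  approximating map takes values in all of l_p(Y), and its coordinates beyond the last block have no
  place in the image. In both cases compactness of \<open>f\<close> reduces its slopes to a finite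
  net, and linear contractions carry the estimates from the net to every other slope.\<close>

text \<open>Quantifying over sequences in \<open>S\<close> itself removes the closure: a sequence in
  the closure is replaced by one in \<open>S\<close> at distance below 1/(n+1), which has the same
  subsequential limits, and closedness returns these limits to the closure.\<close>

lemma (in Metric_space) relatively_compactin_sequentially:
  "relatively_compactin mtopology S \<longleftrightarrow> S \<subseteq> M \<and>
     (\<forall>\<sigma>::nat \<Rightarrow> 'a. range \<sigma> \<subseteq> S \<longrightarrow>
        (\<exists>l r. l \<in> M \<and> strict_mono r \<and> (\<lambda>i. d (\<sigma> (r i)) l) \<longlonglongrightarrow> 0))"
    (is "_ \<longleftrightarrow> _ \<and> ?seq")
proof -
  have lim: "limitin mtopology \<tau> l sequentially \<longleftrightarrow> l \<in> M \<and> (\<lambda>i. d (\<tau> i) l) \<longlonglongrightarrow> 0"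
    if "range \<tau> \<subseteq> M" for \<tau> l
    using that nonneg unfolding limitin_metric tendsto_iff
    by (auto simp: image_subset_iff dist_real_def)
  have "compactin mtopology (mtopology closure_of S) \<longleftrightarrow> ?seq" if S: "S \<subseteq> M"
  proof
    assume c: "compactin mtopology (mtopology closure_of S)"
    show ?seq
    proof (intro allI impI)
      fix \<sigma> :: "nat \<Rightarrow> 'a" assume \<sigma>: "range \<sigma> \<subseteq> S"
      have "S \<subseteq> mtopology closure_of S"
        using S by (simp add: closure_of_subset)
      then obtain l r where l: "l \<in> mtopology closure_of S" "strict_mono r"
        "limitin mtopology (\<sigma> \<circ> r) l sequentially"
        using c \<sigma> unfolding compactin_sequentially by (meson subset_trans)
      moreover have "range (\<sigma> \<circ> r) \<subseteq> M" using \<sigma> S by auto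
      ultimately show "\<exists>l r. l \<in> M \<and> strict_mono r \<and> (\<lambda>i. d (\<sigma> (r i)) l) \<longlonglongrightarrow> 0"
        using lim by (fastforce simp: o_def)
    qed
  next
    assume s: ?seq
    show "compactin mtopology (mtopology closure_of S)"
      unfolding compactin_sequentially
    proof (intro conjI allI impI)
      show "mtopology closure_of S \<subseteq> M"
        by (metis closure_of_subset_topspace topspace_mtopology)
      fix \<tau> :: "nat \<Rightarrow> 'a" assume \<tau>: "range \<tau> \<subseteq> mtopology closure_of S"
      have "\<exists>y\<in>S. \<tau> n \<in> M \<and> d (\<tau> n) y < inverse (real (Suc n))" for n
      proof -
        have "\<tau> n \<in> mtopology closure_of S" using \<tau> by auto
        then have "\<exists>y\<in>S. y \<in> mball (\<tau> n) (inverse (real (Suc n)))" "\<tau> n \<in> M"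
          unfolding metric_closure_of by (auto simp del: in_mball)
        then show ?thesis by auto
      qed
      then obtain \<sigma> where \<sigma>: "\<And>n. \<sigma> n \<in> S" "\<And>n. \<tau> n \<in> M"
        "\<And>n. d (\<tau> n) (\<sigma> n) < inverse (real (Suc n))"
        by metis
      then obtain l r where l: "l \<in> M" "strict_mono r" "(\<lambda>i. d (\<sigma> (r i)) l) \<longlonglongrightarrow> 0"
        using s by (meson image_subsetI)
      have z: "(\<lambda>i. inverse (real (Suc (r i))) + d (\<sigma> (r i)) l) \<longlonglongrightarrow> 0 + 0"
        using LIMSEQ_subseq_LIMSEQ[OF LIMSEQ_inverse_real_of_nat l(2)] l(3)
        by (intro tendsto_add) (auto simp: o_def)
      have b: "d (\<tau> (r i)) l \<le> inverse (real (Suc (r i))) + d (\<sigma> (r i)) l" for i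
        using triangle[of "\<tau> (r i)" "\<sigma> (r i)" l] \<sigma>(1)[of "r i"] \<sigma>(2,3)[of "r i"] l(1) S
        by (smt (verit) subsetD)
      have "(\<lambda>i. d (\<tau> (r i)) l) \<longlonglongrightarrow> 0"
        by (rule tendsto_sandwich[OF _ _ tendsto_const z[unfolded add_0]])
          (auto intro!: always_eventually b simp del: of_nat_Suc)
      then have t: "limitin mtopology (\<tau> \<circ> r) l sequentially"
        using lim[of "\<tau> \<circ> r" l] \<sigma>(2) l(1) by (auto simp: o_def)
      have "l \<in> mtopology closure_of S"
        by (rule limitin_closedin[OF t closedin_closure_of])
          (use \<tau> in \<open>auto simp: image_subset_iff\<close>)
      then show "\<exists>l r. l \<in> mtopology closure_of S \<and> strict_mono r \<and>
          limitin mtopology (\<tau> \<circ> r) l sequentially"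
        using t l(2) by blast
    qed
  qed
  then show ?thesis
    unfolding relatively_compactin_def by auto
qed

section \<open>Lipschitz maps into presented spaces\<close>

locale fun_space =
  fixes U :: "('x \<Rightarrow> 'y::real_normed_vector) set" and N :: "('x \<Rightarrow> 'y) \<Rightarrow> real"
  assumes zero_mem: "(\<lambda>x. 0) \<in> U"
    and add_mem: "f \<in> U \<Longrightarrow> g \<in> U \<Longrightarrow> (\<lambda>x. f x + g x) \<in> U"
    and scale_mem: "f \<in> U \<Longrightarrow> (\<lambda>x. c *\<^sub>R f x) \<in> U"
    and triangle: "f \<in> U \<Longrightarrow> g \<in> U \<Longrightarrow> N (\<lambda>x. f x + g x) \<le> N f + N g"
    and N_scale: "f \<in> U \<Longrightarrow> N (\<lambda>x. c *\<^sub>R f x) = \<bar>c\<bar> * N f"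
begin

lemma diff_mem: "f \<in> U \<Longrightarrow> g \<in> U \<Longrightarrow> (\<lambda>x. f x - g x) \<in> U"
  using add_mem[of f "\<lambda>x. (-1) *\<^sub>R g x"] scale_mem[of g "-1"] by simp

lemma N_zero: "N (\<lambda>x. 0) = 0"
  using N_scale[OF zero_mem, of 0] by simp

lemma N_minus: "f \<in> U \<Longrightarrow> N (\<lambda>x. - f x) = N f"
  using N_scale[of f "-1"] by simp

lemma N_minus_commute: "f \<in> U \<Longrightarrow> g \<in> U \<Longrightarrow> N (\<lambda>x. f x - g x) = N (\<lambda>x. g x - f x)"
  using N_minus[OF diff_mem, of f g] by simp

lemma N_nonneg: assumes "f \<in> U" shows "0 \<le> N f"
  using triangle[of f "\<lambda>x. - f x"] N_minus[of f] scale_mem[of f "-1"] assms N_zero by simp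

lemma N_diff_triangle:
  assumes "f \<in> U" "g \<in> U" "h \<in> U"
  shows "N (\<lambda>x. f x - h x) \<le> N (\<lambda>x. f x - g x) + N (\<lambda>x. g x - h x)"
  using triangle[OF diff_mem diff_mem, of f g g h] assms by simp

lemma N_diff_le: "f \<in> U \<Longrightarrow> g \<in> U \<Longrightarrow> N (\<lambda>x. f x - g x) \<le> N f + N g"
  using N_diff_triangle[of f "\<lambda>x. 0" g] zero_mem N_minus[of g] by simp

lemma N_le_add_diff: "f \<in> U \<Longrightarrow> g \<in> U \<Longrightarrow> N f \<le> N g + N (\<lambda>x. f x - g x)"
  using triangle[of g "\<lambda>x. f x - g x"] diff_mem[of f g] by simp

end

text \<open>An inequality for scalar multiples is enough: applied to the scalar 1/c it gives the
  reverse one.\<close>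

lemma fun_spaceI:
  assumes zero: "(\<lambda>x. 0) \<in> U"
    and add: "\<And>f g. f \<in> U \<Longrightarrow> g \<in> U \<Longrightarrow> (\<lambda>x. f x + g x) \<in> U"
    and scale: "\<And>f c. f \<in> U \<Longrightarrow> (\<lambda>x. c *\<^sub>R f x) \<in> U"
    and nonneg: "\<And>f. f \<in> U \<Longrightarrow> 0 \<le> N f"
    and triangle: "\<And>f g. f \<in> U \<Longrightarrow> g \<in> U \<Longrightarrow> N (\<lambda>x. f x + g x) \<le> N f + N g"
    and scale_le: "\<And>f c. f \<in> U \<Longrightarrow> N (\<lambda>x. c *\<^sub>R f x) \<le> \<bar>c\<bar> * N f"
  shows "fun_space U N"
proof
  fix f c assume f: "f \<in> U"
  show "N (\<lambda>x. c *\<^sub>R f x) = \<bar>c\<bar> * N f"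
  proof (cases "c = 0")
    case True
    then show ?thesis using scale_le[OF f, of 0] nonneg[OF zero] by simp
  next
    case False
    have "N f \<le> \<bar>1 / c\<bar> * N (\<lambda>x. c *\<^sub>R f x)"
      using scale_le[OF scale[OF f, of c], of "1 / c"] False by simp
    then have "\<bar>c\<bar> * N f \<le> N (\<lambda>x. c *\<^sub>R f x)"
      using False by (simp add: field_simps abs_if split: if_splits)
    then show ?thesis using scale_le[OF f, of c] by simp
  qed
qed (use assms in auto)

section \<open>Slopes, compactness and norm attainment for maps into a function space\<close>

definition slope :: "('m::metric_space \<Rightarrow> 'x \<Rightarrow> 'y::real_normed_vector) \<Rightarrow> 'm \<Rightarrow> 'm \<Rightarrow> 'x \<Rightarrow> 'y" where
  "slope f p q = (\<lambda>x. (1 / dist p q) *\<^sub>R (f p x - f q x))"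

text \<open>Lipschitz compactness in sequential form, with limits in the seminorm. A Lipschitz bound
  is not part of it because it follows, see \<open>lipK_bounded\<close>.\<close>

definition lipK :: "('x \<Rightarrow> 'y::real_normed_vector) set \<Rightarrow> (('x \<Rightarrow> 'y) \<Rightarrow> real) \<Rightarrow>
    ('m::metric_space \<Rightarrow> 'x \<Rightarrow> 'y) \<Rightarrow> bool" where
  "lipK U N f \<longleftrightarrow> (\<forall>p. f p \<in> U) \<and>
     (\<forall>p q. (\<forall>i::nat. p i \<noteq> q i) \<longrightarrow> (\<exists>l r. l \<in> U \<and> strict_mono r \<and>
        (\<lambda>i. N (\<lambda>x. slope f (p (r i)) (q (r i)) x - l x)) \<longlonglongrightarrow> 0))"

text \<open>Attainment is maximality among the slopes, without a supremum, so that it makes sense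
  before any bound is known.\<close>

definition attains :: "(('x \<Rightarrow> 'y::real_normed_vector) \<Rightarrow> real) \<Rightarrow>
    ('m::metric_space \<Rightarrow> 'x \<Rightarrow> 'y) \<Rightarrow> bool" where
  "attains N f \<longleftrightarrow>
     (\<exists>p q. p \<noteq> q \<and> (\<forall>p' q'. p' \<noteq> q' \<longrightarrow> N (slope f p' q') \<le> N (slope f p q)))"

abbreviation slopes_close :: "(('x \<Rightarrow> 'y::real_normed_vector) \<Rightarrow> real) \<Rightarrow>
    ('m::metric_space \<Rightarrow> 'x \<Rightarrow> 'y) \<Rightarrow> ('m \<Rightarrow> 'x \<Rightarrow> 'y) \<Rightarrow> real \<Rightarrow> bool" where
  "slopes_close N f g e \<equiv> \<forall>p q. p \<noteq> q \<longrightarrow> N (\<lambda>x. slope f p q x - slope g p q x) \<le> e"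

text \<open>The argument \<open>T\<close> only fixes the domain type, which cannot be read off from
  \<open>U\<close> and \<open>N\<close>.\<close>

definition dense_attaining :: "'m::metric_space itself \<Rightarrow> ('x \<Rightarrow> 'y::real_normed_vector) set \<Rightarrow>
    (('x \<Rightarrow> 'y) \<Rightarrow> real) \<Rightarrow> bool" where
  "dense_attaining T U N \<longleftrightarrow>
     (\<forall>f::'m \<Rightarrow> 'x \<Rightarrow> 'y. \<forall>e>0. lipK U N f \<longrightarrow> (\<exists>g. lipK U N g \<and> attains N g \<and>
        slopes_close N f g e))"

context fun_space begin

lemma slope_mem: "(\<And>p. f p \<in> U) \<Longrightarrow> slope f p q \<in> U"
  unfolding slope_def by (intro scale_mem diff_mem)

lemma lipK_memD: "lipK U N f \<Longrightarrow> f p \<in> U"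
  by (simp add: lipK_def)

text \<open>Slopes whose n-th norm exceeds n would have a convergent, hence bounded,
  subsequence.\<close>

lemma lipK_bounded:
  assumes "lipK U N f"
  shows "\<exists>L. \<forall>p q. p \<noteq> q \<longrightarrow> N (slope f p q) \<le> L"
proof (rule ccontr)
  assume "\<not> ?thesis"
  then have "\<forall>n::nat. \<exists>p q. p \<noteq> q \<and> N (slope f p q) > real n"
    by (meson not_le)
  then obtain p q where pq: "\<And>n::nat. p n \<noteq> q n" "\<And>n. N (slope f (p n) (q n)) > real n"
    by metis
  then obtain l r where l: "l \<in> U" "strict_mono r"
    "(\<lambda>i. N (\<lambda>x. slope f (p (r i)) (q (r i)) x - l x)) \<longlonglongrightarrow> 0"
    using assms[unfolded lipK_def, THEN conjunct2, rule_format, of p q] by blast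
  have "Bseq (\<lambda>i. N (\<lambda>x. slope f (p (r i)) (q (r i)) x - l x))"
    by (rule convergent_imp_Bseq[OF convergentI[OF l(3)]])
  then obtain B where B: "\<And>i. norm (N (\<lambda>x. slope f (p (r i)) (q (r i)) x - l x)) \<le> B"
    by (rule BseqE) blast
  obtain n :: nat where n: "real n > B + N l" using reals_Archimedean2 by blast
  have "N (slope f (p (r n)) (q (r n))) \<le> N l + B"
    using N_le_add_diff[of "slope f (p (r n)) (q (r n))" l, OF slope_mem[OF lipK_memD[OF assms]] l(1)] B[of n]
    by simp
  moreover have "real n \<le> real (r n)" using seq_suble[OF l(2)] by simp
  ultimately show False using pq(2)[of "r n"] n by linarith
qed

text \<open>Total boundedness of the set of slopes. Without a finite net one can choose infinitely
  many slopes at mutual distance at least \<open>e\<close>; two late terms of a convergent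
  subsequence are both within \<open>e / 2\<close> of the limit.\<close>

lemma lipK_net:
  assumes "lipK U N f" "e > 0"
  shows "\<exists>P. finite P \<and> (\<forall>(p, q)\<in>P. p \<noteq> q) \<and>
    (\<forall>p q. p \<noteq> q \<longrightarrow> (\<exists>(p', q')\<in>P. N (\<lambda>x. slope f p q x - slope f p' q' x) < e))"
proof (rule ccontr)
  define D where "D = (\<lambda>z w. N (\<lambda>x. slope f (fst z) (snd z) x - slope f (fst w) (snd w) x))"
  assume neg: "\<not> ?thesis"
  have ex: "\<exists>z. fst z \<noteq> snd z \<and> (\<forall>w\<in>P. e \<le> D z w)"
    if "finite P" "\<And>w. w \<in> P \<Longrightarrow> fst w \<noteq> snd w" for P
  proof -
    have P: "\<forall>(p, q)\<in>P. p \<noteq> q" using that(2) by force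
    have "\<not> (\<forall>p q. p \<noteq> q \<longrightarrow> (\<exists>(p', q')\<in>P. N (\<lambda>x. slope f p q x - slope f p' q' x) < e))"
      by (rule notI, rule notE[OF neg], rule exI[of _ P]) (intro conjI that(1) P)
    then obtain p q where
      "p \<noteq> q" "\<not> (\<exists>(p', q')\<in>P. N (\<lambda>x. slope f p q x - slope f p' q' x) < e)"
      unfolding not_all not_imp by (elim exE conjE)
    then show ?thesis unfolding D_def by (intro exI[of _ "(p, q)"]) (auto simp: not_less)
  qed
  define ok where "ok = (\<lambda>z P. fst z \<noteq> snd z \<and> (\<forall>w\<in>P. e \<le> D z w))"
  have "\<exists>zs::nat \<Rightarrow> 'a \<times> 'a. \<forall>n. ok (zs n) (zs ` {..<n})"
  proof -
    \<comment> \<open>The state of the dependent choice is the list of all pairs chosen so far, so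
      that the next pair can be kept away from each of them.\<close>
    have "\<exists>Q. \<forall>n. (\<lambda>l. finite (set l) \<and> (\<forall>w\<in>set l. fst w \<noteq> snd w) \<and> length l = n) (Q n) \<and>
        (\<exists>z. ok z (set (Q n)) \<and> Q (Suc n) = Q n @ [z])"
    proof (rule dependent_nat_choice, goal_cases)
      case (2 l n)
      then obtain z where z: "ok z (set l)" using ex[of "set l"] unfolding ok_def by blast
      show ?case
        by (rule exI[of _ "l @ [z]"], intro conjI exI[of _ z]) (use 2 z in \<open>auto simp: ok_def\<close>)
    qed auto
    then obtain Q where Q: "\<And>n. length (Q n) = n"
      "\<And>n. \<exists>z. ok z (set (Q n)) \<and> Q (Suc n) = Q n @ [z]" by metis
    then obtain zs where zs: "\<And>n. ok (zs n) (set (Q n))" "\<And>n. Q (Suc n) = Q n @ [zs n]" by metis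
    have "set (Q n) = zs ` {..<n}" for n
      by (induction n) (use Q(1)[of 0] zs(2) in \<open>auto simp: lessThan_Suc\<close>)
    then show ?thesis using zs(1) by metis
  qed
  then obtain zs where zs: "\<And>n. fst (zs n) \<noteq> snd (zs n)" "\<And>m n::nat. m < n \<Longrightarrow> e \<le> D (zs n) (zs m)"
    unfolding ok_def by blast
  obtain l r where l: "l \<in> U" "strict_mono r"
    "(\<lambda>i. N (\<lambda>x. slope f (fst (zs (r i))) (snd (zs (r i))) x - l x)) \<longlonglongrightarrow> 0"
    using assms(1)[unfolded lipK_def, THEN conjunct2, rule_format,
      of "\<lambda>i. fst (zs i)" "\<lambda>i. snd (zs i)"] zs(1) by blast
  have m: "slope f p q \<in> U" for p q using slope_mem lipK_memD[OF assms(1)] by blast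
  have "\<forall>\<^sub>F i in sequentially. N (\<lambda>x. slope f (fst (zs (r i))) (snd (zs (r i))) x - l x) < e / 2"
    by (rule order_tendstoD(2)[OF l(3)]) (use assms(2) in simp)
  then obtain k where k: "\<And>i. i \<ge> k \<Longrightarrow> N (\<lambda>x. slope f (fst (zs (r i))) (snd (zs (r i))) x - l x) < e / 2"
    unfolding eventually_sequentially by blast
  have "D (zs (r (Suc k))) (zs (r k)) < e"
    using N_diff_triangle[OF m l(1) m, of "fst (zs (r (Suc k)))" "snd (zs (r (Suc k)))" "fst (zs (r k))" "snd (zs (r k))"]
      k[of k] k[of "Suc k"] N_minus_commute[OF l(1) m, of "fst (zs (r k))" "snd (zs (r k))"]
    unfolding D_def by simp
  moreover have "r k < r (Suc k)" using l(2) by (simp add: strict_mono_def)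
  ultimately show False using zs(2)[of "r k" "r (Suc k)"] by simp
qed

end

section \<open>Presenting a normed space by functions\<close>

text \<open>\<open>\<pi>\<close> is a linear surjection whose kernel is the null space of the
  seminorm: evaluation at the only point for \<open>Y\<close>, restriction for C(K,Y), the identity
  for sequences, and the class map for the spaces of almost everywhere classes.\<close>

locale fun_space_repr = fun_space U N
  for U :: "('x \<Rightarrow> 'y::real_normed_vector) set" and N :: "('x \<Rightarrow> 'y) \<Rightarrow> real" +
  fixes V :: "'v normed_sp" and \<pi> :: "('x \<Rightarrow> 'y) \<Rightarrow> 'v"
  assumes carrier: "ns_carrier V = \<pi> ` U"
    and zero: "ns_zero V = \<pi> (\<lambda>x. 0)"
    and add: "f \<in> U \<Longrightarrow> g \<in> U \<Longrightarrow> ns_add V (\<pi> f) (\<pi> g) = \<pi> (\<lambda>x. f x + g x)"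
    and scale: "f \<in> U \<Longrightarrow> ns_scale V c (\<pi> f) = \<pi> (\<lambda>x. c *\<^sub>R f x)"
    and norm: "f \<in> U \<Longrightarrow> ns_norm V (\<pi> f) = N f"
    and eqI: "f \<in> U \<Longrightarrow> g \<in> U \<Longrightarrow> N (\<lambda>x. f x - g x) = 0 \<Longrightarrow> \<pi> f = \<pi> g"
begin

lemma pi_diff: "f \<in> U \<Longrightarrow> g \<in> U \<Longrightarrow> ns_diff V (\<pi> f) (\<pi> g) = \<pi> (\<lambda>x. f x - g x)"
  using scale_mem[of g "-1"] by (simp add: ns_diff_def scale add)

lemma norm_pi_diff: "f \<in> U \<Longrightarrow> g \<in> U \<Longrightarrow> ns_norm V (ns_diff V (\<pi> f) (\<pi> g)) = N (\<lambda>x. f x - g x)"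
  by (simp add: pi_diff norm diff_mem)

lemma dist_pi: "f \<in> U \<Longrightarrow> g \<in> U \<Longrightarrow> ns_dist V (\<pi> f) (\<pi> g) = N (\<lambda>x. f x - g x)"
  by (simp add: ns_dist_def carrier norm_pi_diff)

lemma N_eq0_iff: "f \<in> U \<Longrightarrow> g \<in> U \<Longrightarrow> N (\<lambda>x. f x - g x) = 0 \<longleftrightarrow> \<pi> f = \<pi> g"
  using eqI[of f g] norm_pi_diff[of f g] norm_pi_diff[of g g] N_zero by auto

lemma metric: "Metric_space (ns_carrier V) (ns_dist V)"
proof
  fix x y z
  show "0 \<le> ns_dist V x y" "ns_dist V x y = ns_dist V y x"
    by (auto simp: ns_dist_def carrier norm_pi_diff intro!: N_nonneg[OF diff_mem] N_minus_commute)
  show "ns_dist V x y = 0 \<longleftrightarrow> x = y" if "x \<in> ns_carrier V" "y \<in> ns_carrier V"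
    using that by (auto simp: carrier dist_pi N_eq0_iff N_zero)
  show "ns_dist V x z \<le> ns_dist V x y + ns_dist V y z"
    if "x \<in> ns_carrier V" "y \<in> ns_carrier V" "z \<in> ns_carrier V"
    using that by (auto simp: carrier dist_pi N_diff_triangle)
qed

lemma slope_pi:
  assumes "\<And>p. f p \<in> U"
  shows "ns_scale V (1 / dist p q) (ns_diff V (\<pi> (f p)) (\<pi> (f q))) = \<pi> (slope f p q)"
  unfolding slope_def using assms by (simp add: pi_diff scale diff_mem)

lemma norm_slope_pi:
  assumes "\<And>p. f p \<in> U"
  shows "ns_norm V (ns_diff V (\<pi> (f p)) (\<pi> (f q))) / dist p q = N (slope f p q)"
  unfolding slope_def using assms by (simp add: norm_pi_diff N_scale diff_mem)

lemma relcompact_slopes_iff: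
  assumes f: "\<And>p. f p \<in> U"
  shows "relatively_compactin (ns_topology V)
      {ns_scale V (1 / dist p q) (ns_diff V (\<pi> (f p)) (\<pi> (f q))) | p q. p \<noteq> q} \<longleftrightarrow> lipK U N f"
proof -
  interpret Metric_space "ns_carrier V" "ns_dist V" by (rule metric)
  let ?S = "{\<pi> (slope f p q) | p q. p \<noteq> q}"
  have sm: "slope f p q \<in> U" for p q by (rule slope_mem[OF f])
  then have sub: "?S \<subseteq> ns_carrier V" by (auto simp: carrier)
  have "relatively_compactin mtopology ?S \<longleftrightarrow> lipK U N f"
    unfolding relatively_compactin_sequentially lipK_def
  proof (intro iffI conjI allI impI sub f)
    fix p q :: "nat \<Rightarrow> 'a" assume pq: "\<forall>i. p i \<noteq> q i"
    assume "?S \<subseteq> ns_carrier V \<and> (\<forall>\<sigma>::nat \<Rightarrow> _. range \<sigma> \<subseteq> ?S \<longrightarrow>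
      (\<exists>l r. l \<in> ns_carrier V \<and> strict_mono r \<and> (\<lambda>i. ns_dist V (\<sigma> (r i)) l) \<longlonglongrightarrow> 0))"
    then have *: "range \<sigma> \<subseteq> ?S \<Longrightarrow>
      \<exists>l r. l \<in> ns_carrier V \<and> strict_mono r \<and> (\<lambda>i. ns_dist V (\<sigma> (r i)) l) \<longlonglongrightarrow> 0"
      for \<sigma> :: "nat \<Rightarrow> _" by blast
    have "\<exists>l r. l \<in> ns_carrier V \<and> strict_mono r \<and>
        (\<lambda>i. ns_dist V (\<pi> (slope f (p (r i)) (q (r i)))) l) \<longlonglongrightarrow> 0"
      by (rule *) (use pq in auto)
    then obtain l r where "l \<in> U" "strict_mono r"
      "(\<lambda>i. ns_dist V (\<pi> (slope f (p (r i)) (q (r i)))) (\<pi> l)) \<longlonglongrightarrow> 0"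
      by (auto simp: carrier)
    then show "\<exists>l r. l \<in> U \<and> strict_mono r \<and>
        (\<lambda>i. N (\<lambda>x. slope f (p (r i)) (q (r i)) x - l x)) \<longlonglongrightarrow> 0"
      using sm by (auto simp: dist_pi)
  next
    fix \<sigma> :: "nat \<Rightarrow> 'v" assume \<sigma>: "range \<sigma> \<subseteq> ?S"
    assume K: "(\<forall>p. f p \<in> U) \<and> (\<forall>p q. (\<forall>i::nat. p i \<noteq> q i) \<longrightarrow> (\<exists>l r. l \<in> U \<and> strict_mono r \<and>
        (\<lambda>i. N (\<lambda>x. slope f (p (r i)) (q (r i)) x - l x)) \<longlonglongrightarrow> 0))"
    have "\<forall>i. \<exists>p q. \<sigma> i = \<pi> (slope f p q) \<and> p \<noteq> q" using \<sigma> by fastforce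
    then obtain p q where pq: "\<And>i. \<sigma> i = \<pi> (slope f (p i) (q i))" "\<And>i. p i \<noteq> q i" by metis
    then obtain l r where "l \<in> U" "strict_mono r"
        "(\<lambda>i. N (\<lambda>x. slope f (p (r i)) (q (r i)) x - l x)) \<longlonglongrightarrow> 0"
      using K[THEN conjunct2, rule_format, of p q] by blast
    then show "\<exists>l r. l \<in> ns_carrier V \<and> strict_mono r \<and> (\<lambda>i. ns_dist V (\<sigma> (r i)) l) \<longlonglongrightarrow> 0"
      using sm by (intro exI[of _ "\<pi> l"] exI[of _ r]) (auto simp: pq(1) dist_pi carrier)
  qed
  then show ?thesis by (simp add: slope_pi[of f, OF f] ns_topology_def)
qed

text \<open>The bound \<open>L\<close> gives the real supremum in \<open>lip_norm\<close> its
  meaning. The adjoined 0 does not change a maximum, since \<open>N\<close> is nonnegative and some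
  pair of distinct points is present.\<close>

lemma attains_iff:
  fixes f :: "'m::metric_space \<Rightarrow> 'x \<Rightarrow> 'y"
  assumes f: "\<And>p. f p \<in> U" and bd: "\<And>p q. p \<noteq> q \<Longrightarrow> N (slope f p q) \<le> L"
  shows "strongly_attains_norm V (\<lambda>p. \<pi> (f p)) \<longleftrightarrow> attains N f"
proof -
  let ?S = "insert 0 {N (slope f p q) | p q. p \<noteq> q}"
  have bdd: "bdd_above ?S" using bd by (auto intro!: bdd_aboveI[of _ "max 0 L"] simp: le_max_iff_disj)
  have *: "N (slope f p q) = Sup ?S \<longleftrightarrow> (\<forall>p' q'. p' \<noteq> q' \<longrightarrow> N (slope f p' q') \<le> N (slope f p q))"
    if "p \<noteq> q" for p q
  proof
    assume eq: "N (slope f p q) = Sup ?S"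
    show "\<forall>p' q'. p' \<noteq> q' \<longrightarrow> N (slope f p' q') \<le> N (slope f p q)"
      unfolding eq by (auto intro!: cSup_upper bdd)
  next
    assume "\<forall>p' q'. p' \<noteq> q' \<longrightarrow> N (slope f p' q') \<le> N (slope f p q)"
    then show "N (slope f p q) = Sup ?S"
      using that N_nonneg[OF slope_mem[OF f]] by (intro cSup_eq_maximum[symmetric]) auto
  qed
  show ?thesis
    unfolding strongly_attains_norm_def attains_def lip_norm_def norm_slope_pi[of f, OF f] using * by (simp cong: conj_cong)
qed

text \<open>
  The Lipschitz maps into \<open>V\<close> are themselves presented by functions, now of two variables.
\<close>

definition lip_fun :: "'m::metric_space \<Rightarrow> ('m \<times> 'x \<Rightarrow> 'y) set" where
  "lip_fun z = {h. (\<forall>p. (\<lambda>x. h (p, x)) \<in> U) \<and> N (\<lambda>x. h (z, x)) = 0 \<and>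
     (\<exists>L. \<forall>p q. N (\<lambda>x. h (p, x) - h (q, x)) \<le> L * dist p q)}"

definition lip_N :: "('m::metric_space \<times> 'x \<Rightarrow> 'y) \<Rightarrow> real" where
  "lip_N h = Sup (insert 0 {N (\<lambda>x. h (p, x) - h (q, x)) / dist p q | p q. p \<noteq> q})"

lemma lip_fun_quot_le:
  assumes "h \<in> lip_fun z" "p \<noteq> q"
  shows "N (\<lambda>x. h (p, x) - h (q, x)) / dist p q \<le> lip_N h"
proof -
  obtain L where "\<And>p q. N (\<lambda>x. h (p, x) - h (q, x)) \<le> L * dist p q"
    using assms(1) by (auto simp: lip_fun_def)
  then have "bdd_above (insert 0 {N (\<lambda>x. h (p, x) - h (q, x)) / dist p q | p q. p \<noteq> q})"
    by (intro bdd_aboveI[of _ "max 0 L"]) (auto simp: divide_le_eq le_max_iff_disj)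
  then show ?thesis unfolding lip_N_def using assms(2) by (intro cSup_upper) auto
qed

lemma lip_N_leI:
  assumes "0 \<le> L" "\<And>p q. p \<noteq> q \<Longrightarrow> N (\<lambda>x. h (p, x) - h (q, x)) / dist p q \<le> L"
  shows "lip_N h \<le> L"
  unfolding lip_N_def using assms by (intro cSup_least) auto

lemma lip_N_nonneg: assumes "h \<in> lip_fun z" shows "0 \<le> lip_N h"
proof -
  obtain L where "\<And>p q. N (\<lambda>x. h (p, x) - h (q, x)) \<le> L * dist p q"
    using assms(1) by (auto simp: lip_fun_def)
  then have "bdd_above (insert 0 {N (\<lambda>x. h (p, x) - h (q, x)) / dist p q | p q. p \<noteq> q})"
    by (intro bdd_aboveI[of _ "max 0 L"]) (auto simp: divide_le_eq le_max_iff_disj)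
  then show ?thesis unfolding lip_N_def by (intro cSup_upper) auto
qed

lemma lip_fun_memD: "h \<in> lip_fun z \<Longrightarrow> (\<lambda>x. h (p, x)) \<in> U"
  by (simp add: lip_fun_def)

lemma lip_fun_addD:
  assumes "f \<in> lip_fun z" "g \<in> lip_fun z"
  shows "(\<lambda>x. f x + g x) \<in> lip_fun z" "lip_N (\<lambda>x. f x + g x) \<le> lip_N f + lip_N g"
proof -
  have tri: "N (\<lambda>x. f (p, x) + g (p, x) - (f (q, x) + g (q, x))) \<le>
      N (\<lambda>x. f (p, x) - f (q, x)) + N (\<lambda>x. g (p, x) - g (q, x))" for p q
    using triangle[OF diff_mem diff_mem, OF lip_fun_memD[OF assms(1)] lip_fun_memD[OF assms(1)]
        lip_fun_memD[OF assms(2)] lip_fun_memD[OF assms(2)], of p q p q]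
    by (simp add: algebra_simps)
  obtain L1 L2 where "\<And>p q. N (\<lambda>x. f (p, x) - f (q, x)) \<le> L1 * dist p q"
    "\<And>p q. N (\<lambda>x. g (p, x) - g (q, x)) \<le> L2 * dist p q"
    using assms by (auto simp: lip_fun_def)
  then have "N (\<lambda>x. f (p, x) + g (p, x) - (f (q, x) + g (q, x))) \<le> (L1 + L2) * dist p q" for p q
    by (intro order_trans[OF tri]) (simp add: distrib_right add_mono)
  moreover have "N (\<lambda>x. f (z, x) + g (z, x)) = 0"
    using triangle[OF lip_fun_memD[OF assms(1)] lip_fun_memD[OF assms(2)], of z z]
      N_nonneg[OF add_mem[OF lip_fun_memD[OF assms(1)] lip_fun_memD[OF assms(2)]], of z z] assms
    by (simp add: lip_fun_def)
  ultimately show "(\<lambda>x. f x + g x) \<in> lip_fun z"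
    using assms by (auto simp: lip_fun_def intro!: add_mem)
  show "lip_N (\<lambda>x. f x + g x) \<le> lip_N f + lip_N g"
  proof (rule lip_N_leI)
    show "0 \<le> lip_N f + lip_N g" by (intro add_nonneg_nonneg lip_N_nonneg[OF assms(1)] lip_N_nonneg[OF assms(2)])
    fix p q :: 'a assume "p \<noteq> q"
    then show "N (\<lambda>x. f (p, x) + g (p, x) - (f (q, x) + g (q, x))) / dist p q \<le> lip_N f + lip_N g"
      using lip_fun_quot_le[OF assms(1)] lip_fun_quot_le[OF assms(2)]
      by (intro order_trans[OF divide_right_mono[OF tri]]) (simp_all add: add_divide_distrib add_mono)
  qed
qed

lemma lip_fun_scaleD:
  assumes f: "f \<in> lip_fun z"
  shows "(\<lambda>x. c *\<^sub>R f x) \<in> lip_fun z" "lip_N (\<lambda>x. c *\<^sub>R f x) \<le> \<bar>c\<bar> * lip_N f"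
proof -
  have eq: "N (\<lambda>x. c *\<^sub>R f (p, x) - c *\<^sub>R f (q, x)) = \<bar>c\<bar> * N (\<lambda>x. f (p, x) - f (q, x))" for p q
    using N_scale[OF diff_mem[OF lip_fun_memD[OF f] lip_fun_memD[OF f]], of c p q]
    by (simp add: scaleR_diff_right)
  obtain L where "\<And>p q. N (\<lambda>x. f (p, x) - f (q, x)) \<le> L * dist p q"
    using f by (auto simp: lip_fun_def)
  then have "\<bar>c\<bar> * N (\<lambda>x. f (p, x) - f (q, x)) \<le> (\<bar>c\<bar> * L) * dist p q" for p q
    by (metis abs_ge_zero mult.assoc mult_left_mono)
  moreover have "N (\<lambda>x. c *\<^sub>R f (z, x)) = 0"
    using N_scale[OF lip_fun_memD[OF f], of c z] f by (simp add: lip_fun_def)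
  ultimately show "(\<lambda>x. c *\<^sub>R f x) \<in> lip_fun z"
    using f eq scale_mem[OF lip_fun_memD[OF f]] by (simp add: lip_fun_def) blast
  show "lip_N (\<lambda>x. c *\<^sub>R f x) \<le> \<bar>c\<bar> * lip_N f"
    by (rule lip_N_leI)
      (use lip_N_nonneg[OF f] lip_fun_quot_le[OF f] in
        \<open>auto simp: eq mult_left_mono simp flip: times_divide_eq_right\<close>)
qed

lemma fun_space_lip_fun: "fun_space (lip_fun z) lip_N"
proof (rule fun_spaceI)
  show "(\<lambda>x. 0) \<in> lip_fun z"
    by (auto simp: lip_fun_def zero_mem N_zero intro!: exI[of _ 0])
qed (auto intro: lip_fun_addD lip_fun_scaleD lip_N_nonneg)

text \<open>With this the metric facts proved for \<open>V\<close> hold for the space of Lipschitz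
  maps as well. The base point condition in \<open>lip_fun\<close> is a vanishing seminorm, because
  a representative of zero need not be the zero function.\<close>

lemma Lip0_repr:
  "fun_space_repr (lip_fun z) lip_N (Lip0 z V) (\<lambda>h p. \<pi> (\<lambda>x. h (p, x)))"
proof (intro fun_space_repr.intro fun_space_lip_fun fun_space_repr_axioms.intro)
  fix f g :: "'a \<times> 'x \<Rightarrow> 'y" and c :: real
  assume f: "f \<in> lip_fun z"
  show "ns_scale (Lip0 z V) c (\<lambda>p. \<pi> (\<lambda>x. f (p, x))) = (\<lambda>p. \<pi> (\<lambda>x. c *\<^sub>R f (p, x)))"
    using lip_fun_memD[OF f] by (auto simp: Lip0_def scale)
  show "ns_norm (Lip0 z V) (\<lambda>p. \<pi> (\<lambda>x. f (p, x))) = lip_N f"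
    using lip_fun_memD[OF f] by (simp add: Lip0_def lip_norm_def lip_N_def norm_pi_diff)
  assume g: "g \<in> lip_fun z"
  show "ns_add (Lip0 z V) (\<lambda>p. \<pi> (\<lambda>x. f (p, x))) (\<lambda>p. \<pi> (\<lambda>x. g (p, x))) =
      (\<lambda>p. \<pi> (\<lambda>x. f (p, x) + g (p, x)))"
    using lip_fun_memD[OF f] lip_fun_memD[OF g] by (auto simp: Lip0_def add)
  assume 0: "lip_N (\<lambda>x. f x - g x) = 0"
  have fg: "(\<lambda>x. f x - g x) \<in> lip_fun z"
    using lip_fun_addD(1)[OF f lip_fun_scaleD(1)[OF g], of "-1"] by simp
  have "\<pi> (\<lambda>x. f (p, x)) = \<pi> (\<lambda>x. g (p, x))" for p
  proof (rule eqI[OF lip_fun_memD[OF f] lip_fun_memD[OF g]])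
    let ?h = "\<lambda>p x. f (p, x) - g (p, x)"
    have m: "?h p \<in> U" for p using lip_fun_memD[OF fg] by simp
    have z: "N (?h z) = 0" using fg by (simp add: lip_fun_def)
    \<comment> \<open>A vanishing \<open>lip_N\<close> controls differences only. Comparison with
      the base point, where the value is null, turns this into \<open>N (?h p) = 0\<close>.\<close>
    have "N (\<lambda>x. ?h p x - ?h z x) \<le> 0"
    proof (cases "p = z")
      case False
      then show ?thesis
        using lip_fun_quot_le[OF fg, of p z] by (simp add: 0 divide_le_0_iff)
    qed (simp add: N_zero)
    then show "N (?h p) = 0"
      using N_le_add_diff[OF m m, of p z] z N_nonneg[OF m, of p] by simp
  qed
  then show "(\<lambda>p. \<pi> (\<lambda>x. f (p, x))) = (\<lambda>p. \<pi> (\<lambda>x. g (p, x)))" by simp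
next
  show "ns_zero (Lip0 z V) = (\<lambda>p. \<pi> (\<lambda>x. 0))" by (simp add: Lip0_def zero)
  show "ns_carrier (Lip0 z V) = (\<lambda>h p. \<pi> (\<lambda>x. h (p, x))) ` lip_fun z"
  proof (intro set_eqI iffI)
    fix F assume F: "F \<in> ns_carrier (Lip0 z V)"
    then have "F p \<in> \<pi> ` U" for p by (auto simp: Lip0_def carrier image_subset_iff)
    then have "\<forall>p. \<exists>f\<in>U. F p = \<pi> f" by blast
    then obtain f where f: "\<And>p. f p \<in> U" "\<And>p. F p = \<pi> (f p)" by metis
    have "(\<lambda>(p, x). f p x) \<in> lip_fun z"
      using F f N_eq0_iff[OF f(1) zero_mem, of z]
      by (auto simp: lip_fun_def Lip0_def norm_pi_diff zero)
    moreover have "F = (\<lambda>p. \<pi> (\<lambda>x. (\<lambda>(p, x). f p x) (p, x)))" using f(2) by auto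
    ultimately show "F \<in> (\<lambda>h p. \<pi> (\<lambda>x. h (p, x))) ` lip_fun z" by blast
  next
    fix F assume "F \<in> (\<lambda>h p. \<pi> (\<lambda>x. h (p, x))) ` lip_fun z"
    then obtain h where h: "h \<in> lip_fun z" "F = (\<lambda>p. \<pi> (\<lambda>x. h (p, x)))" by blast
    then show "F \<in> ns_carrier (Lip0 z V)"
      using N_eq0_iff[OF lip_fun_memD[OF h(1), of z] zero_mem] lip_fun_memD[OF h(1)]
      by (auto simp: lip_fun_def Lip0_def carrier norm_pi_diff zero)
  qed
qed

end

lemma LIMSEQ_0_sandwich:
  fixes a b :: "nat \<Rightarrow> real"
  assumes "b \<longlonglongrightarrow> 0" "\<And>i. a i \<le> b i" "\<And>i. 0 \<le> a i"
  shows "a \<longlonglongrightarrow> 0"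
  by (rule tendsto_sandwich[OF _ _ tendsto_const assms(1)]) (auto intro: always_eventually assms(2,3))

context fun_space begin

lemma slope_diff_quot:
  assumes "\<And>p. f p \<in> U" "\<And>p. g p \<in> U"
  shows "N (\<lambda>x. f p x - g p x - (f q x - g q x)) / dist p q = N (\<lambda>x. slope f p q x - slope g p q x)"
proof -
  have "(\<lambda>x. slope f p q x - slope g p q x) =
      (\<lambda>x. (1 / dist p q) *\<^sub>R ((f p x - g p x) - (f q x - g q x)))"
    by (auto simp: slope_def algebra_simps)
  then show ?thesis
    using N_scale[OF diff_mem[OF diff_mem[OF assms] diff_mem[OF assms]], of "1 / dist p q" p p q q] by simp
qed

end

section \<open>Translation of the density statement\<close>

context fun_space_repr begin

lemma lip_fun_iff:
  fixes f :: "'m::metric_space \<Rightarrow> 'x \<Rightarrow> 'y"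
  shows "(\<lambda>(p, x). f p x) \<in> lip_fun z \<longleftrightarrow>
    (\<forall>p. f p \<in> U) \<and> N (f z) = 0 \<and> (\<exists>L. \<forall>p q. p \<noteq> q \<longrightarrow> N (slope f p q) \<le> L)"
proof (cases "\<forall>p. f p \<in> U")
  case True
  have *: "N (slope f p q) = N (\<lambda>x. f p x - f q x) / dist p q" for p q
    unfolding slope_def using True by (simp add: N_scale diff_mem)
  have "(\<exists>L. \<forall>p q. N (\<lambda>x. f p x - f q x) \<le> L * dist p q) \<longleftrightarrow>
      (\<exists>L. \<forall>p q. p \<noteq> q \<longrightarrow> N (slope f p q) \<le> L)"
    (is "(\<exists>L. ?A L) \<longleftrightarrow> (\<exists>L. ?B L)")
  proof -
    have "?A L \<longleftrightarrow> ?B L" for L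
    proof
      assume "?A L"
      then show "?B L" by (simp add: * divide_le_eq)
    next
      assume B: "?B L"
      show "?A L"
      proof (intro allI)
        fix p q show "N (\<lambda>x. f p x - f q x) \<le> L * dist p q"
          using B[rule_format, of p q] by (cases "p = q") (simp_all add: * divide_le_eq N_zero)
      qed
    qed
    then show ?thesis by simp
  qed
  then show ?thesis using True by (simp add: lip_fun_def)
qed (auto simp: lip_fun_def)

lemma Lip0K_pi_iff:
  assumes f: "\<And>p. f p \<in> U" and z: "N (f z) = 0"
  shows "(\<lambda>p. \<pi> (f p)) \<in> Lip0K z V \<longleftrightarrow> lipK U N f"
proof -
  interpret L: fun_space_repr "lip_fun z" lip_N "Lip0 z V" "\<lambda>h p. \<pi> (\<lambda>x. h (p, x))"
    by (rule Lip0_repr)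
  have "(\<lambda>p. \<pi> (f p)) \<in> ns_carrier (Lip0 z V)" if "lipK U N f"
  proof -
    have "(\<lambda>(p, x). f p x) \<in> lip_fun z"
      using f z lipK_bounded[OF that] by (simp add: lip_fun_iff)
    then have "(\<lambda>p. \<pi> (\<lambda>x. (\<lambda>(p, x). f p x) (p, x))) \<in> ns_carrier (Lip0 z V)"
      unfolding L.carrier by blast
    then show ?thesis by simp
  qed
  then show ?thesis
    unfolding Lip0K_def using relcompact_slopes_iff[of f, OF f] by auto
qed

lemma LipSNAK_pi_iff:
  assumes f: "\<And>p. f p \<in> U" and z: "N (f z) = 0"
  shows "(\<lambda>p. \<pi> (f p)) \<in> LipSNAK z V \<longleftrightarrow> lipK U N f \<and> attains N f"
proof (cases "lipK U N f")
  case True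
  obtain L where "\<And>p q. p \<noteq> q \<Longrightarrow> N (slope f p q) \<le> L" using lipK_bounded[OF True] by blast
  then have "strongly_attains_norm V (\<lambda>p. \<pi> (f p)) \<longleftrightarrow> attains N f"
    by (rule attains_iff[of f, OF f])
  then show ?thesis using Lip0K_pi_iff[of f, OF f z] True by (simp add: LipSNAK_def)
next
  case False
  then show ?thesis using Lip0K_pi_iff[of f, OF f z] by (simp add: LipSNAK_def)
qed

lemma Lip0K_imp_pi:
  assumes "F \<in> Lip0K z V"
  shows "\<exists>f. (\<forall>p. f p \<in> U) \<and> N (f z) = 0 \<and> F = (\<lambda>p. \<pi> (f p))"
proof -
  interpret L: fun_space_repr "lip_fun z" lip_N "Lip0 z V" "\<lambda>h p. \<pi> (\<lambda>x. h (p, x))"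
    by (rule Lip0_repr)
  obtain h where h: "h \<in> lip_fun z" "F = (\<lambda>p. \<pi> (\<lambda>x. h (p, x)))"
    using assms L.carrier by (auto simp: Lip0K_def)
  show ?thesis
    by (rule exI[of _ "\<lambda>p x. h (p, x)"]) (use h in \<open>auto simp: lip_fun_def\<close>)
qed

lemma dist_Lip0_iff:
  assumes f: "lipK U N f" "N (f z) = 0" and g: "lipK U N g" "N (g z) = 0" and "0 \<le> e"
  shows "ns_dist (Lip0 z V) (\<lambda>p. \<pi> (f p)) (\<lambda>p. \<pi> (g p)) \<le> e \<longleftrightarrow>
    slopes_close N f g e"
proof -
  interpret L: fun_space_repr "lip_fun z" lip_N "Lip0 z V" "\<lambda>h p. \<pi> (\<lambda>x. h (p, x))"
    by (rule Lip0_repr)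
  have m: "f p \<in> U" "g p \<in> U" for p using f g by (auto simp: lipK_def)
  have mem: "(\<lambda>(p, x). f p x) \<in> lip_fun z" "(\<lambda>(p, x). g p x) \<in> lip_fun z"
    using f g m lipK_bounded by (auto simp: lip_fun_iff)
  have d: "(\<lambda>y. (\<lambda>(p, x). f p x) y - (\<lambda>(p, x). g p x) y) \<in> lip_fun z"
    by (rule L.diff_mem[OF mem])
  have quot: "N (\<lambda>x. f p x - g p x - (f q x - g q x)) / dist p q =
      N (\<lambda>x. slope f p q x - slope g p q x)" for p q
    by (rule slope_diff_quot[of f g, OF m])
  have "ns_dist (Lip0 z V) (\<lambda>p. \<pi> (f p)) (\<lambda>p. \<pi> (g p)) =
      lip_N (\<lambda>y. (\<lambda>(p, x). f p x) y - (\<lambda>(p, x). g p x) y)"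
    using L.dist_pi[OF mem] by simp
  moreover have "lip_N (\<lambda>y. (\<lambda>(p, x). f p x) y - (\<lambda>(p, x). g p x) y) \<le> e \<longleftrightarrow>
      slopes_close N f g e"
  proof
    assume le: "lip_N (\<lambda>y. (\<lambda>(p, x). f p x) y - (\<lambda>(p, x). g p x) y) \<le> e"
    show "slopes_close N f g e"
      using lip_fun_quot_le[OF d] le by (fastforce simp: quot)
  next
    assume "slopes_close N f g e"
    then show "lip_N (\<lambda>y. (\<lambda>(p, x). f p x) y - (\<lambda>(p, x). g p x) y) \<le> e"
      using \<open>0 \<le> e\<close> by (intro lip_N_leI) (auto simp: quot)
  qed
  ultimately show ?thesis by simp
qed

text \<open>Subtracting the value at \<open>z\<close> brings any map into the based space and leaves
  all slopes unchanged, hence also compactness, attainment and distances.\<close>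

theorem LipSNAK_dense_iff:
  fixes z :: "'m::metric_space"
  shows "LipSNAK_dense z V \<longleftrightarrow> dense_attaining TYPE('m) U N"
proof -
  interpret L: fun_space_repr "lip_fun z" lip_N "Lip0 z V" "\<lambda>h p. \<pi> (\<lambda>x. h (p, x))"
    by (rule Lip0_repr)
  interpret M: Metric_space "ns_carrier (Lip0 z V)" "ns_dist (Lip0 z V)"
    by (rule L.metric)
  have sub: "LipSNAK z V \<subseteq> ns_carrier (Lip0 z V)" "Lip0K z V \<subseteq> ns_carrier (Lip0 z V)"
    by (auto simp: LipSNAK_def Lip0K_def)
  have s: "G \<in> ns_carrier (Lip0 z V)" if "G \<in> LipSNAK z V" for G using sub(1) that by blast
  \<comment> \<open>Closed balls are used because a bound \<open>\<le> e\<close> on a supremum of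
    slopes is the same bound on each slope.\<close>
  have "F \<in> M.mtopology closure_of LipSNAK z V \<longleftrightarrow>
      (\<forall>e>0. \<exists>G\<in>LipSNAK z V. ns_dist (Lip0 z V) F G \<le> e)" if "F \<in> ns_carrier (Lip0 z V)" for F
    using that s by (simp add: M.metric_closure_of_alt M.in_mcball cong: bex_cong)
  then have char: "LipSNAK_dense z V \<longleftrightarrow>
      (\<forall>F\<in>Lip0K z V. \<forall>e>0. \<exists>G\<in>LipSNAK z V. ns_dist (Lip0 z V) F G \<le> e)"
    unfolding LipSNAK_dense_def ns_topology_def subset_iff Ball_def using subsetD[OF sub(2)] by simp
  have sl: "slope (\<lambda>p x. f p x - f z x) = slope f" for f :: "'m \<Rightarrow> 'x \<Rightarrow> 'y"
    by (intro ext) (simp add: slope_def)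
  have base: "lipK U N (\<lambda>p x. f p x - f z x)" "N (\<lambda>x. f z x - f z x) = 0"
    if "lipK U N f" for f :: "'m \<Rightarrow> 'x \<Rightarrow> 'y"
    using that by (auto simp: lipK_def sl diff_mem N_zero)
  have att: "attains N (\<lambda>p x. f p x - f z x) \<longleftrightarrow> attains N f" for f :: "'m \<Rightarrow> 'x \<Rightarrow> 'y"
    by (simp add: attains_def sl)
  show ?thesis
    unfolding char
  proof
    assume dens: "\<forall>F\<in>Lip0K z V. \<forall>e>0. \<exists>G\<in>LipSNAK z V. ns_dist (Lip0 z V) F G \<le> e"
    show "dense_attaining TYPE('m) U N"
      unfolding dense_attaining_def
    proof (intro allI impI)
      fix f :: "'m \<Rightarrow> 'x \<Rightarrow> 'y" and e :: real
      assume e: "e > 0" and f: "lipK U N f"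
      let ?f = "\<lambda>p x. f p x - f z x"
      have "(\<lambda>p. \<pi> (?f p)) \<in> Lip0K z V"
        using Lip0K_pi_iff[of ?f z] base[OF f] lipK_memD[OF base(1)[OF f]] by blast
      then obtain G where G: "G \<in> LipSNAK z V" "ns_dist (Lip0 z V) (\<lambda>p. \<pi> (?f p)) G \<le> e"
        using dens e by blast
      then have "G \<in> Lip0K z V" by (simp add: LipSNAK_def)
      then obtain g where g: "\<forall>p. g p \<in> U" "N (g z) = 0" "G = (\<lambda>p. \<pi> (g p))"
        using Lip0K_imp_pi by blast
      have g': "lipK U N g" "attains N g"
        using LipSNAK_pi_iff[of g, OF g(1)[rule_format] g(2)] G(1) g(3) by auto
      have "slopes_close N ?f g e"
        using dist_Lip0_iff[OF base[OF f] g'(1) g(2), of e] G(2) e g(3) by simp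
      then show "\<exists>g. lipK U N g \<and> attains N g \<and>
          slopes_close N f g e"
        using g' by (auto simp: sl)
    qed
  next
    assume dens: "dense_attaining TYPE('m) U N"
    show "\<forall>F\<in>Lip0K z V. \<forall>e>0. \<exists>G\<in>LipSNAK z V. ns_dist (Lip0 z V) F G \<le> e"
    proof (intro ballI allI impI)
      fix F and e :: real assume F: "F \<in> Lip0K z V" and e: "e > 0"
      from F obtain f where f: "\<forall>p. f p \<in> U" "N (f z) = 0" "F = (\<lambda>p. \<pi> (f p))"
        using Lip0K_imp_pi by blast
      have f': "lipK U N f" using Lip0K_pi_iff[of f, OF f(1)[rule_format] f(2)] F f(3) by simp
      then obtain g where g: "lipK U N g" "attains N g"
        "slopes_close N f g e"
        using dens[unfolded dense_attaining_def, rule_format, of e f] e by blast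
      let ?g = "\<lambda>p x. g p x - g z x"
      have "(\<lambda>p. \<pi> (?g p)) \<in> LipSNAK z V"
        using LipSNAK_pi_iff[of ?g z] base[OF g(1)] lipK_memD[OF base(1)[OF g(1)]] g(2) att by blast
      moreover have "ns_dist (Lip0 z V) F (\<lambda>p. \<pi> (?g p)) \<le> e"
        using dist_Lip0_iff[OF f' f(2) base[OF g(1)], of e] e g(3) f(3) by (simp add: sl)
      ultimately show "\<exists>G\<in>LipSNAK z V. ns_dist (Lip0 z V) F G \<le> e" by blast
    qed
  qed
qed

end

section \<open>Transfer of density by compression\<close>

text \<open>Linearity on \<open>U\<close>, stated for the one combination that occurs in a slope;
  \<open>c = 1\<close> gives differences.\<close>

definition diff_linear :: "('x \<Rightarrow> 'y::real_normed_vector) set \<Rightarrow> (('x \<Rightarrow> 'y) \<Rightarrow> 'i \<Rightarrow> 'z::real_normed_vector) \<Rightarrow> bool" where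
  "diff_linear U E \<longleftrightarrow>
     (\<forall>f\<in>U. \<forall>g\<in>U. \<forall>c. E (\<lambda>x. c *\<^sub>R (f x - g x)) = (\<lambda>i. c *\<^sub>R (E f i - E g i)))"

lemma diff_linearD:
  "diff_linear U E \<Longrightarrow> f \<in> U \<Longrightarrow> g \<in> U \<Longrightarrow> E (\<lambda>x. c *\<^sub>R (f x - g x)) = (\<lambda>i. c *\<^sub>R (E f i - E g i))"
  by (simp add: diff_linear_def)

lemma diff_linear_diff:
  assumes "diff_linear U E" "f \<in> U" "g \<in> U" shows "E (\<lambda>x. f x - g x) = (\<lambda>i. E f i - E g i)"
  using diff_linearD[OF assms, of 1] by simp

lemma diff_linear_slope:
  assumes "diff_linear U E" "\<And>p. f p \<in> U" shows "slope (\<lambda>p. E (f p)) p q = E (slope f p q)"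
  using diff_linearD[OF assms(1) assms(2)[of p] assms(2)[of q], of "1 / dist p q"]
  by (simp add: slope_def)

text \<open>Some attaining map must approximate the zero map, and attainment asks for a pair of
  distinct points. On a one-point domain the density hypothesis is therefore false.\<close>

lemma dense_attaining_two_points:
  assumes "fun_space W N'" "dense_attaining TYPE('m::metric_space) W N'"
  shows "\<exists>p q :: 'm. p \<noteq> q"
proof -
  interpret W: fun_space W N' by fact
  have "lipK W N' (\<lambda>(p::'m) i. 0)"
    unfolding lipK_def slope_def
    by (auto simp: W.zero_mem W.N_zero intro!: exI[of _ "\<lambda>i. 0"] exI[of _ id] strict_mono_id)
  then obtain h :: "'m \<Rightarrow> _" where "attains N' h"
    using assms(2) unfolding dense_attaining_def by (meson zero_less_one)
  then show ?thesis by (auto simp: attains_def)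
qed

text \<open>The constant \<open>C\<close> is 1 for a contraction and 1 + c for its amplified
  version.\<close>

lemma lipK_compose:
  fixes f :: "'m::metric_space \<Rightarrow> 'x \<Rightarrow> 'y::real_normed_vector"
  assumes "fun_space U N" "fun_space W N'" and E: "diff_linear U E"
    "\<And>h. h \<in> U \<Longrightarrow> E h \<in> W" "\<And>h. h \<in> U \<Longrightarrow> N' (E h) \<le> C * N h"
    and f: "lipK U N f"
  shows "lipK W N' (\<lambda>p. E (f p))"
  unfolding lipK_def
proof (intro conjI allI impI)
  interpret U: fun_space U N by fact
  interpret W: fun_space W N' by fact
  have fm: "f p \<in> U" for p by (rule U.lipK_memD[OF f])
  have sm: "slope f p q \<in> U" for p q by (rule U.slope_mem[OF fm])
  show "E (f p) \<in> W" for p by (intro E(2) fm)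
  fix p q :: "nat \<Rightarrow> 'm" assume pq: "\<forall>i. p i \<noteq> q i"
  obtain l r where l: "l \<in> U" "strict_mono r"
    "(\<lambda>i. N (\<lambda>x. slope f (p (r i)) (q (r i)) x - l x)) \<longlonglongrightarrow> 0"
    using f[unfolded lipK_def, THEN conjunct2, rule_format, of p q] pq by blast
  have sl: "slope (\<lambda>p. E (f p)) p q = E (slope f p q)" for p q
    by (rule diff_linear_slope[of U E f, OF E(1) fm])
  have 1: "N' (\<lambda>x. slope (\<lambda>p. E (f p)) (p (r i)) (q (r i)) x - E l x) \<le>
      C * N (\<lambda>x. slope f (p (r i)) (q (r i)) x - l x)" for i
    unfolding sl diff_linear_diff[OF E(1) sm l(1), symmetric] by (rule E(3)[OF U.diff_mem[OF sm l(1)]])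
  have 2: "0 \<le> N' (\<lambda>x. slope (\<lambda>p. E (f p)) (p (r i)) (q (r i)) x - E l x)" for i
    unfolding sl by (intro W.N_nonneg W.diff_mem E(2) sm l(1))
  show "\<exists>l r. l \<in> W \<and> strict_mono r \<and>
      (\<lambda>i. N' (\<lambda>x. slope (\<lambda>p. E (f p)) (p (r i)) (q (r i)) x - l x)) \<longlonglongrightarrow> 0"
    by (rule exI[of _ "E l"], rule exI[of _ r])
      (intro conjI E(2) l(1,2) LIMSEQ_0_sandwich[OF tendsto_mult_right_zero[OF l(3)] 1 2])
qed

text \<open>A map all of whose slopes are null attains its norm at any pair, so it approximates
  itself.\<close>

lemma dense_attaining_nonzeroI:
  assumes "fun_space U N" "\<exists>p q :: 'm::metric_space. p \<noteq> q"
    and nonzero: "\<And>f e (p::'m) q. 0 < e \<Longrightarrow> lipK U N f \<Longrightarrow> p \<noteq> q \<Longrightarrow> 0 < N (slope f p q) \<Longrightarrow>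
      \<exists>g. lipK U N g \<and> attains N g \<and> slopes_close N f g e"
  shows "dense_attaining TYPE('m) U N"
  unfolding dense_attaining_def
proof (intro allI impI)
  interpret U: fun_space U N by fact
  fix f :: "'m \<Rightarrow> _" and e :: real
  assume e: "e > 0" and f: "lipK U N f"
  show "\<exists>g. lipK U N g \<and> attains N g \<and>
    slopes_close N f g e"
  proof (cases "\<forall>p q. p \<noteq> q \<longrightarrow> N (slope f p q) = 0")
    case True
    obtain p q :: 'm where "p \<noteq> q" using assms(2) by blast
    then have "attains N f"
      using True unfolding attains_def by (intro exI[of _ p] exI[of _ q]) auto
    then show ?thesis using f e by (auto simp: U.N_zero)
  next
    case False
    then obtain p q where "p \<noteq> q" "N (slope f p q) \<noteq> 0" by blast
    then show ?thesis
      using nonzero[OF e f] U.N_nonneg[of "slope f p q", OF U.slope_mem[OF U.lipK_memD[OF f]]] by force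
  qed
qed

text \<open>
  Norm attaining maps into the small space \<open>W\<close> can be moved to \<open>U\<close>: \<open>E\<close> compresses the finitely many
  vectors \<open>T\<close>, and \<open>R f w\<close> replaces the compressed part of \<open>f\<close> by \<open>w\<close>, so that the norm of \<open>R f w\<close>
  is the norm of \<open>w\<close> as soon as the latter dominates.
\<close>

definition compression :: "('x \<Rightarrow> 'y::real_normed_vector) set \<Rightarrow> (('x \<Rightarrow> 'y) \<Rightarrow> real) \<Rightarrow>
    ('i \<Rightarrow> 'z::real_normed_vector) set \<Rightarrow> (('i \<Rightarrow> 'z) \<Rightarrow> real) \<Rightarrow>
    (('x \<Rightarrow> 'y) \<Rightarrow> 'i \<Rightarrow> 'z) \<Rightarrow> (('x \<Rightarrow> 'y) \<Rightarrow> ('i \<Rightarrow> 'z) \<Rightarrow> 'x \<Rightarrow> 'y) \<Rightarrow> bool" where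
  "compression U N W N' E R \<longleftrightarrow> diff_linear U E \<and> (\<forall>f\<in>U. E f \<in> W \<and> N' (E f) \<le> N f) \<and>
     (\<forall>f\<in>U. \<forall>w\<in>W. R f w \<in> U \<and> N' w \<le> N (R f w) \<and> N (R f w) \<le> max (N f) (N' w)) \<and>
     (\<forall>f\<in>U. \<forall>g\<in>U. \<forall>w\<in>W. \<forall>v\<in>W. \<forall>c. R (\<lambda>x. c *\<^sub>R (f x - g x)) (\<lambda>i. c *\<^sub>R (w i - v i)) =
        (\<lambda>x. c *\<^sub>R (R f w x - R g v x)))"

text \<open>Let \<open>H\<close> attain its norm near \<open>(1 + c)\<close> times \<open>E\<close>
  of \<open>f\<close>. Every slope of \<open>G = R f H\<close> is bounded by the maximum of a slope
  norm of \<open>f\<close>, at most \<open>L\<close>, and of the attained norm of \<open>H\<close>.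
  The amplification makes the latter at least \<open>L\<close>, and the slope of \<open>G\<close> at
  the attaining pair of \<open>H\<close> is at least as large, so \<open>G\<close> attains its norm
  there.\<close>

theorem dense_attaining_compression:
  assumes "fun_space U N" "fun_space W N'" and dW: "dense_attaining TYPE('m::metric_space) W N'"
    and compr: "\<And>T s0 e. finite T \<Longrightarrow> T \<subseteq> U \<Longrightarrow> s0 \<in> T \<Longrightarrow> 0 < N s0 \<Longrightarrow> (0::real) < e \<Longrightarrow>
      \<exists>E R. compression U N W N' E R \<and>
        N s0 - e \<le> N' (E s0) \<and> (\<forall>s\<in>T. N (\<lambda>x. s x - R s (E s) x) \<le> e)"
  shows "dense_attaining TYPE('m) U N"
proof (rule dense_attaining_nonzeroI[OF assms(1) dense_attaining_two_points[OF assms(2) dW]])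
  interpret U: fun_space U N by fact
  interpret W: fun_space W N' by fact
  fix f :: "'m \<Rightarrow> _" and e :: real and p1 q1
  assume e: "e > 0" and f: "lipK U N f" and pq1: "p1 \<noteq> q1" "N (slope f p1 q1) > 0"
  have fm: "f p \<in> U" for p by (rule U.lipK_memD[OF f])
  have sm: "slope f p q \<in> U" for p q by (rule U.slope_mem[OF fm])
  define S where "S = {N (slope f p q) | p q. p \<noteq> q}"
  have Sne: "S \<noteq> {}" using pq1 by (auto simp: S_def)
  have bdd: "bdd_above S" using U.lipK_bounded[OF f] by (auto simp: S_def bdd_above_def)
  define L where "L = Sup S"
  have le_L: "N (slope f p q) \<le> L" if "p \<noteq> q" for p q
    unfolding L_def by (rule cSup_upper[OF _ bdd]) (use that in \<open>auto simp: S_def\<close>)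
  have L: "L > 0" using le_L[OF pq1(1)] pq1(2) by linarith
  \<comment> \<open>The final estimate has errors \<open>d\<close>, \<open>d\<close>,
    \<open>d\<close> and \<open>7 * d\<close>, in total \<open>10 * d\<close>; the bound
    \<open>4 * d \<le> L\<close> serves the amplification.\<close>
  define d where "d = min (L / 4) (e / 10)"
  have d: "d > 0" "4 * d \<le> L" "10 * d \<le> e" using L e by (auto simp: d_def)
  \<comment> \<open>Since \<open>N' (E s0) \<ge> L - 2 * d\<close>, the choice
    \<open>c * L = 6 * d\<close> yields \<open>(1 + c) * (L - 2 * d) \<ge> L + d\<close>; the extra
    \<open>d\<close> pays for replacing the amplified map by \<open>H\<close>.\<close>
  define c where "c = 6 * d / L"
  have c: "c > 0" "c * L = 6 * d" using d L by (auto simp: c_def)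
  have "L - d < Sup S" using d by (simp add: L_def)
  then obtain y where "y \<in> S" "L - d < y" using Sne by (rule less_cSupE)
  then obtain p0 q0 where pq0: "p0 \<noteq> q0" "N (slope f p0 q0) > L - d"
    unfolding S_def by auto
  define s0 where "s0 = slope f p0 q0"
  obtain P where P: "finite P"
    "\<And>p q. p \<noteq> q \<Longrightarrow> \<exists>(p', q')\<in>P. N (\<lambda>x. slope f p q x - slope f p' q' x) < d"
    using U.lipK_net[OF f d(1)] by auto
  define T where "T = (\<lambda>(p, q). slope f p q) ` insert (p0, q0) P"
  have T: "finite T" "T \<subseteq> U" "s0 \<in> T" "N s0 > 0"
    using P(1) sm pq0 d by (auto simp: T_def s0_def)
  obtain E R where E0: "diff_linear U E" "\<forall>f\<in>U. E f \<in> W \<and> N' (E f) \<le> N f"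
    and R0: "\<forall>f\<in>U. \<forall>w\<in>W. R f w \<in> U \<and> N' w \<le> N (R f w) \<and> N (R f w) \<le> max (N f) (N' w)"
    and Rlin0: "\<forall>f\<in>U. \<forall>g\<in>U. \<forall>w\<in>W. \<forall>v\<in>W. \<forall>c. R (\<lambda>x. c *\<^sub>R (f x - g x)) (\<lambda>i. c *\<^sub>R (w i - v i)) =
          (\<lambda>x. c *\<^sub>R (R f w x - R g v x))"
    and Es0: "N s0 - d \<le> N' (E s0)"
    and net0: "\<forall>s\<in>T. N (\<lambda>x. s x - R s (E s) x) \<le> d"
    using compr[OF T d(1)] unfolding compression_def by (elim exE conjE) (rule that; assumption)
  have E: "diff_linear U E" "\<And>g. g \<in> U \<Longrightarrow> E g \<in> W" "\<And>g. g \<in> U \<Longrightarrow> N' (E g) \<le> N g"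
    using E0 by auto
  have R: "\<And>g w. g \<in> U \<Longrightarrow> w \<in> W \<Longrightarrow> R g w \<in> U"
      "\<And>g w. g \<in> U \<Longrightarrow> w \<in> W \<Longrightarrow> N' w \<le> N (R g w)"
      "\<And>g w. g \<in> U \<Longrightarrow> w \<in> W \<Longrightarrow> N (R g w) \<le> max (N g) (N' w)"
    using R0 by blast+
  note Rlin = Rlin0[rule_format] and net = net0[rule_format]
  have Rdiff: "R (\<lambda>x. g x - h x) (\<lambda>i. w i - v i) = (\<lambda>x. R g w x - R h v x)"
    if "g \<in> U" "h \<in> U" "w \<in> W" "v \<in> W" for g h w v
    using Rlin[OF that, of 1] by simp
  define E' where "E' = (\<lambda>h i. (1 + c) *\<^sub>R E h i)"
  have E': "diff_linear U E'" "\<And>h. h \<in> U \<Longrightarrow> E' h \<in> W" "\<And>h. h \<in> U \<Longrightarrow> N' (E' h) \<le> (1 + c) * N h"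
    using E c(1) by (auto simp: E'_def diff_linear_def W.scale_mem W.N_scale scaleR_diff_right mult.commute)
  define EF where "EF = (\<lambda>p. E' (f p))"
  have slEF: "slope EF p q = (\<lambda>i. (1 + c) *\<^sub>R E (slope f p q) i)" for p q
    using diff_linear_slope[of U E' f, OF E'(1) fm] by (simp add: EF_def E'_def)
  have "lipK W N' EF"
    unfolding EF_def by (rule lipK_compose[OF assms(1,2) E' f])
  then obtain H where H: "lipK W N' H" "attains N' H"
    "\<And>p q. p \<noteq> q \<Longrightarrow> N' (\<lambda>x. slope EF p q x - slope H p q x) \<le> d"
    using dW[unfolded dense_attaining_def, rule_format, of d EF] d(1) by blast
  have Hm: "H p \<in> W" for p by (rule W.lipK_memD[OF H(1)])
  have hm: "slope H p q \<in> W" for p q by (rule W.slope_mem[OF Hm])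
  have Em: "E (slope f p q) \<in> W" for p q by (rule E(2)[OF sm])
  \<comment> \<open>\<open>R\<close> is jointly linear in its two arguments, so a slope of
    \<open>G\<close> is \<open>R\<close> applied to the slopes of \<open>f\<close> and
    \<open>H\<close>.\<close>
  define G where "G = (\<lambda>p. R (f p) (H p))"
  have slG: "slope G p q = R (slope f p q) (slope H p q)" for p q
    unfolding slope_def[of f] slope_def[of H] Rlin[OF fm fm Hm Hm] by (simp add: slope_def G_def)
  have "lipK U N G"
    unfolding lipK_def
  proof (intro conjI allI impI)
    show "G p \<in> U" for p unfolding G_def by (intro R(1) fm Hm)
    fix p q :: "nat \<Rightarrow> 'm" assume pq: "\<forall>i. p i \<noteq> q i"
    obtain l r where l: "l \<in> U" "strict_mono r"
      "(\<lambda>i. N (\<lambda>x. slope f (p (r i)) (q (r i)) x - l x)) \<longlonglongrightarrow> 0"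
      using f[unfolded lipK_def, THEN conjunct2, rule_format, of p q] pq by blast
    obtain l' r' where l': "l' \<in> W" "strict_mono r'"
      "(\<lambda>i. N' (\<lambda>x. slope H (p (r (r' i))) (q (r (r' i))) x - l' x)) \<longlonglongrightarrow> 0"
      using H(1)[unfolded lipK_def, THEN conjunct2, rule_format, of "\<lambda>i. p (r i)" "\<lambda>i. q (r i)"] pq
      by blast
    let ?p = "\<lambda>i. p (r (r' i))" and ?q = "\<lambda>i. q (r (r' i))"
    have 1: "N (\<lambda>x. slope G (?p i) (?q i) x - R l l' x) \<le>
        N (\<lambda>x. slope f (?p i) (?q i) x - l x) + N' (\<lambda>x. slope H (?p i) (?q i) x - l' x)" for i
      unfolding slG Rdiff[OF sm l(1) hm l'(1), symmetric]
      by (rule order_trans[OF R(3)[OF U.diff_mem[OF sm l(1)] W.diff_mem[OF hm l'(1)]]])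
        (simp add: U.N_nonneg[OF U.diff_mem[OF sm l(1)]] W.N_nonneg[OF W.diff_mem[OF hm l'(1)]])
    have 2: "0 \<le> N (\<lambda>x. slope G (?p i) (?q i) x - R l l' x)" for i
      unfolding slG by (intro U.N_nonneg U.diff_mem R(1) sm hm l(1) l'(1))
    have "(\<lambda>i. N (\<lambda>x. slope f (?p i) (?q i) x - l x)) \<longlonglongrightarrow> 0"
      using LIMSEQ_subseq_LIMSEQ[OF l(3) l'(2)] by (simp add: o_def)
    then have 3: "(\<lambda>i. N (\<lambda>x. slope f (?p i) (?q i) x - l x) + N' (\<lambda>x. slope H (?p i) (?q i) x - l' x)) \<longlonglongrightarrow> 0"
      using l'(3) by (rule tendsto_add_zero)
    show "\<exists>l r. l \<in> U \<and> strict_mono r \<and>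
        (\<lambda>i. N (\<lambda>x. slope G (p (r i)) (q (r i)) x - l x)) \<longlonglongrightarrow> 0"
      using R(1)[OF l(1) l'(1)] strict_mono_o[OF l(2) l'(2)] LIMSEQ_0_sandwich[OF 3 1 2]
      by (intro exI[of _ "R l l'"] exI[of _ "r \<circ> r'"]) (simp add: o_def)
  qed
  moreover have "attains N G"
  proof -
    obtain p2 q2 where pq2: "p2 \<noteq> q2" "\<And>p q. p \<noteq> q \<Longrightarrow> N' (slope H p q) \<le> N' (slope H p2 q2)"
      using H(2) by (auto simp: attains_def)
    have "(1 + c) * N' (E s0) \<le> N' (slope H p0 q0) + d"
      using W.N_le_add_diff[OF W.scale_mem[OF Em] hm, of "1 + c" p0 q0 p0 q0] H(3)[OF pq0(1)] c(1)
        W.N_scale[OF Em, of "1 + c" p0 q0]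
      by (simp add: slEF s0_def)
    moreover have "(1 + c) * (L - 2 * d) \<le> (1 + c) * N' (E s0)"
      using Es0 pq0(2) c(1) unfolding s0_def[symmetric] by (intro mult_left_mono) auto
    moreover have "(1 + c) * (L - 2 * d) \<ge> L + d"
    proof -
      have "c * (2 * d) \<le> c * (L / 2)" using c(1) d(2) by (intro mult_left_mono) auto
      then show ?thesis using c(2) by (simp add: algebra_simps)
    qed
    ultimately have "L \<le> N' (slope H p2 q2)" using pq2(2)[OF pq0(1)] by linarith
    then have "N (slope G p q) \<le> N (slope G p2 q2)" if "p \<noteq> q" for p q
      using R(3)[OF sm hm, of p q p q] R(2)[OF sm hm, of p2 q2 p2 q2] le_L[OF that] pq2(2)[OF that]
      unfolding slG by linarith
    then show ?thesis using pq2(1) by (auto simp: attains_def)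
  qed
  moreover have "N (\<lambda>x. slope f p q x - slope G p q x) \<le> e" if pq: "p \<noteq> q" for p q
  proof -
    obtain p' q' where pq': "(p', q') \<in> P" "N (\<lambda>x. slope f p q x - slope f p' q' x) < d"
      using P(2)[OF pq] by blast
    let ?s = "slope f p q" and ?t = "slope f p' q'" and ?h = "slope H p q"
    have t: "?t \<in> T" using pq'(1) by (force simp: T_def)
    have RE: "R (slope f a b) (E (slope f a b)) \<in> U" for a b by (intro R(1) sm Em)
    have dst: "(\<lambda>x. ?t x - ?s x) \<in> U" by (intro U.diff_mem sm)
    \<comment> \<open>The map sending \<open>s\<close> to \<open>R s (E s)\<close> is itself a
      linear contraction, so it does not increase the distance from \<open>?s\<close> to the
      net.\<close>
    have 1: "N (\<lambda>x. R ?t (E ?t) x - R ?s (E ?s) x) \<le> d"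
      unfolding Rdiff[OF sm sm Em Em, symmetric] diff_linear_diff[OF E(1) sm sm, symmetric]
      using R(3)[OF dst E(2)[OF dst]] E(3)[OF dst] pq'(2) U.N_minus_commute[OF sm sm, of p q p' q']
      by linarith
    have 2: "N (\<lambda>x. R ?s (E ?s) x - R ?s ?h x) \<le> 7 * d"
    proof -
      \<comment> \<open>Both terms keep the same \<open>?s\<close>, so the first argument of
        \<open>R\<close> cancels to 0 and only the distance in the small space remains:
        \<open>c * L = 6 * d\<close> for undoing the amplification and \<open>d\<close> for
        \<open>H\<close>.\<close>
      have "N (\<lambda>x. R ?s (E ?s) x - R ?s ?h x) \<le> N' (\<lambda>x. E ?s x - ?h x)"
        unfolding Rdiff[OF sm sm Em hm, symmetric]
        using R(3)[OF U.zero_mem W.diff_mem[OF Em hm], of p q p q] W.N_nonneg[OF W.diff_mem[OF Em hm], of p q p q]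
        by (simp add: U.N_zero)
      also have "\<dots> \<le> N' (\<lambda>x. E ?s x - (1 + c) *\<^sub>R E ?s x) + N' (\<lambda>x. (1 + c) *\<^sub>R E ?s x - ?h x)"
        by (rule W.N_diff_triangle[OF Em W.scale_mem[OF Em] hm])
      also have "(\<lambda>x. E ?s x - (1 + c) *\<^sub>R E ?s x) = (\<lambda>x. (- c) *\<^sub>R E ?s x)"
        by (simp add: algebra_simps)
      also have "N' (\<lambda>x. (- c) *\<^sub>R E ?s x) = c * N' (E ?s)"
        using W.N_scale[OF Em, of "- c" p q] c(1) by simp
      also have "c * N' (E ?s) \<le> c * L"
        using E(3)[OF sm, of p q] le_L[OF pq] c(1) by (intro mult_left_mono) auto
      also have "N' (\<lambda>x. (1 + c) *\<^sub>R E ?s x - ?h x) \<le> d"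
        using H(3)[OF pq] by (simp add: slEF)
      finally show ?thesis using c(2) by simp
    qed
    have "N (\<lambda>x. ?s x - R ?s ?h x) \<le> N (\<lambda>x. ?s x - ?t x) + N (\<lambda>x. ?t x - R ?t (E ?t) x)
        + N (\<lambda>x. R ?t (E ?t) x - R ?s (E ?s) x) + N (\<lambda>x. R ?s (E ?s) x - R ?s ?h x)"
      using U.N_diff_triangle[of ?s ?t "R ?s ?h", OF sm sm R(1)[OF sm hm]]
        U.N_diff_triangle[of ?t "R ?t (E ?t)" "R ?s ?h", OF sm RE R(1)[OF sm hm]]
        U.N_diff_triangle[of "R ?t (E ?t)" "R ?s (E ?s)" "R ?s ?h", OF RE RE R(1)[OF sm hm]]
      by linarith
    then show ?thesis
      unfolding slG using 1 2 pq'(2) net[OF t] d(3) by linarith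
  qed
  ultimately show "\<exists>g. lipK U N g \<and> attains N g \<and>
    slopes_close N f g e" by blast
qed

section \<open>The p-additive case: power inequalities, heads and tails of sequences\<close>

text \<open>Young's inequality with exponents p and p/(p-1); equivalently, s^p lies above its
  tangent at x. For p = 1 the conjugate exponent degenerates and the claim is immediate,
  \<open>0 powr 0\<close> being 0.\<close>

lemma powr_minus_one_mult_le:
  fixes x s p :: real
  assumes "1 \<le> p" "0 \<le> x" "0 \<le> s"
  shows "x powr (p - 1) * s \<le> (p - 1) / p * x powr p + s powr p / p"
proof (cases "p = 1")
  case True
  then show ?thesis using assms by simp
next
  case False
  then have p: "p > 1" using assms by simp
  have "s * x powr (p - 1) \<le> s powr p / p + (x powr (p - 1)) powr (p / (p - 1)) / (p / (p - 1))"
    by (rule Youngs_inequality) (use p assms in \<open>auto simp: field_simps\<close>)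
  also have "(x powr (p - 1)) powr (p / (p - 1)) = x powr p"
    using p by (simp add: powr_powr)
  finally show ?thesis by (simp add: mult.commute)
qed

text \<open>The functional with coefficients \<nu>^(p-1) and a^(p-1) supports the ball of the
  two-dimensional l_p norm at the point (\<nu>, a), so on that ball it is largest there. The
  conclusion is this inequality divided by \<nu>^(p-1).\<close>

lemma powr_sum_le_imp:
  fixes \<nu> a u t p :: real
  assumes "1 \<le> p" "0 < \<nu>" "0 \<le> a" "0 \<le> u" "0 \<le> t" and le: "u powr p + t powr p \<le> \<nu> powr p + a powr p"
  shows "u + a powr (p - 1) / \<nu> powr p * t * \<nu> \<le> (1 + a powr (p - 1) / \<nu> powr p * a) * \<nu>"
proof -
  have pw: "x powr (p - 1) * x = x powr p" if "0 \<le> x" for x :: real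
    using that powr_mult_base[of x "p - 1"] by (cases "x = 0") (auto simp: mult.commute)
  have "\<nu> powr (p - 1) * u + a powr (p - 1) * t \<le>
      (p - 1) / p * (\<nu> powr p + a powr p) + (u powr p + t powr p) / p"
    using powr_minus_one_mult_le[of p \<nu> u] powr_minus_one_mult_le[of p a t] assms
    by (simp add: distrib_left add_divide_distrib)
  also have "\<dots> \<le> (p - 1) / p * (\<nu> powr p + a powr p) + (\<nu> powr p + a powr p) / p"
    using le assms(1) by (simp add: divide_right_mono)
  also have "\<dots> = \<nu> powr p + a powr p"
    using assms(1) by (simp add: field_simps)
  finally have *: "\<nu> powr (p - 1) * u + a powr (p - 1) * t \<le> \<nu> powr p + a powr p" .
  have \<nu>p: "\<nu> powr p = \<nu> powr (p - 1) * \<nu>" using pw[of \<nu>] assms(2) by simp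
  have pos: "\<nu> powr (p - 1) > 0" using assms(2) by simp
  have e1: "\<nu> powr (p - 1) * (u + a powr (p - 1) / \<nu> powr p * t * \<nu>) = \<nu> powr (p - 1) * u + a powr (p - 1) * t"
    unfolding \<nu>p using pos assms(2) by (simp add: field_simps)
  have e2: "\<nu> powr (p - 1) * ((1 + a powr (p - 1) / \<nu> powr p * a) * \<nu>) = \<nu> powr p + a powr p"
    unfolding \<nu>p pw[OF assms(3), symmetric] using pos assms(2) by (simp add: field_simps)
  have "\<nu> powr (p - 1) * (u + a powr (p - 1) / \<nu> powr p * t * \<nu>) \<le>
      \<nu> powr (p - 1) * ((1 + a powr (p - 1) / \<nu> powr p * a) * \<nu>)"
    unfolding e1 e2 by (rule *)
  then show ?thesis using pos by (rule mult_left_le_imp_le)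
qed

definition seq_head :: "nat \<Rightarrow> (nat \<Rightarrow> 'z::real_vector) \<Rightarrow> nat \<Rightarrow> 'z" where
  "seq_head n w = (\<lambda>k. if k < n then w k else 0)"

definition seq_tail :: "nat \<Rightarrow> (nat \<Rightarrow> 'z::real_vector) \<Rightarrow> nat \<Rightarrow> 'z" where
  "seq_tail n w = (\<lambda>k. if k < n then 0 else w k)"

lemma head_tail_simps:
  "seq_head n (\<lambda>k. w k - v k) = (\<lambda>k. seq_head n w k - seq_head n v k)"
  "seq_tail n (\<lambda>k. w k - v k) = (\<lambda>k. seq_tail n w k - seq_tail n v k)"
  "seq_head n (\<lambda>k. c *\<^sub>R w k) = (\<lambda>k. c *\<^sub>R seq_head n w k)"
  "seq_tail n (\<lambda>k. c *\<^sub>R w k) = (\<lambda>k. c *\<^sub>R seq_tail n w k)"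
  by (auto simp: seq_head_def seq_tail_def)

text \<open>
  The compression \<open>E\<close> now takes values in the first \<open>n\<close> coordinates of a sequence space with a
  \<open>p\<close>-additive norm, and \<open>J\<close> embeds these coordinates isometrically. A norm attaining map \<open>H\<close> close to
  \<open>E \<circ> f\<close> has small tails, but \<open>J \<circ> H\<close> forgets them and need not attain its norm any more. The loss is
  compensated by the real Lipschitz function \<open>p \<mapsto> N' (tail (H p - H q2))\<close>, whose slope at the
  attaining pair is the norm of the tail there.
\<close>

theorem dense_attaining_sequence_compression:
  fixes N' :: "(nat \<Rightarrow> 'z::real_normed_vector) \<Rightarrow> real"
  assumes "fun_space U N" "fun_space W N'" and dW: "dense_attaining TYPE('m::metric_space) W N'"
    and \<rho>: "1 \<le> (\<rho>::real)"
    and head: "\<And>n w. w \<in> W \<Longrightarrow> seq_head n w \<in> W" and tail: "\<And>n w. w \<in> W \<Longrightarrow> seq_tail n w \<in> W"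
    and split: "\<And>n w. w \<in> W \<Longrightarrow> N' w powr \<rho> = N' (seq_head n w) powr \<rho> + N' (seq_tail n w) powr \<rho>"
    and compr: "\<And>T e. finite T \<Longrightarrow> T \<subseteq> U \<Longrightarrow> (0::real) < e \<Longrightarrow>
      \<exists>n E J. diff_linear U E \<and> (\<forall>f\<in>U. E f \<in> W \<and> N' (E f) \<le> N f \<and> seq_tail n (E f) = (\<lambda>k. 0)) \<and>
        diff_linear W J \<and> (\<forall>w\<in>W. J w \<in> U \<and> N (J w) = N' (seq_head n w)) \<and>
        (\<forall>s\<in>T. N (\<lambda>x. s x - J (E s) x) \<le> e)"
  shows "dense_attaining TYPE('m) U N"
proof (rule dense_attaining_nonzeroI[OF assms(1) dense_attaining_two_points[OF assms(2) dW]])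
  interpret U: fun_space U N by fact
  interpret W: fun_space W N' by fact
  fix f :: "'m \<Rightarrow> _" and e :: real and p1 q1
  assume e: "e > 0" and f: "lipK U N f" and pq1: "p1 \<noteq> q1" "N (slope f p1 q1) > 0"
  have fm: "f p \<in> U" for p by (rule U.lipK_memD[OF f])
  have sm: "slope f p q \<in> U" for p q by (rule U.slope_mem[OF fm])
  \<comment> \<open>Any nonzero slope serves here, since \<open>L\<close> only has to keep the head
    of the attaining slope away from 0.\<close>
  define L where "L = N (slope f p1 q1)"
  \<comment> \<open>Five errors of size \<open>d\<close> occur at the end. The head of the attaining
    slope will have norm at least \<open>L - 3 * d\<close>, which \<open>4 * d \<le> L\<close> makes
    at least \<open>d\<close>.\<close>
  define d where "d = min (L / 4) (e / 5)"
  have d: "d > 0" "4 * d \<le> L" "5 * d \<le> e" using pq1 e by (auto simp: d_def L_def)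
  obtain P where P: "finite P"
    "\<And>p q. p \<noteq> q \<Longrightarrow> \<exists>(p', q')\<in>P. N (\<lambda>x. slope f p q x - slope f p' q' x) < d"
    using U.lipK_net[OF f d(1)] by auto
  define T where "T = (\<lambda>(p, q). slope f p q) ` insert (p1, q1) P"
  have T: "finite T" "T \<subseteq> U" "slope f p1 q1 \<in> T"
    using P(1) sm by (auto simp: T_def)
  obtain n E J where E: "diff_linear U E"
    "\<forall>f\<in>U. E f \<in> W \<and> N' (E f) \<le> N f \<and> seq_tail n (E f) = (\<lambda>k. 0)"
    and J: "diff_linear W J" "\<forall>w\<in>W. J w \<in> U \<and> N (J w) = N' (seq_head n w)"
    and net0: "\<forall>s\<in>T. N (\<lambda>x. s x - J (E s) x) \<le> d"
    using compr[OF T(1,2) d(1)] by (elim exE conjE) (rule that; assumption)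
  note net = net0[rule_format]
  have EW: "E g \<in> W" and E_le: "N' (E g) \<le> N g" and tail_E: "seq_tail n (E g) = (\<lambda>k. 0)"
    if "g \<in> U" for g using E(2) that by auto
  have JU: "J w \<in> U" and NJ: "N (J w) = N' (seq_head n w)" if "w \<in> W" for w using J(2) that by auto
  have head_le: "N' (seq_head n w) \<le> N' w" and tail_le: "N' (seq_tail n w) \<le> N' w" if w: "w \<in> W" for w
  proof -
    have "N' (seq_head n w) powr \<rho> \<le> N' w powr \<rho>" "N' (seq_tail n w) powr \<rho> \<le> N' w powr \<rho>"
      using split[OF w, of n] by auto
    then show "N' (seq_head n w) \<le> N' w" "N' (seq_tail n w) \<le> N' w"
      using powr_less_mono2[of \<rho> "N' w"] W.N_nonneg[OF w] \<rho> by (meson not_le order_less_le_trans zero_less_one)+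
  qed
  have J_le: "N (J w) \<le> N' w" if "w \<in> W" for w using NJ head_le that by simp
  define EF where "EF = (\<lambda>p. E (f p))"
  have slEF: "slope EF p q = E (slope f p q)" for p q
    unfolding EF_def by (rule diff_linear_slope[of U E f, OF E(1) fm])
  have "lipK W N' EF"
    unfolding EF_def by (rule lipK_compose[OF assms(1,2) E(1) EW _ f, where C = 1]) (simp_all add: E_le)
  then obtain H where H: "lipK W N' H" "attains N' H"
    "\<And>p q. p \<noteq> q \<Longrightarrow> N' (\<lambda>x. slope EF p q x - slope H p q x) \<le> d"
    using dW[unfolded dense_attaining_def, rule_format, of d EF] d(1) by blast
  have Hm: "H p \<in> W" for p by (rule W.lipK_memD[OF H(1)])
  have hm: "slope H p q \<in> W" for p q by (rule W.slope_mem[OF Hm])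
  have Em: "E (slope f p q) \<in> W" for p q by (rule EW[OF sm])
  obtain p2 q2 where pq2: "p2 \<noteq> q2" "\<And>p q. p \<noteq> q \<Longrightarrow> N' (slope H p q) \<le> N' (slope H p2 q2)"
    using H(2) by (auto simp: attains_def)
  define y where "y = slope H p2 q2"
  have y: "y \<in> W" unfolding y_def by (rule hm)
  define \<nu> where "\<nu> = N' (seq_head n y)"
  define a where "a = N' (seq_tail n y)"
  \<comment> \<open>The values of \<open>E\<close> have no tail, so the tail of a slope of
    \<open>H\<close> is entirely part of its distance from the corresponding slope of
    \<open>EF\<close>.\<close>
  have tail_small: "N' (seq_tail n (slope H p q)) \<le> d" if pq: "p \<noteq> q" for p q
  proof -
    have "seq_tail n (\<lambda>x. slope H p q x - slope EF p q x) = seq_tail n (slope H p q)"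
      by (simp add: head_tail_simps slEF tail_E[OF sm])
    then have "N' (seq_tail n (slope H p q)) \<le> N' (\<lambda>x. slope H p q x - slope EF p q x)"
      using tail_le[OF W.diff_mem[OF hm Em]] by (metis slEF)
    also have "\<dots> = N' (\<lambda>x. slope EF p q x - slope H p q x)"
      unfolding slEF by (rule W.N_minus_commute[OF hm Em])
    finally show ?thesis using H(3)[OF pq] by linarith
  qed
  have a: "0 \<le> a" "a \<le> d"
    using W.N_nonneg[OF tail[OF y]] tail_small[OF pq2(1)] by (auto simp: a_def y_def)
  \<comment> \<open>Together with \<open>a \<le> d\<close> this gives \<open>a \<le> \<nu>\<close>:
    at the attaining pair the head dominates the tail, which keeps the correction below
    small.\<close>
  have "d \<le> \<nu>"
  proof -
    let ?s = "slope f p1 q1"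
    have "L \<le> N (J (E ?s)) + d"
      using U.N_le_add_diff[of ?s "J (E ?s)", OF sm JU[OF Em]] net[OF T(3)] by (simp add: L_def)
    moreover have "N (J (E ?s)) \<le> N' (E ?s)" by (rule J_le[OF Em])
    moreover have "N' (E ?s) \<le> N' (slope H p1 q1) + d"
      using W.N_le_add_diff[of "E ?s" "slope H p1 q1", OF Em hm] H(3)[OF pq1(1)] by (simp add: slEF)
    moreover have "N' (slope H p1 q1) \<le> N' y" unfolding y_def by (rule pq2(2)[OF pq1(1)])
    moreover have "N' y \<le> \<nu> + a"
      using W.triangle[OF head[OF y, of n] tail[OF y, of n]]
      by (simp add: \<nu>_def a_def seq_head_def seq_tail_def if_distrib cong: if_cong)
    ultimately show ?thesis using d(2) a(2) by linarith
  qed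
  then have \<nu>: "0 < \<nu>" "a \<le> \<nu>" using d(1) a(2) by linarith+
  have NJy: "N (J y) = \<nu>" using NJ[OF y] by (simp add: \<nu>_def)
  \<comment> \<open>The coefficient of the supporting functional in \<open>powr_sum_le_imp\<close>.
    If \<open>a = 0\<close> then \<open>c = 0\<close>, also for \<open>\<rho> = 1\<close>, because
    \<open>0 powr 0 = 0\<close>.\<close>
  define c where "c = a powr (\<rho> - 1) / \<nu> powr \<rho>"
  have c: "0 \<le> c" by (simp add: c_def)
  have c\<nu>: "c * \<nu> \<le> 1"
  proof -
    have "a powr (\<rho> - 1) \<le> \<nu> powr (\<rho> - 1)" using \<nu>(2) a(1) \<rho> by (intro powr_mono2) auto
    then have "a powr (\<rho> - 1) * \<nu> \<le> \<nu> powr (\<rho> - 1) * \<nu>" using \<nu>(1) by simp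
    also have "\<nu> powr (\<rho> - 1) * \<nu> = \<nu> powr \<rho>"
      using powr_mult_base[of \<nu> "\<rho> - 1"] \<nu>(1) by (simp add: mult.commute)
    finally show ?thesis using \<nu>(1) by (simp add: c_def field_simps)
  qed
  \<comment> \<open>A seminorm of a difference replaces a norming functional of the tail. Anchoring
    at \<open>q2\<close> makes \<open>g q2 = 0\<close>, so the difference \<open>g p2 - g q2\<close>
    is the full seminorm of the tail of \<open>H p2 - H q2\<close>, times \<open>c\<close>.\<close>
  define g where "g = (\<lambda>p. c * N' (seq_tail n (\<lambda>k. H p k - H q2 k)))"
  define sg where "sg = (\<lambda>p q. (g p - g q) / dist p q)"
  have tm: "seq_tail n (\<lambda>k. H p k - H q k) \<in> W" for p q by (intro tail W.diff_mem Hm)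
  have tail_slope: "N' (seq_tail n (slope H p q)) = N' (seq_tail n (\<lambda>k. H p k - H q k)) / dist p q" for p q
    using W.N_scale[OF tm, of "1 / dist p q" p q] by (simp add: slope_def head_tail_simps(4))
  have sg_le: "\<bar>sg p q\<bar> \<le> c * N' (seq_tail n (slope H p q))" for p q
  proof -
    have "\<bar>N' (seq_tail n (\<lambda>k. H p k - H q2 k)) - N' (seq_tail n (\<lambda>k. H q k - H q2 k))\<bar> \<le>
        N' (seq_tail n (\<lambda>k. H p k - H q k))"
    proof -
      have d1: "(\<lambda>k. seq_tail n (\<lambda>k. H p k - H q2 k) k - seq_tail n (\<lambda>k. H q k - H q2 k) k) =
          seq_tail n (\<lambda>k. H p k - H q k)"
        by (auto simp: seq_tail_def)
      have d2: "(\<lambda>k. seq_tail n (\<lambda>k. H q k - H q2 k) k - seq_tail n (\<lambda>k. H p k - H q2 k) k) =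
          (\<lambda>k. - seq_tail n (\<lambda>k. H p k - H q k) k)"
        by (auto simp: seq_tail_def)
      show ?thesis
        using W.N_le_add_diff[OF tm tm, of p q2 q q2] W.N_le_add_diff[OF tm tm, of q q2 p q2]
        unfolding d1 d2 W.N_minus[OF tm] by linarith
    qed
    then have "\<bar>g p - g q\<bar> \<le> c * N' (seq_tail n (\<lambda>k. H p k - H q k))"
      using c by (simp add: g_def abs_mult mult_left_mono flip: right_diff_distrib)
    then show ?thesis
      unfolding tail_slope sg_def abs_divide times_divide_eq_right by (simp add: divide_right_mono)
  qed
  have sg2: "sg p2 q2 = c * a"
  proof -
    have "seq_tail n (\<lambda>k. H q2 k - H q2 k) = (\<lambda>k. 0)" by (auto simp: seq_tail_def)
    then have "g q2 = 0" by (simp only: g_def W.N_zero mult_zero_right)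
    then show ?thesis by (simp add: sg_def a_def y_def tail_slope g_def)
  qed
  \<comment> \<open>The correction points in the direction \<open>J y\<close>, so at the attaining
    pair the two summands of the slope are nonnegative multiples of \<open>J y\<close> and their
    norms add up.\<close>
  define G where "G = (\<lambda>p x. J (H p) x + g p *\<^sub>R J y x)"
  have slG: "slope G p q = (\<lambda>x. J (slope H p q) x + sg p q *\<^sub>R J y x)" for p q
    unfolding diff_linear_slope[of W J H, OF J(1) Hm, symmetric]
    by (auto simp: slope_def G_def sg_def algebra_simps diff_divide_distrib)
  have Jh: "J (slope H p q) \<in> U" for p q by (rule JU[OF hm])
  have sgJ: "(\<lambda>x. sg p q *\<^sub>R J y x) \<in> U" for p q by (intro U.scale_mem JU y)
  have slGm: "slope G p q \<in> U" for p q unfolding slG by (intro U.add_mem Jh sgJ)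
  have "lipK U N G"
    unfolding lipK_def
  proof (intro conjI allI impI)
    show "G p \<in> U" for p unfolding G_def by (intro U.add_mem U.scale_mem JU y Hm)
    fix p q :: "nat \<Rightarrow> 'm" assume pq: "\<forall>i. p i \<noteq> q i"
    obtain l r where l: "l \<in> W" "strict_mono r"
      "(\<lambda>i. N' (\<lambda>x. slope H (p (r i)) (q (r i)) x - l x)) \<longlonglongrightarrow> 0"
      using H(1)[unfolded lipK_def, THEN conjunct2, rule_format, of p q] pq by blast
    \<comment> \<open>The correction has bounded real slopes, so a further subsequence makes them
      converge as well.\<close>
    have "\<bar>sg (p i) (q i)\<bar> \<le> c * d" for i
      using order_trans[OF sg_le mult_left_mono[OF tail_small c]] pq by blast
    then have "bounded (range (\<lambda>i. sg (p (r i)) (q (r i))))"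
      by (auto simp: bounded_iff intro!: exI[of _ "c * d"])
    then obtain \<sigma> r' where r': "strict_mono (r' :: nat \<Rightarrow> nat)"
      "((\<lambda>i. sg (p (r i)) (q (r i))) \<circ> r') \<longlonglongrightarrow> \<sigma>"
      using bounded_imp_convergent_subsequence by blast
    let ?p = "\<lambda>i. p (r (r' i))" and ?q = "\<lambda>i. q (r (r' i))"
    let ?l = "\<lambda>x. J l x + \<sigma> *\<^sub>R J y x"
    have lm: "?l \<in> U" by (intro U.add_mem U.scale_mem JU l(1) y)
    have 1: "N (\<lambda>x. slope G (?p i) (?q i) x - ?l x) \<le>
        N' (\<lambda>x. slope H (?p i) (?q i) x - l x) + \<bar>sg (?p i) (?q i) - \<sigma>\<bar> * \<nu>" for i
    proof -
      have "(\<lambda>x. slope G (?p i) (?q i) x - ?l x) =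
          (\<lambda>x. J (\<lambda>x. slope H (?p i) (?q i) x - l x) x + (sg (?p i) (?q i) - \<sigma>) *\<^sub>R J y x)"
        by (auto simp: slG diff_linear_diff[OF J(1) hm l(1)] algebra_simps)
      then have "N (\<lambda>x. slope G (?p i) (?q i) x - ?l x) \<le>
          N (J (\<lambda>x. slope H (?p i) (?q i) x - l x)) + N (\<lambda>x. (sg (?p i) (?q i) - \<sigma>) *\<^sub>R J y x)"
        using U.triangle[OF JU[OF W.diff_mem[OF hm l(1)]] U.scale_mem[OF JU[OF y]]] by simp
      then show ?thesis
        using J_le[of "\<lambda>x. slope H (?p i) (?q i) x - l x", OF W.diff_mem[OF hm l(1)]]
        by (simp add: U.N_scale[OF JU[OF y]] NJy)
    qed
    have 2: "0 \<le> N (\<lambda>x. slope G (?p i) (?q i) x - ?l x)" for i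
      by (intro U.N_nonneg U.diff_mem slGm lm)
    have "(\<lambda>i. N' (\<lambda>x. slope H (?p i) (?q i) x - l x)) \<longlonglongrightarrow> 0"
      using LIMSEQ_subseq_LIMSEQ[OF l(3) r'(1)] by (simp add: o_def)
    moreover have "(\<lambda>i. \<bar>sg (?p i) (?q i) - \<sigma>\<bar> * \<nu>) \<longlonglongrightarrow> 0"
      using tendsto_rabs_zero[OF LIM_zero[OF r'(2)]] by (intro tendsto_mult_left_zero) (simp add: o_def)
    ultimately have 3: "(\<lambda>i. N' (\<lambda>x. slope H (?p i) (?q i) x - l x) + \<bar>sg (?p i) (?q i) - \<sigma>\<bar> * \<nu>) \<longlonglongrightarrow> 0"
      by (rule tendsto_add_zero)
    show "\<exists>l r. l \<in> U \<and> strict_mono r \<and>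
        (\<lambda>i. N (\<lambda>x. slope G (p (r i)) (q (r i)) x - l x)) \<longlonglongrightarrow> 0"
      using lm strict_mono_o[OF l(2) r'(1)] LIMSEQ_0_sandwich[OF 3 1 2]
      by (intro exI[of _ ?l] exI[of _ "r \<circ> r'"]) (simp add: o_def)
  qed
  moreover have "attains N G"
  proof -
    have "slope G p2 q2 = (\<lambda>x. (1 + c * a) *\<^sub>R J y x)"
      by (simp add: slG sg2 y_def[symmetric] algebra_simps)
    then have eq: "N (slope G p2 q2) = (1 + c * a) * \<nu>"
      using c a(1) by (simp add: U.N_scale[OF JU[OF y]] NJy)
    have "N (slope G p q) \<le> (1 + c * a) * \<nu>" if pq: "p \<noteq> q" for p q
    proof -
      define u where "u = N' (seq_head n (slope H p q))"
      define t where "t = N' (seq_tail n (slope H p q))"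
      have ut: "0 \<le> u" "0 \<le> t"
        using W.N_nonneg[OF head[OF hm]] W.N_nonneg[OF tail[OF hm]] by (auto simp: u_def t_def)
      have "N (slope G p q) \<le> N (J (slope H p q)) + N (\<lambda>x. sg p q *\<^sub>R J y x)"
        unfolding slG by (rule U.triangle[OF Jh sgJ])
      also have "\<dots> = u + \<bar>sg p q\<bar> * \<nu>"
        by (simp add: u_def NJ[OF hm] U.N_scale[OF JU[OF y]] NJy)
      also have "\<dots> \<le> u + c * t * \<nu>"
        using sg_le[of p q] \<nu>(1) by (simp add: t_def mult_right_mono)
      \<comment> \<open>Only the pair \<open>(u, t)\<close> of head and tail norms matters now.
        Since \<open>H\<close> attains its norm at the slope \<open>y\<close>, this pair lies in the
        two-dimensional ball with \<open>(\<nu>, a)\<close> on its boundary.\<close>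
      also have "\<dots> \<le> (1 + c * a) * \<nu>"
        unfolding c_def
      proof (rule powr_sum_le_imp[OF \<rho> \<nu>(1) a(1) ut])
        have "N' (slope H p q) powr \<rho> \<le> N' y powr \<rho>"
          using pq2(2)[OF pq] W.N_nonneg[OF hm] \<rho> by (intro powr_mono2) (auto simp: y_def)
        then show "u powr \<rho> + t powr \<rho> \<le> \<nu> powr \<rho> + a powr \<rho>"
          using split[OF hm, of p q n] split[OF y, of n] by (simp add: u_def t_def \<nu>_def a_def)
      qed
      finally show ?thesis .
    qed
    then show ?thesis using pq2(1) eq unfolding attains_def by (intro exI[of _ p2] exI[of _ q2]) simp
  qed
  moreover have "N (\<lambda>x. slope f p q x - slope G p q x) \<le> e" if pq: "p \<noteq> q" for p q
  proof -
    obtain p' q' where pq': "(p', q') \<in> P" "N (\<lambda>x. slope f p q x - slope f p' q' x) < d"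
      using P(2)[OF pq] by blast
    let ?s = "slope f p q" and ?t = "slope f p' q'" and ?h = "slope H p q"
    have t: "?t \<in> T" using pq'(1) by (force simp: T_def)
    have JE: "J (E (slope f a b)) \<in> U" for a b by (intro JU Em)
    have dst: "(\<lambda>x. ?t x - ?s x) \<in> U" by (intro U.diff_mem sm)
    have 1: "N (\<lambda>x. J (E ?t) x - J (E ?s) x) \<le> d"
      unfolding diff_linear_diff[OF J(1) Em Em, symmetric] diff_linear_diff[OF E(1) sm sm, symmetric]
      using J_le[OF EW[OF dst]] E_le[OF dst] pq'(2) U.N_minus_commute[of ?s ?t, OF sm sm]
      by linarith
    have 2: "N (\<lambda>x. J (E ?s) x - J ?h x) \<le> d"
      unfolding diff_linear_diff[OF J(1) Em hm, symmetric]
      using J_le[OF W.diff_mem[OF Em hm], of p q p q] H(3)[OF pq] by (simp add: slEF)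
    have 3: "N (\<lambda>x. J ?h x - slope G p q x) \<le> d"
    proof -
      have "(\<lambda>x. J ?h x - slope G p q x) = (\<lambda>x. - (sg p q *\<^sub>R J y x))" by (simp add: slG)
      then have "N (\<lambda>x. J ?h x - slope G p q x) = \<bar>sg p q\<bar> * \<nu>"
        by (simp add: U.N_minus[OF sgJ] U.N_scale[OF JU[OF y]] NJy)
      also have "\<dots> \<le> (c * d) * \<nu>"
        using order_trans[OF sg_le mult_left_mono[OF tail_small[OF pq] c]] \<nu>(1)
        by (intro mult_right_mono) auto
      also have "\<dots> \<le> d" using mult_right_mono[OF c\<nu>, of d] d(1) by (simp add: mult_ac)
      finally show ?thesis .
    qed
    have "N (\<lambda>x. ?s x - slope G p q x) \<le> N (\<lambda>x. ?s x - ?t x) + N (\<lambda>x. ?t x - J (E ?t) x)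
        + N (\<lambda>x. J (E ?t) x - J (E ?s) x) + N (\<lambda>x. J (E ?s) x - J ?h x) + N (\<lambda>x. J ?h x - slope G p q x)"
      using U.N_diff_triangle[of ?s ?t "slope G p q", OF sm sm slGm]
        U.N_diff_triangle[of ?t "J (E ?t)" "slope G p q", OF sm JE slGm]
        U.N_diff_triangle[of "J (E ?t)" "J (E ?s)" "slope G p q", OF JE JE slGm]
        U.N_diff_triangle[of "J (E ?s)" "J ?h" "slope G p q", OF JE Jh slGm]
      by linarith
    then show ?thesis
      using 1 2 3 pq'(2) net[OF t] d(3) by linarith
  qed
  ultimately show "\<exists>g. lipK U N g \<and> attains N g \<and>
    slopes_close N f g e" by blast
qed

section \<open>Continuous functions\<close>

text \<open>\<open>Y\<close> is the space of all functions on a one-point set, which allows it to be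
  the small space of a compression.\<close>

lemma fun_space_repr_of_type:
  "fun_space_repr UNIV (\<lambda>w. norm (w ())) (ns_of_type :: 'y::real_normed_vector normed_sp) (\<lambda>w. w ())"
proof
  show "ns_carrier (ns_of_type :: 'y normed_sp) = (\<lambda>w. w ()) ` UNIV"
    by (auto simp: ns_of_type_def intro: image_eqI[of _ _ "\<lambda>_. y" for y])
qed (auto simp: ns_of_type_def norm_triangle_ineq)

lemma continuous_map_scaleR:
  fixes f :: "'k \<Rightarrow> 'y::real_normed_vector"
  assumes "continuous_map K euclidean \<phi>" "continuous_map K euclidean f"
  shows "continuous_map K euclidean (\<lambda>x. \<phi> x *\<^sub>R f x)"
  using assms unfolding continuous_map_atin limitin_canonical_iff by (auto intro: tendsto_scaleR)

definition C_norm :: "'k topology \<Rightarrow> ('k \<Rightarrow> 'y::real_normed_vector) \<Rightarrow> real" where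
  "C_norm K f = Sup (insert 0 ((\<lambda>x. norm (f x)) ` topspace K))"

lemma C_norm_ge:
  assumes "compact_space K" "continuous_map K euclidean f" "x \<in> topspace K"
  shows "norm (f x) \<le> C_norm K f"
proof -
  have "compactin euclidean (f ` topspace K)"
    using assms(1,2) image_compactin unfolding compact_space_def by blast
  then have "bounded (f ` topspace K)" by (simp add: compact_imp_bounded)
  then have "bdd_above ((\<lambda>x. norm (f x)) ` topspace K)"
    by (auto simp: bounded_iff bdd_above_def)
  then have "bdd_above (insert 0 ((\<lambda>x. norm (f x)) ` topspace K))" by simp
  then show ?thesis unfolding C_norm_def using assms(3) by (intro cSup_upper) auto
qed

lemma C_norm_leI: "0 \<le> b \<Longrightarrow> (\<And>x. x \<in> topspace K \<Longrightarrow> norm (f x) \<le> b) \<Longrightarrow> C_norm K f \<le> b"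
  unfolding C_norm_def by (intro cSup_least) auto

lemma C_norm_nonneg:
  assumes "compact_space K" "continuous_map K euclidean f"
  shows "0 \<le> C_norm K f"
proof (cases "topspace K = {}")
  case False
  then obtain x where "x \<in> topspace K" by blast
  then show ?thesis using C_norm_ge[OF assms] norm_ge_zero order_trans by blast
qed (simp add: C_norm_def)

lemma C_norm_attained:
  assumes "compact_space K" "continuous_map K euclidean f" "0 < C_norm K f" "0 < e"
  shows "\<exists>x\<in>topspace K. C_norm K f - e < norm (f x)"
proof -
  \<comment> \<open>The maximum with 0 prevents the 0 adjoined in the supremum from being the
    element found.\<close>
  have "max 0 (C_norm K f - e) < C_norm K f" using assms by auto
  then obtain b where "b \<in> insert 0 ((\<lambda>x. norm (f x)) ` topspace K)" "max 0 (C_norm K f - e) < b"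
    unfolding C_norm_def[of K f] by (rule less_cSupE) auto
  then show ?thesis by auto
qed

lemma fun_space_C:
  fixes K :: "'k topology"
  assumes K: "compact_space K"
  shows "fun_space {f::'k \<Rightarrow> 'y::real_normed_vector. continuous_map K euclidean f} (C_norm K)"
proof (rule fun_spaceI; clarsimp)
  fix f g :: "'k \<Rightarrow> 'y" and c :: real
  assume f: "continuous_map K euclidean f"
  show "continuous_map K euclidean (\<lambda>x. c *\<^sub>R f x)"
    using continuous_map_scaleR[OF _ f, of "\<lambda>_. c"] by simp
  show "C_norm K (\<lambda>x. c *\<^sub>R f x) \<le> \<bar>c\<bar> * C_norm K f"
    by (rule C_norm_leI)
      (use C_norm_nonneg[OF K f] C_norm_ge[OF K f] in \<open>auto intro: mult_left_mono\<close>)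
  show "0 \<le> C_norm K f" by (rule C_norm_nonneg[OF K f])
  assume g: "continuous_map K euclidean g"
  show "continuous_map K euclidean (\<lambda>x. f x + g x)" by (rule continuous_map_add[OF f g])
  show "C_norm K (\<lambda>x. f x + g x) \<le> C_norm K f + C_norm K g"
    by (rule C_norm_leI)
      (use C_norm_nonneg[OF K] C_norm_ge[OF K] f g in \<open>auto intro!: norm_triangle_le add_mono add_nonneg_nonneg\<close>)
qed

lemma fun_space_repr_C:
  fixes K :: "'k topology"
  assumes K: "compact_space K"
  shows "fun_space_repr {f::'k \<Rightarrow> 'y::real_normed_vector. continuous_map K euclidean f} (C_norm K)
    (C_space K) (\<lambda>f. restrict f (topspace K))"
proof -
  interpret fun_space "{f::'k \<Rightarrow> 'y. continuous_map K euclidean f}" "C_norm K"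
    by (rule fun_space_C[OF K])
  show ?thesis
  proof
    have cont: "continuous_map K euclidean (restrict f (topspace K)) \<longleftrightarrow> continuous_map K euclidean f"
      for f :: "'k \<Rightarrow> 'y"
      using continuous_map_eq[of K euclidean f "restrict f (topspace K)"]
        continuous_map_eq[of K euclidean "restrict f (topspace K)" f] by auto
    show "ns_carrier (C_space K :: ('k \<Rightarrow> 'y) normed_sp) =
        (\<lambda>f. restrict f (topspace K)) ` {f. continuous_map K euclidean f}"
    proof (intro set_eqI iffI)
      fix f :: "'k \<Rightarrow> 'y" assume "f \<in> ns_carrier (C_space K)"
      then have "continuous_map K euclidean f" "f = restrict f (topspace K)"
        by (auto simp: C_space_def extensional_restrict)
      then show "f \<in> (\<lambda>f. restrict f (topspace K)) ` {f. continuous_map K euclidean f}" by blast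
    qed (auto simp: C_space_def cont)
  next
    fix f g :: "'k \<Rightarrow> 'y"
    assume f: "f \<in> {f. continuous_map K euclidean f}" and g: "g \<in> {f. continuous_map K euclidean f}"
      and 0: "C_norm K (\<lambda>x. f x - g x) = 0"
    have "norm (f x - g x) \<le> 0" if "x \<in> topspace K" for x
      using C_norm_ge[OF K _ that, of "\<lambda>x. f x - g x"] diff_mem[OF f g] 0 by simp
    then show "restrict f (topspace K) = restrict g (topspace K)" by (intro restrict_ext) simp
  qed (auto simp: C_space_def C_norm_def intro!: restrict_ext arg_cong[where f = Sup])
qed

text \<open>The point \<open>t0\<close> is one where \<open>s0\<close> almost attains its norm. An
  Urysohn function \<phi> with value 1 at \<open>t0\<close>, living where the finitely many
  functions hardly vary, blends \<open>f\<close> with the constant \<open>w\<close>. Convexity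
  bounds the blend by the larger of the two norms, and its value at \<open>t0\<close> is exactly
  \<open>w\<close>.\<close>

theorem dense_attaining_C:
  fixes K :: "'k topology"
  assumes K: "compact_space K" "Hausdorff_space K"
    and "dense_attaining TYPE('m::metric_space) UNIV (\<lambda>w. norm (w () :: 'y::real_normed_vector))"
  shows "dense_attaining TYPE('m) {f::'k \<Rightarrow> 'y. continuous_map K euclidean f} (C_norm K)"
proof (rule dense_attaining_compression[OF fun_space_C[OF K(1)]
      fun_space_repr.axioms(1)[OF fun_space_repr_of_type] assms(3)])
  let ?U = "{f::'k \<Rightarrow> 'y. continuous_map K euclidean f}"
  fix T :: "('k \<Rightarrow> 'y) set" and s0 and e :: real
  assume T: "finite T" "T \<subseteq> ?U" "s0 \<in> T" and s0: "0 < C_norm K s0" and e: "0 < e"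
  have Tc: "continuous_map K euclidean s" if "s \<in> T" for s using T that by auto
  obtain t0 where t0: "t0 \<in> topspace K" "C_norm K s0 - e < norm (s0 t0)"
    using C_norm_attained[OF K(1) Tc[OF T(3)] s0 e] by blast
  \<comment> \<open>The neighbourhood of \<open>t0\<close> on which every member of \<open>T\<close>
    stays within \<open>e\<close> of its value at \<open>t0\<close>; finiteness of \<open>T\<close>
    makes it open.\<close>
  define V where "V = topspace K \<inter> (\<Inter>s\<in>T. {x \<in> topspace K. norm (s x - s t0) < e})"
  have "openin K {x \<in> topspace K. norm (s x - s t0) < e}" if "s \<in> T" for s
  proof -
    have "openin K {x \<in> topspace K. s x \<in> ball (s t0) e}"
      by (rule openin_continuous_map_preimage[OF Tc[OF that]]) simp
    then show ?thesis by (simp add: dist_norm norm_minus_commute)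
  qed
  then have V: "openin K V" "t0 \<in> V"
    unfolding V_def using T(1,3) t0(1) e by (auto intro!: openin_INT2 openin_Int)
  have Vs: "norm (s x - s t0) < e" if "s \<in> T" "x \<in> V" for s x using that by (auto simp: V_def)
  have nK: "normal_space K" using compact_Hausdorff_or_regular_imp_normal_space K by blast
  have "closedin K {t0}" using K(2) t0(1) by (simp add: closedin_Hausdorff_singleton)
  moreover have "closedin K (topspace K - V)" using V(1) by blast
  moreover have "disjnt (topspace K - V) {t0}" using V(2) by (simp add: disjnt_def)
  ultimately obtain \<phi> where \<phi>: "continuous_map K (top_of_set {0..1::real}) \<phi>"
    "\<phi> ` (topspace K - V) \<subseteq> {0}" "\<phi> ` {t0} \<subseteq> {1}"
    using Urysohn_lemma[OF nK, of "topspace K - V" "{t0}" 0 1] by auto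
  have \<phi>c: "continuous_map K euclidean \<phi>" and \<phi>01: "\<And>x. x \<in> topspace K \<Longrightarrow> 0 \<le> \<phi> x \<and> \<phi> x \<le> 1"
    using \<phi>(1) by (auto simp: continuous_map_in_subtopology image_subset_iff Pi_iff)
  define R where "R = (\<lambda>(f::'k \<Rightarrow> 'y) (w::unit \<Rightarrow> 'y) x. (1 - \<phi> x) *\<^sub>R f x + \<phi> x *\<^sub>R w ())"
  have Rc: "continuous_map K euclidean (R f w)" if f: "continuous_map K euclidean f" for f w
    unfolding R_def by (intro continuous_map_add continuous_map_scaleR f \<phi>c continuous_map_diff) auto
  have Rlin: "R (\<lambda>x. c *\<^sub>R (f x - g x)) (\<lambda>i. c *\<^sub>R (w i - v i)) = (\<lambda>x. c *\<^sub>R (R f w x - R g v x))"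
    for f g w v c unfolding R_def by (auto simp: algebra_simps)
  have Rle: "C_norm K (R f w) \<le> max (C_norm K f) (norm (w ()))" if f: "continuous_map K euclidean f" for f w
  proof (rule C_norm_leI)
    show "0 \<le> max (C_norm K f) (norm (w ()))" by (simp add: le_max_iff_disj)
    fix x assume x: "x \<in> topspace K"
    have "norm (R f w x) \<le> (1 - \<phi> x) * norm (f x) + \<phi> x * norm (w ())"
      unfolding R_def using \<phi>01[OF x] by (intro norm_triangle_le) simp
    also have "\<dots> \<le> (1 - \<phi> x) * max (C_norm K f) (norm (w ())) + \<phi> x * max (C_norm K f) (norm (w ()))"
      using \<phi>01[OF x] C_norm_ge[OF K(1) f x] by (intro add_mono mult_left_mono) auto
    finally show "norm (R f w x) \<le> max (C_norm K f) (norm (w ()))" by (simp add: algebra_simps)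
  qed
  have Rge: "norm (w ()) \<le> C_norm K (R f w)" if f: "continuous_map K euclidean f" for f w
  proof -
    have "R f w t0 = w ()" using \<phi>(3) by (simp add: R_def)
    then show ?thesis using C_norm_ge[OF K(1) Rc[OF f] t0(1), of w] by simp
  qed
  have net: "C_norm K (\<lambda>x. s x - R s (\<lambda>i. s t0) x) \<le> e" if s: "s \<in> T" for s
  proof (rule C_norm_leI)
    fix x assume x: "x \<in> topspace K"
    have "s x - R s (\<lambda>i. s t0) x = \<phi> x *\<^sub>R (s x - s t0)" by (simp add: R_def algebra_simps)
    moreover have "\<phi> x * norm (s x - s t0) \<le> e"
    proof (cases "x \<in> V")
      case True
      then show ?thesis using mult_mono[of "\<phi> x" 1 "norm (s x - s t0)" e] \<phi>01[OF x] Vs[OF s True] e by simp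
    next
      case False
      then have "\<phi> x = 0" using \<phi>(2) x by auto
      then show ?thesis using e by simp
    qed
    ultimately show "norm (s x - R s (\<lambda>i. s t0) x) \<le> e" using \<phi>01[OF x] by simp
  qed (use e in simp)
  show "\<exists>(E :: ('k \<Rightarrow> 'y) \<Rightarrow> unit \<Rightarrow> 'y) R. compression ?U (C_norm K) UNIV (\<lambda>w. norm (w ())) E R \<and>
      C_norm K s0 - e \<le> norm (E s0 ()) \<and> (\<forall>s\<in>T. C_norm K (\<lambda>x. s x - R s (E s) x) \<le> e)"
    unfolding compression_def
    by (rule exI[of _ "\<lambda>f i. f t0"], rule exI[of _ R])
      (use C_norm_ge[OF K(1) _ t0(1)] Rc Rge Rle Rlin t0(2) net in \<open>auto simp: diff_linear_def\<close>)
qed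

section \<open>Strongly measurable functions\<close>

lemma strongly_measurableI_simple: "simple_function \<mu> f \<Longrightarrow> strongly_measurable \<mu> f"
  unfolding strongly_measurable_def by (intro exI[of _ "\<lambda>_. f"]) auto

lemma strongly_measurable_add:
  assumes "strongly_measurable \<mu> f" "strongly_measurable \<mu> g"
  shows "strongly_measurable \<mu> (\<lambda>x. f x + g x)"
proof -
  obtain s t where "\<forall>i. simple_function \<mu> (s i)" "\<forall>x\<in>space \<mu>. (\<lambda>i. s i x) \<longlonglongrightarrow> f x"
    "\<forall>i. simple_function \<mu> (t i)" "\<forall>x\<in>space \<mu>. (\<lambda>i. t i x) \<longlonglongrightarrow> g x"
    using assms unfolding strongly_measurable_def by blast
  then show ?thesis unfolding strongly_measurable_def
    by (intro exI[of _ "\<lambda>i x. s i x + t i x"]) (auto intro!: tendsto_add simple_function_compose2[of _ _ _ "(+)"])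
qed

lemma strongly_measurable_simple_scaleR:
  assumes "simple_function \<mu> a" "strongly_measurable \<mu> f"
  shows "strongly_measurable \<mu> (\<lambda>x. a x *\<^sub>R f x)"
proof -
  obtain s where "\<forall>i. simple_function \<mu> (s i)" "\<forall>x\<in>space \<mu>. (\<lambda>i. s i x) \<longlonglongrightarrow> f x"
    using assms unfolding strongly_measurable_def by blast
  then show ?thesis using assms(1) unfolding strongly_measurable_def
    by (intro exI[of _ "\<lambda>i x. a x *\<^sub>R s i x"])
      (auto intro!: tendsto_scaleR simple_function_compose2[of _ _ _ "(*\<^sub>R)"])
qed

lemma strongly_measurable_scaleR: "strongly_measurable \<mu> f \<Longrightarrow> strongly_measurable \<mu> (\<lambda>x. c *\<^sub>R f x)"
  by (rule strongly_measurable_simple_scaleR) auto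

lemma strongly_measurable_const: "strongly_measurable \<mu> (\<lambda>x. c)"
  by (rule strongly_measurableI_simple) simp

lemma strongly_measurable_indicator:
  "A \<in> sets \<mu> \<Longrightarrow> strongly_measurable \<mu> f \<Longrightarrow> strongly_measurable \<mu> (\<lambda>x. indicator A x *\<^sub>R f x)"
  by (rule strongly_measurable_simple_scaleR) auto

lemma strongly_measurable_diff:
  "strongly_measurable \<mu> f \<Longrightarrow> strongly_measurable \<mu> g \<Longrightarrow> strongly_measurable \<mu> (\<lambda>x. f x - g x)"
  using strongly_measurable_add[of \<mu> f "\<lambda>x. (-1) *\<^sub>R g x"] strongly_measurable_scaleR[of \<mu> g "-1"] by simp

lemma strongly_measurable_sum:
  "(\<And>i. i \<in> I \<Longrightarrow> strongly_measurable \<mu> (f i)) \<Longrightarrow> strongly_measurable \<mu> (\<lambda>x. \<Sum>i\<in>I. f i x)"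
  by (induction I rule: infinite_finite_induct)
    (auto intro: strongly_measurable_const strongly_measurable_add)

lemma borel_measurable_norm_strongly:
  assumes "strongly_measurable \<mu> f"
  shows "(\<lambda>x. norm (f x)) \<in> borel_measurable \<mu>"
proof -
  obtain s where s: "\<forall>i. simple_function \<mu> (s i)" "\<forall>x\<in>space \<mu>. (\<lambda>i. s i x) \<longlonglongrightarrow> f x"
    using assms unfolding strongly_measurable_def by blast
  show ?thesis
  proof (rule borel_measurable_LIMSEQ_real)
    show "(\<lambda>i. norm (s i x)) \<longlonglongrightarrow> norm (f x)" if "x \<in> space \<mu>" for x
      using s(2) that by (auto intro: tendsto_norm)
    show "(\<lambda>x. norm (s i x)) \<in> borel_measurable \<mu>" for i
      by (rule borel_measurable_simple_function) (use s(1) in \<open>auto intro: simple_function_compose1\<close>)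
  qed
qed

lemma UN_eq_constI: "x \<in> C \<Longrightarrow> (\<And>h. h \<in> C \<Longrightarrow> F h = K) \<Longrightarrow> (\<Union>h\<in>C. F h) = K"
  by auto

text \<open>Each union in \<open>ae_classes\<close> runs over a constant family, because the
  operations respect almost everywhere equality; \<open>cong\<close> frees the norm from the
  representative chosen by \<open>SOME\<close>.\<close>

lemma fun_space_repr_ae:
  fixes U :: "('b \<Rightarrow> 'y::real_normed_vector) set"
  assumes "fun_space U N"
    and cong: "\<And>f g. f \<in> U \<Longrightarrow> g \<in> U \<Longrightarrow> (AE x in \<mu>. f x = g x) \<Longrightarrow> N f = N g"
    and null: "\<And>f. f \<in> U \<Longrightarrow> N f = 0 \<Longrightarrow> (AE x in \<mu>. f x = 0)"
  shows "fun_space_repr U N (ae_classes \<mu> U N) (\<lambda>f. ae_rel \<mu> U `` {f})"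
proof -
  interpret fun_space U N by fact
  have eqv: "equiv U (ae_rel \<mu> U)"
  proof (rule equivI)
    show "ae_rel \<mu> U \<subseteq> U \<times> U" by (auto simp: ae_rel_def)
    show "refl_on U (ae_rel \<mu> U)" by (auto simp: refl_on_def ae_rel_def)
    show "sym (ae_rel \<mu> U)" by (auto simp: sym_def ae_rel_def)
    show "trans (ae_rel \<mu> U)" by (auto simp: trans_def ae_rel_def elim: eventually_elim2)
  qed
  have eq: "ae_rel \<mu> U `` {f} = ae_rel \<mu> U `` {g}"
    if "f \<in> U" "g \<in> U" "AE x in \<mu>. f x = g x" for f g
    using equiv_class_eq[OF eqv] that by (simp add: ae_rel_def)
  have self: "f \<in> ae_rel \<mu> U `` {f}" if "f \<in> U" for f using that by (simp add: ae_rel_def)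
  have mem: "g \<in> U \<and> (AE x in \<mu>. f x = g x)" if "g \<in> ae_rel \<mu> U `` {f}" for f g
    using that by (auto simp: ae_rel_def)
  show ?thesis
  proof
    fix f g :: "'b \<Rightarrow> 'y" and c :: real
    assume f: "f \<in> U"
    have "(\<Union>h\<in>ae_rel \<mu> U `` {f}. ae_rel \<mu> U `` {\<lambda>x. c *\<^sub>R h x}) = ae_rel \<mu> U `` {\<lambda>x. c *\<^sub>R f x}"
    proof (rule UN_eq_constI[OF self[OF f]])
      fix h assume "h \<in> ae_rel \<mu> U `` {f}"
      then have "h \<in> U" "AE x in \<mu>. f x = h x" using mem by blast+
      then show "ae_rel \<mu> U `` {\<lambda>x. c *\<^sub>R h x} = ae_rel \<mu> U `` {\<lambda>x. c *\<^sub>R f x}"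
        by (intro eq scale_mem f) auto
    qed
    then show "ns_scale (ae_classes \<mu> U N) c (ae_rel \<mu> U `` {f}) = ae_rel \<mu> U `` {\<lambda>x. c *\<^sub>R f x}"
      by (simp add: ae_classes_def)
    have "(SOME h. h \<in> ae_rel \<mu> U `` {f}) \<in> ae_rel \<mu> U `` {f}"
      by (rule someI[where P = "\<lambda>h. h \<in> ae_rel \<mu> U `` {f}", OF self[OF f]])
    from mem[OF this] show "ns_norm (ae_classes \<mu> U N) (ae_rel \<mu> U `` {f}) = N f"
      using cong[OF f, symmetric] by (simp add: ae_classes_def)
    assume g: "g \<in> U"
    have "(\<Union>h\<in>ae_rel \<mu> U `` {f}. \<Union>k\<in>ae_rel \<mu> U `` {g}. ae_rel \<mu> U `` {\<lambda>x. h x + k x}) =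
        ae_rel \<mu> U `` {\<lambda>x. f x + g x}"
    proof (intro UN_eq_constI[OF self[OF f]] UN_eq_constI[OF self[OF g]])
      fix h k assume "h \<in> ae_rel \<mu> U `` {f}" "k \<in> ae_rel \<mu> U `` {g}"
      then have "h \<in> U" "k \<in> U" "AE x in \<mu>. f x = h x" "AE x in \<mu>. g x = k x" using mem by blast+
      then show "ae_rel \<mu> U `` {\<lambda>x. h x + k x} = ae_rel \<mu> U `` {\<lambda>x. f x + g x}"
        by (intro eq add_mem f g) auto
    qed
    then show "ns_add (ae_classes \<mu> U N) (ae_rel \<mu> U `` {f}) (ae_rel \<mu> U `` {g}) =
        ae_rel \<mu> U `` {\<lambda>x. f x + g x}"
      by (simp add: ae_classes_def)
    assume "N (\<lambda>x. f x - g x) = 0"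
    from null[OF diff_mem[OF f g] this] show "ae_rel \<mu> U `` {f} = ae_rel \<mu> U `` {g}"
      by (intro eq f g) auto
  qed (auto simp: ae_classes_def quotient_def)
qed

section \<open>The spaces of p-integrable and of essentially bounded functions\<close>

abbreviation Lp_int :: "real \<Rightarrow> 'b measure \<Rightarrow> ('b \<Rightarrow> 'y::real_normed_vector) \<Rightarrow> ennreal" where
  "Lp_int p \<mu> f \<equiv> \<integral>\<^sup>+x. ennreal (norm (f x) powr p) \<partial>\<mu>"

abbreviation on_set :: "'b set \<Rightarrow> ('b \<Rightarrow> 'y::real_vector) \<Rightarrow> 'b \<Rightarrow> 'y" where
  "on_set A f \<equiv> \<lambda>x. indicator A x *\<^sub>R f x"

definition Lp_fun :: "real \<Rightarrow> 'b measure \<Rightarrow> ('b \<Rightarrow> 'y::real_normed_vector) set" where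
  "Lp_fun p \<mu> = {f. strongly_measurable \<mu> f \<and> (Lp_int p \<mu> f) < \<infinity>}"

definition Lp_norm :: "real \<Rightarrow> 'b measure \<Rightarrow> ('b \<Rightarrow> 'y::real_normed_vector) \<Rightarrow> real" where
  "Lp_norm p \<mu> f = enn2real (Lp_int p \<mu> f) powr (1 / p)"

text \<open>Convexity of s^p for the points u/a and v/b with weights a/(a+b) and b/(a+b). When the
  weights are the two norms, integrating this yields Minkowski's inequality.\<close>

lemma powr_add_le_weighted:
  fixes a b u v p :: real
  assumes "1 \<le> p" "0 < a" "0 < b" "0 \<le> u" "0 \<le> v"
  shows "(u + v) powr p \<le> (a + b) powr (p - 1) * (a powr (1 - p) * u powr p + b powr (1 - p) * v powr p)"
proof -
  define \<theta> where "\<theta> = a / (a + b)"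
  define w where "w = (u + v) / (a + b)"
  have "\<theta> * (u / a) = u / (a + b)" "(1 - \<theta>) * (v / b) = v / (a + b)"
    using assms by (auto simp: \<theta>_def field_simps)
  then have w: "w = \<theta> * (u / a) + (1 - \<theta>) * (v / b)" and w0: "0 \<le> w"
    using assms by (simp_all add: w_def add_divide_distrib)
  have \<theta>: "0 \<le> \<theta>" "0 \<le> 1 - \<theta>" using assms by (auto simp: \<theta>_def field_simps)
  have pw: "w powr (p - 1) * w = w powr p"
    using w0 powr_mult_base[of w "p - 1"] by (cases "w = 0") (auto simp: mult.commute)
  \<comment> \<open>Averaging the tangent at the mean \<open>w\<close> over the two points returns
    \<open>w powr p\<close>, which is how Jensen's inequality arises here.\<close>
  have tangent: "p * (w powr (p - 1) * s) - (p - 1) * w powr p \<le> s powr p" if "0 \<le> s" for s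
    using powr_minus_one_mult_le[of p w s] assms(1) w0 that by (simp add: field_simps)
  have "w powr p = \<theta> * (p * (w powr (p - 1) * (u / a)) - (p - 1) * w powr p) +
      (1 - \<theta>) * (p * (w powr (p - 1) * (v / b)) - (p - 1) * w powr p)"
  proof -
    have "\<theta> * (p * (w powr (p - 1) * (u / a)) - (p - 1) * w powr p) +
      (1 - \<theta>) * (p * (w powr (p - 1) * (v / b)) - (p - 1) * w powr p) =
      p * (w powr (p - 1) * (\<theta> * (u / a) + (1 - \<theta>) * (v / b))) - (p - 1) * w powr p"
      by (simp add: algebra_simps)
    also have "\<dots> = w powr p" unfolding w[symmetric] pw by (simp add: algebra_simps)
    finally show ?thesis by simp
  qed
  also have "\<dots> \<le> \<theta> * (u / a) powr p + (1 - \<theta>) * (v / b) powr p"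
    using \<theta> assms by (intro add_mono mult_left_mono tangent) auto
  finally have *: "w powr p \<le> \<theta> * (u / a) powr p + (1 - \<theta>) * (v / b) powr p" .
  have "(u + v) powr p = (a + b) powr p * w powr p"
    using assms w0 by (simp add: w_def flip: powr_mult)
  also have "\<dots> \<le> (a + b) powr p * (\<theta> * (u / a) powr p + (1 - \<theta>) * (v / b) powr p)"
    using * by (intro mult_left_mono) auto
  also have "(a + b) powr p = (a + b) powr (p - 1) * (a + b)"
    using powr_mult_base[of "a + b" "p - 1"] assms by (simp add: mult.commute)
  also have "(a + b) powr (p - 1) * (a + b) * (\<theta> * (u / a) powr p + (1 - \<theta>) * (v / b) powr p) =
      (a + b) powr (p - 1) * (a * (u / a) powr p + b * (v / b) powr p)"
  proof -
    have "(a + b) * \<theta> = a" "(a + b) * (1 - \<theta>) = b" using assms by (auto simp: \<theta>_def field_simps)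
    then have "a * (u / a) powr p + b * (v / b) powr p =
        (a + b) * (\<theta> * (u / a) powr p + (1 - \<theta>) * (v / b) powr p)"
      unfolding distrib_left[of "a + b" "\<theta> * _"] mult.assoc[symmetric] by simp
    then show ?thesis by (simp only: mult.assoc)
  qed
  also have "a * (u / a) powr p = a powr (1 - p) * u powr p"
    using assms by (simp add: powr_divide powr_diff)
  also have "b * (v / b) powr p = b powr (1 - p) * v powr p"
    using assms by (simp add: powr_divide powr_diff)
  finally show ?thesis .
qed

text \<open>The pointwise weighted inequality is integrated with the norms of \<open>u\<close> and
  \<open>v\<close> as weights. These may vanish, so both are enlarged by \<eta>, which accounts for
  the term \<open>2 * \<eta>\<close> and is sent to 0 at the end.\<close>

lemma nn_integral_Minkowski:
  fixes u v :: "'b \<Rightarrow> real"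
  assumes p: "1 \<le> p" and [measurable]: "u \<in> borel_measurable \<mu>" "v \<in> borel_measurable \<mu>"
    and u: "\<And>x. 0 \<le> u x" and v: "\<And>x. 0 \<le> v x"
    and fin: "(\<integral>\<^sup>+x. ennreal (u x powr p) \<partial>\<mu>) < \<infinity>" "(\<integral>\<^sup>+x. ennreal (v x powr p) \<partial>\<mu>) < \<infinity>"
  shows "(\<integral>\<^sup>+x. ennreal ((u x + v x) powr p) \<partial>\<mu>) < \<infinity>"
    and "enn2real (\<integral>\<^sup>+x. ennreal ((u x + v x) powr p) \<partial>\<mu>) powr (1 / p) \<le>
      enn2real (\<integral>\<^sup>+x. ennreal (u x powr p) \<partial>\<mu>) powr (1 / p) +
      enn2real (\<integral>\<^sup>+x. ennreal (v x powr p) \<partial>\<mu>) powr (1 / p)"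
proof -
  obtain A where A: "0 \<le> A" "(\<integral>\<^sup>+x. ennreal (u x powr p) \<partial>\<mu>) = ennreal A"
    using fin(1) by (cases "\<integral>\<^sup>+x. ennreal (u x powr p) \<partial>\<mu>") auto
  obtain B where B: "0 \<le> B" "(\<integral>\<^sup>+x. ennreal (v x powr p) \<partial>\<mu>) = ennreal B"
    using fin(2) by (cases "\<integral>\<^sup>+x. ennreal (v x powr p) \<partial>\<mu>") auto
  let ?I = "\<integral>\<^sup>+x. ennreal ((u x + v x) powr p) \<partial>\<mu>"
  have le: "?I \<le> ennreal ((A powr (1 / p) + B powr (1 / p) + 2 * \<eta>) powr p)" if \<eta>: "0 < \<eta>" for \<eta>
  proof -
    define a where "a = A powr (1 / p) + \<eta>"
    define b where "b = B powr (1 / p) + \<eta>"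
    have ab: "0 < a" "0 < b" using \<eta> by (auto simp: a_def b_def add_nonneg_pos)
    have "A = (A powr (1 / p)) powr p" using A(1) p by (simp add: powr_powr)
    also have "\<dots> \<le> a powr p" unfolding a_def using \<eta> p by (intro powr_mono2) auto
    finally have Aa: "a powr (1 - p) * A \<le> a powr (1 - p) * a powr p" by (intro mult_left_mono) auto
    have "B = (B powr (1 / p)) powr p" using B(1) p by (simp add: powr_powr)
    also have "\<dots> \<le> b powr p" unfolding b_def using \<eta> p by (intro powr_mono2) auto
    finally have Bb: "b powr (1 - p) * B \<le> b powr (1 - p) * b powr p" by (intro mult_left_mono) auto
    define C where "C = (a + b) powr (p - 1)"
    have "?I \<le> (\<integral>\<^sup>+x. ennreal (C * a powr (1 - p)) * ennreal (u x powr p) +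
        ennreal (C * b powr (1 - p)) * ennreal (v x powr p) \<partial>\<mu>)"
      using powr_add_le_weighted[OF p ab u v]
      by (intro nn_integral_mono) (simp add: C_def distrib_left mult.assoc flip: ennreal_mult ennreal_plus)
    also have "\<dots> = ennreal (C * a powr (1 - p)) * ennreal A + ennreal (C * b powr (1 - p)) * ennreal B"
      by (simp add: nn_integral_add nn_integral_cmult A B)
    also have "\<dots> = ennreal (C * (a powr (1 - p) * A + b powr (1 - p) * B))"
      using A(1) B(1) by (simp add: C_def distrib_left mult.assoc flip: ennreal_mult ennreal_plus)
    also have "\<dots> \<le> ennreal (C * (a + b))"
    proof (rule ennreal_leI, rule mult_left_mono)
      have "a powr (1 - p) * a powr p = a" "b powr (1 - p) * b powr p = b"
        using ab by (simp_all flip: powr_add)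
      then show "a powr (1 - p) * A + b powr (1 - p) * B \<le> a + b" using Aa Bb by linarith
    qed (simp add: C_def)
    also have "C * (a + b) = (a + b) powr p"
      using powr_mult_base[of "a + b" "p - 1"] ab by (simp add: C_def mult.commute)
    also have "a + b = A powr (1 / p) + B powr (1 / p) + 2 * \<eta>" by (simp add: a_def b_def)
    finally show ?thesis .
  qed
  show fin': "?I < \<infinity>" using le[of 1] by (rule le_less_trans) auto
  then obtain I where I: "0 \<le> I" "?I = ennreal I" by (cases ?I) auto
  have "I powr (1 / p) \<le> A powr (1 / p) + B powr (1 / p)"
  proof (rule field_le_epsilon)
    fix \<epsilon> :: real assume "0 < \<epsilon>"
    then have "I \<le> (A powr (1 / p) + B powr (1 / p) + \<epsilon>) powr p"
      using le[of "\<epsilon> / 2"] I by (simp add: ennreal_le_iff)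
    then have "I powr (1 / p) \<le> ((A powr (1 / p) + B powr (1 / p) + \<epsilon>) powr p) powr (1 / p)"
      using I(1) p by (intro powr_mono2) auto
    also have "\<dots> = A powr (1 / p) + B powr (1 / p) + \<epsilon>"
      using p \<open>0 < \<epsilon>\<close> by (simp add: powr_powr add_nonneg_pos)
    finally show "I powr (1 / p) \<le> A powr (1 / p) + B powr (1 / p) + \<epsilon>" .
  qed
  then show "enn2real ?I powr (1 / p) \<le> enn2real (\<integral>\<^sup>+x. ennreal (u x powr p) \<partial>\<mu>) powr (1 / p) +
      enn2real (\<integral>\<^sup>+x. ennreal (v x powr p) \<partial>\<mu>) powr (1 / p)"
    using I A B by simp
qed

lemma Lp_norm_mono:
  assumes "1 \<le> p" "f \<in> Lp_fun p \<mu>" "AE x in \<mu>. norm (g x) \<le> norm (f x)"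
  shows "Lp_norm p \<mu> g \<le> Lp_norm p \<mu> f"
  unfolding Lp_norm_def using assms
  by (intro powr_mono2 enn2real_mono nn_integral_mono_AE)
    (auto simp: Lp_fun_def elim!: eventually_mono intro!: ennreal_leI powr_mono2)

lemma Lp_fun_mono:
  assumes "1 \<le> p" "f \<in> Lp_fun p \<mu>" "strongly_measurable \<mu> g" "AE x in \<mu>. norm (g x) \<le> norm (f x)"
  shows "g \<in> Lp_fun p \<mu>"
proof -
  have "(Lp_int p \<mu> g) \<le> (Lp_int p \<mu> f)"
    using assms by (intro nn_integral_mono_AE) (auto elim!: eventually_mono intro!: ennreal_leI powr_mono2)
  then show ?thesis using assms by (auto simp: Lp_fun_def)
qed

lemma fun_space_Lp:
  assumes p: "1 \<le> p"
  shows "fun_space (Lp_fun p \<mu> :: ('b \<Rightarrow> 'y::real_normed_vector) set) (Lp_norm p \<mu>)"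
proof (rule fun_spaceI)
  fix f g :: "'b \<Rightarrow> 'y" and c :: real
  show "(\<lambda>x. 0) \<in> (Lp_fun p \<mu> :: ('b \<Rightarrow> 'y) set)" by (simp add: Lp_fun_def strongly_measurable_const)
  assume f: "f \<in> Lp_fun p \<mu>"
  then have fm [measurable]: "(\<lambda>x. norm (f x)) \<in> borel_measurable \<mu>"
    by (simp add: Lp_fun_def borel_measurable_norm_strongly)
  have eq: "(\<integral>\<^sup>+x. ennreal (norm (c *\<^sub>R f x) powr p) \<partial>\<mu>) =
      ennreal (\<bar>c\<bar> powr p) * (Lp_int p \<mu> f)"
    by (subst nn_integral_cmult[symmetric]) (auto simp: powr_mult ennreal_mult)
  show "(\<lambda>x. c *\<^sub>R f x) \<in> Lp_fun p \<mu>"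
    using f eq by (auto simp: Lp_fun_def ennreal_mult_less_top strongly_measurable_scaleR)
  have "Lp_norm p \<mu> (\<lambda>x. c *\<^sub>R f x) = (\<bar>c\<bar> powr p) powr (1 / p) * Lp_norm p \<mu> f"
    unfolding Lp_norm_def eq by (simp add: enn2real_mult powr_mult)
  then show "Lp_norm p \<mu> (\<lambda>x. c *\<^sub>R f x) \<le> \<bar>c\<bar> * Lp_norm p \<mu> f"
    using p by (simp add: powr_powr)
  show "0 \<le> Lp_norm p \<mu> f" by (simp add: Lp_norm_def)
  assume g: "g \<in> Lp_fun p \<mu>"
  then have gm [measurable]: "(\<lambda>x. norm (g x)) \<in> borel_measurable \<mu>"
    by (simp add: Lp_fun_def borel_measurable_norm_strongly)
  note M = nn_integral_Minkowski[OF p fm gm norm_ge_zero norm_ge_zero]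
  have le: "(\<integral>\<^sup>+x. ennreal (norm (f x + g x) powr p) \<partial>\<mu>) \<le>
      (\<integral>\<^sup>+x. ennreal ((norm (f x) + norm (g x)) powr p) \<partial>\<mu>)"
    using p by (intro nn_integral_mono ennreal_leI powr_mono2 norm_triangle_ineq) auto
  show "(\<lambda>x. f x + g x) \<in> Lp_fun p \<mu>"
    using f g M(1) le by (auto simp: Lp_fun_def strongly_measurable_add)
  have "Lp_norm p \<mu> (\<lambda>x. f x + g x) \<le>
      enn2real (\<integral>\<^sup>+x. ennreal ((norm (f x) + norm (g x)) powr p) \<partial>\<mu>) powr (1 / p)"
    unfolding Lp_norm_def using p le M(1) f g by (intro powr_mono2 enn2real_mono) (auto simp: Lp_fun_def)
  also have "\<dots> \<le> Lp_norm p \<mu> f + Lp_norm p \<mu> g"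
    unfolding Lp_norm_def using M(2) f g by (simp add: Lp_fun_def)
  finally show "Lp_norm p \<mu> (\<lambda>x. f x + g x) \<le> Lp_norm p \<mu> f + Lp_norm p \<mu> g" .
qed

lemma Lp_norm_cong_AE:
  assumes "AE x in \<mu>. f x = g x" shows "Lp_norm p \<mu> f = Lp_norm p \<mu> g"
  unfolding Lp_norm_def using assms
  by (intro arg_cong2[of _ _ _ _ "(powr)"] arg_cong[of _ _ enn2real] nn_integral_cong_AE) auto

lemma fun_space_repr_Lp:
  assumes p: "1 \<le> p"
  shows "fun_space_repr (Lp_fun p \<mu>) (Lp_norm p \<mu>) (Lp_space p \<mu> :: ('b \<Rightarrow> 'y::real_normed_vector) set normed_sp)
    (\<lambda>f. ae_rel \<mu> (Lp_fun p \<mu>) `` {f})"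
proof -
  have repr: "Lp_space p \<mu> = ae_classes \<mu> (Lp_fun p \<mu>) (Lp_norm p \<mu> :: ('b \<Rightarrow> 'y) \<Rightarrow> real)"
    by (simp add: Lp_space_def Lp_fun_def Lp_norm_def[abs_def])
  have null: "AE x in \<mu>. f x = 0" if f: "f \<in> Lp_fun p \<mu>" and 0: "Lp_norm p \<mu> f = 0" for f :: "'b \<Rightarrow> 'y"
  proof -
    have [measurable]: "(\<lambda>x. norm (f x)) \<in> borel_measurable \<mu>"
      using f by (simp add: Lp_fun_def borel_measurable_norm_strongly)
    have "(Lp_int p \<mu> f) = 0"
      using 0 f by (auto simp: Lp_norm_def Lp_fun_def enn2real_eq_0_iff)
    then have "AE x in \<mu>. ennreal (norm (f x) powr p) = 0"
      by (subst (asm) nn_integral_0_iff_AE) auto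
    then show ?thesis by eventually_elim (simp add: ennreal_eq_0_iff)
  qed
  show ?thesis
    unfolding repr by (rule fun_space_repr_ae[OF fun_space_Lp[OF p]]) (auto intro: Lp_norm_cong_AE null)
qed

section \<open>Sequence spaces as L_p spaces of counting measure\<close>

lemma nn_integral_count_space_powr:
  "(\<integral>\<^sup>+k. ennreal (norm (w k) powr p) \<partial>count_space UNIV) < \<infinity> \<longleftrightarrow> summable (\<lambda>k::nat. norm (w k) powr p)"
  "summable (\<lambda>k::nat. norm (w k) powr p) \<Longrightarrow>
    (\<integral>\<^sup>+k. ennreal (norm (w k) powr p) \<partial>count_space UNIV) = ennreal (\<Sum>k. norm (w k) powr p)"
  unfolding nn_integral_count_space_nat
  by (auto simp: suminf_ennreal2 less_top intro: summable_suminf_not_top)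

text \<open>The truncations of a sequence take finitely many values and are eventually constant at
  each index.\<close>

lemma strongly_measurable_count_space_nat:
  fixes w :: "nat \<Rightarrow> 'y::real_normed_vector"
  shows "strongly_measurable (count_space UNIV) w"
  unfolding strongly_measurable_def
proof (intro exI[of _ "\<lambda>i. seq_head i w"] conjI allI ballI)
  fix i :: nat
  have "range (seq_head i w) \<subseteq> insert 0 (w ` {..<i})" by (auto simp: seq_head_def)
  then have "finite (range (seq_head i w))" by (rule finite_subset) simp
  then show "simple_function (count_space UNIV) (seq_head i w)"
    by (simp add: simple_function_def)
next
  fix k :: nat
  have "\<forall>\<^sub>F i in sequentially. seq_head i w k = w k"
    using eventually_gt_at_top[of k] by eventually_elim (simp add: seq_head_def)
  then show "(\<lambda>i. seq_head i w k) \<longlonglongrightarrow> w k" by (rule tendsto_eventually)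
qed

text \<open>Reading sequences as functions for counting measure makes Minkowski's inequality and
  monotonicity available for them without a second proof.\<close>

abbreviation lp_fun :: "real \<Rightarrow> (nat \<Rightarrow> 'y::real_normed_vector) set" where
  "lp_fun p \<equiv> Lp_fun p (count_space UNIV)"

abbreviation lp_norm :: "real \<Rightarrow> (nat \<Rightarrow> 'y::real_normed_vector) \<Rightarrow> real" where
  "lp_norm p \<equiv> Lp_norm p (count_space UNIV)"

lemma lp_fun_iff: "w \<in> lp_fun p \<longleftrightarrow> summable (\<lambda>k. norm (w k) powr p)"
  by (simp add: Lp_fun_def strongly_measurable_count_space_nat nn_integral_count_space_powr(1)[simplified])

lemma lp_norm_eq: "w \<in> lp_fun p \<Longrightarrow> lp_norm p w = (\<Sum>k. norm (w k) powr p) powr (1 / p)"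
  unfolding lp_fun_iff Lp_norm_def by (simp add: nn_integral_count_space_powr(2) suminf_nonneg)

lemma lp_norm_powr:
  assumes "1 \<le> p" "w \<in> lp_fun p"
  shows "lp_norm p w powr p = (\<Sum>k. norm (w k) powr p)"
  using assms suminf_nonneg[of "\<lambda>k. norm (w k) powr p"] by (simp add: lp_norm_eq powr_powr lp_fun_iff)

lemma fun_space_repr_lp:
  assumes p: "1 \<le> p"
  shows "fun_space_repr (lp_fun p) (lp_norm p) (lp_space p :: (nat \<Rightarrow> 'y::real_normed_vector) normed_sp) (\<lambda>w. w)"
proof -
  interpret fun_space "lp_fun p :: (nat \<Rightarrow> 'y) set" "lp_norm p" by (rule fun_space_Lp[OF p])
  show ?thesis
  proof
    fix v w :: "nat \<Rightarrow> 'y"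
    assume vw: "v \<in> lp_fun p" "w \<in> lp_fun p" and 0: "lp_norm p (\<lambda>k. v k - w k) = 0"
    have "(\<Sum>k. norm (v k - w k) powr p) = 0"
      using lp_norm_powr[OF p diff_mem[OF vw]] 0 by simp
    then have "\<forall>k. norm (v k - w k) powr p = 0"
      using diff_mem[OF vw] by (subst (asm) suminf_eq_zero_iff) (auto simp: lp_fun_iff)
    then show "v = w" by auto
  qed (auto simp: lp_space_def lp_fun_iff lp_norm_eq)
qed

lemma lp_head_tail:
  assumes p: "1 \<le> p" and w: "w \<in> lp_fun p"
  shows "seq_head n w \<in> lp_fun p" "seq_tail n w \<in> lp_fun p"
    "lp_norm p w powr p = lp_norm p (seq_head n w) powr p + lp_norm p (seq_tail n w) powr p"
proof -
  show h: "seq_head n w \<in> lp_fun p"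
    by (rule Lp_fun_mono[OF p w strongly_measurable_count_space_nat]) (auto simp: seq_head_def)
  show t: "seq_tail n w \<in> lp_fun p"
    by (rule Lp_fun_mono[OF p w strongly_measurable_count_space_nat]) (auto simp: seq_tail_def)
  have "(\<Sum>k. norm (w k) powr p) = (\<Sum>k. norm (seq_head n w k) powr p + norm (seq_tail n w k) powr p)"
    by (intro arg_cong[of _ _ suminf]) (auto simp: seq_head_def seq_tail_def)
  also have "\<dots> = (\<Sum>k. norm (seq_head n w k) powr p) + (\<Sum>k. norm (seq_tail n w k) powr p)"
    using h t by (intro suminf_add[symmetric]) (auto simp: lp_fun_iff)
  finally show "lp_norm p w powr p = lp_norm p (seq_head n w) powr p + lp_norm p (seq_tail n w) powr p"
    by (simp add: lp_norm_powr[OF p] w h t)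
qed

section \<open>Essentially bounded functions\<close>

definition Linf_fun :: "'b measure \<Rightarrow> ('b \<Rightarrow> 'y::real_normed_vector) set" where
  "Linf_fun \<mu> = {f. strongly_measurable \<mu> f \<and> esssup \<mu> (\<lambda>x. ennreal (norm (f x))) < \<infinity>}"

definition Linf_norm :: "'b measure \<Rightarrow> ('b \<Rightarrow> 'y::real_normed_vector) \<Rightarrow> real" where
  "Linf_norm \<mu> f = enn2real (esssup \<mu> (\<lambda>x. ennreal (norm (f x))))"

lemma Linf_norm_nonneg: "0 \<le> Linf_norm \<mu> f"
  by (simp add: Linf_norm_def)

lemma AE_le_Linf_norm:
  assumes "f \<in> Linf_fun \<mu>" shows "AE x in \<mu>. norm (f x) \<le> Linf_norm \<mu> f"
proof -
  have "esssup \<mu> (\<lambda>x. ennreal (norm (f x))) = ennreal (Linf_norm \<mu> f)"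
    using assms by (simp add: Linf_fun_def Linf_norm_def)
  then show ?thesis
    using esssup_AE[of "\<lambda>x. ennreal (norm (f x))" \<mu>] by (simp add: ennreal_le_iff Linf_norm_nonneg)
qed

lemma Linf_leI:
  assumes "strongly_measurable \<mu> f" "0 \<le> c" "AE x in \<mu>. norm (f x) \<le> c"
  shows "f \<in> Linf_fun \<mu>" "Linf_norm \<mu> f \<le> c"
proof -
  have [measurable]: "(\<lambda>x. norm (f x)) \<in> borel_measurable \<mu>"
    using assms by (simp add: borel_measurable_norm_strongly)
  have le: "esssup \<mu> (\<lambda>x. ennreal (norm (f x))) \<le> ennreal c"
    using assms by (intro esssup_I) (auto elim!: eventually_mono intro: ennreal_leI)
  then show "f \<in> Linf_fun \<mu>" using assms(1) by (auto simp: Linf_fun_def intro: le_less_trans)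
  show "Linf_norm \<mu> f \<le> c" using enn2real_mono[OF le] assms(2) by (simp add: Linf_norm_def)
qed

lemma fun_space_Linf: "fun_space (Linf_fun \<mu> :: ('b \<Rightarrow> 'y::real_normed_vector) set) (Linf_norm \<mu>)"
proof (rule fun_spaceI)
  fix f g :: "'b \<Rightarrow> 'y" and c :: real
  show "(\<lambda>x. 0) \<in> (Linf_fun \<mu> :: ('b \<Rightarrow> 'y) set)"
    by (rule Linf_leI[of _ _ 0]) (auto simp: strongly_measurable_const)
  assume f: "f \<in> Linf_fun \<mu>"
  have "AE x in \<mu>. norm (c *\<^sub>R f x) \<le> \<bar>c\<bar> * Linf_norm \<mu> f"
    using AE_le_Linf_norm[OF f] by eventually_elim (simp add: mult_left_mono)
  moreover have "strongly_measurable \<mu> (\<lambda>x. c *\<^sub>R f x)"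
    using f by (simp add: Linf_fun_def strongly_measurable_scaleR)
  ultimately show "(\<lambda>x. c *\<^sub>R f x) \<in> Linf_fun \<mu>" "Linf_norm \<mu> (\<lambda>x. c *\<^sub>R f x) \<le> \<bar>c\<bar> * Linf_norm \<mu> f"
    using Linf_leI[of \<mu> "\<lambda>x. c *\<^sub>R f x" "\<bar>c\<bar> * Linf_norm \<mu> f"] by (simp_all add: Linf_norm_nonneg)
  show "0 \<le> Linf_norm \<mu> f" by (rule Linf_norm_nonneg)
  assume g: "g \<in> Linf_fun \<mu>"
  have "AE x in \<mu>. norm (f x + g x) \<le> Linf_norm \<mu> f + Linf_norm \<mu> g"
    using AE_le_Linf_norm[OF f] AE_le_Linf_norm[OF g]
    by eventually_elim (auto intro: norm_triangle_le)
  moreover have "strongly_measurable \<mu> (\<lambda>x. f x + g x)"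
    using f g by (simp add: Linf_fun_def strongly_measurable_add)
  ultimately show "(\<lambda>x. f x + g x) \<in> Linf_fun \<mu>"
      "Linf_norm \<mu> (\<lambda>x. f x + g x) \<le> Linf_norm \<mu> f + Linf_norm \<mu> g"
    using Linf_leI[of \<mu> "\<lambda>x. f x + g x" "Linf_norm \<mu> f + Linf_norm \<mu> g"] by (simp_all add: Linf_norm_nonneg)
qed

lemma fun_space_repr_Linf:
  "fun_space_repr (Linf_fun \<mu>) (Linf_norm \<mu>) (Linf_space \<mu> :: ('b \<Rightarrow> 'y::real_normed_vector) set normed_sp)
    (\<lambda>f. ae_rel \<mu> (Linf_fun \<mu>) `` {f})"
proof -
  have repr: "Linf_space \<mu> = ae_classes \<mu> (Linf_fun \<mu>) (Linf_norm \<mu> :: ('b \<Rightarrow> 'y) \<Rightarrow> real)"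
    by (simp add: Linf_space_def Linf_fun_def Linf_norm_def[abs_def])
  have null: "AE x in \<mu>. f x = 0" if "f \<in> Linf_fun \<mu>" "Linf_norm \<mu> f = 0" for f :: "'b \<Rightarrow> 'y"
    using AE_le_Linf_norm[OF that(1)] that(2) by simp
  have "Linf_norm \<mu> f \<le> Linf_norm \<mu> g"
    if f: "f \<in> Linf_fun \<mu>" and g: "g \<in> Linf_fun \<mu>" and eq: "AE x in \<mu>. f x = g x" for f g :: "'b \<Rightarrow> 'y"
  proof (rule Linf_leI(2))
    show "AE x in \<mu>. norm (f x) \<le> Linf_norm \<mu> g"
      using AE_le_Linf_norm[OF g] eq by eventually_elim simp
  qed (use f in \<open>auto simp: Linf_norm_nonneg Linf_fun_def\<close>)
  then have cong: "Linf_norm \<mu> f = Linf_norm \<mu> g"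
    if "f \<in> Linf_fun \<mu>" "g \<in> Linf_fun \<mu>" "AE x in \<mu>. f x = g x" for f g :: "'b \<Rightarrow> 'y"
    using that by (intro antisym) (auto simp: eq_commute)
  show ?thesis
    unfolding repr by (rule fun_space_repr_ae[OF fun_space_Linf]) (auto intro: cong null)
qed

section \<open>Integration in a Banach space\<close>

text \<open>An approximant is kept only where its norm is at most twice that of \<open>f\<close> and
  is set to 0 elsewhere. Where \<open>f\<close> is nonzero the factor 2 leaves room, so eventually
  nothing is cut; where \<open>f\<close> vanishes the cut approximants vanish too.\<close>

lemma strongly_measurable_dominated_approx:
  fixes f :: "'b \<Rightarrow> 'y::real_normed_vector"
  assumes "strongly_measurable \<mu> f"
  shows "\<exists>t. (\<forall>i::nat. simple_function \<mu> (t i)) \<and> (\<forall>x\<in>space \<mu>. (\<lambda>i. t i x) \<longlonglongrightarrow> f x) \<and>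
    (\<forall>i. \<forall>x. norm (t i x) \<le> 2 * norm (f x))"
proof -
  obtain s where s: "\<And>i. simple_function \<mu> (s i)" "\<And>x. x \<in> space \<mu> \<Longrightarrow> (\<lambda>i. s i x) \<longlonglongrightarrow> f x"
    using assms unfolding strongly_measurable_def by blast
  have [measurable]: "(\<lambda>x. norm (f x)) \<in> borel_measurable \<mu>"
    by (rule borel_measurable_norm_strongly[OF assms])
  have [measurable]: "(\<lambda>x. norm (s i x)) \<in> borel_measurable \<mu>" for i
    by (rule borel_measurable_norm_strongly[OF strongly_measurableI_simple[OF s(1)]])
  define A where "A = (\<lambda>i. {x \<in> space \<mu>. norm (s i x) \<le> 2 * norm (f x)})"
  have A: "A i \<in> sets \<mu>" for i unfolding A_def by measurable
  define t where "t = (\<lambda>i x. indicator (A i) x *\<^sub>R s i x)"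
  have "simple_function \<mu> (t i)" for i
    unfolding t_def by (rule simple_function_compose2[of _ _ _ "(*\<^sub>R)"]) (auto intro: s(1) A)
  moreover have "(\<lambda>i. t i x) \<longlonglongrightarrow> f x" if x: "x \<in> space \<mu>" for x
  proof (cases "f x = 0")
    case True
    then have "t i x = 0" for i by (auto simp: t_def A_def indicator_def)
    then show ?thesis using True by simp
  next
    case False
    have "\<forall>\<^sub>F i in sequentially. norm (s i x) < 2 * norm (f x)"
      by (rule order_tendstoD(2)[OF tendsto_norm[OF s(2)[OF x]]]) (use False in simp)
    then have "\<forall>\<^sub>F i in sequentially. s i x = t i x"
      by eventually_elim (use x in \<open>simp add: t_def A_def\<close>)
    then show ?thesis by (rule Lim_transform_eventually[OF s(2)[OF x]])
  qed
  moreover have "norm (t i x) \<le> 2 * norm (f x)" for i x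
    by (auto simp: t_def A_def indicator_def)
  ultimately show ?thesis by blast
qed

text \<open>Dominated convergence: the approximants are bounded by twice the norm of
  \<open>f\<close>, hence the differences by three times that norm.\<close>

lemma Lp_simple_approx:
  fixes f :: "'b \<Rightarrow> 'y::real_normed_vector"
  assumes p: "1 \<le> p" and f: "f \<in> Lp_fun p \<mu>"
  shows "\<exists>t. (\<forall>i. simple_function \<mu> (t i) \<and> t i \<in> Lp_fun p \<mu>) \<and>
    (\<lambda>i. Lp_norm p \<mu> (\<lambda>x. f x - t i x)) \<longlonglongrightarrow> 0"
proof -
  interpret fun_space "Lp_fun p \<mu> :: ('b \<Rightarrow> 'y) set" "Lp_norm p \<mu>" by (rule fun_space_Lp[OF p])
  have fs: "strongly_measurable \<mu> f" using f by (simp add: Lp_fun_def)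
  have [measurable]: "(\<lambda>x. norm (f x)) \<in> borel_measurable \<mu>"
    by (rule borel_measurable_norm_strongly[OF fs])
  obtain t where t: "\<And>i. simple_function \<mu> (t i)" "\<And>x. x \<in> space \<mu> \<Longrightarrow> (\<lambda>i. t i x) \<longlonglongrightarrow> f x"
    "\<And>i x. norm (t i x) \<le> 2 * norm (f x)"
    using strongly_measurable_dominated_approx[OF fs] by blast
  have tm: "t i \<in> Lp_fun p \<mu>" for i
    by (rule Lp_fun_mono[OF p scale_mem[OF f, of 2] strongly_measurableI_simple[OF t(1)]]) (simp add: t(3))
  have fin: "(\<integral>\<^sup>+x. ennreal (norm (3 *\<^sub>R f x) powr p) \<partial>\<mu>) < \<infinity>"
    using scale_mem[OF f, of 3] by (simp add: Lp_fun_def)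
  have le: "norm (f x - t i x) powr p \<le> norm (3 *\<^sub>R f x) powr p" for i x
    using norm_triangle_ineq4[of "f x" "t i x"] t(3)[of i x] p by (intro powr_mono2) auto
  have lim: "(\<lambda>i. ennreal (norm (f x - t i x) powr p)) \<longlonglongrightarrow> 0" if x: "x \<in> space \<mu>" for x
  proof -
    have "(\<lambda>i. norm (f x - t i x)) \<longlonglongrightarrow> norm (f x - f x)"
      by (intro tendsto_norm tendsto_diff tendsto_const t(2) x)
    then have "(\<lambda>i. norm (f x - t i x) powr p) \<longlonglongrightarrow> 0 powr p"
      using p by (intro tendsto_powr') auto
    then have "(\<lambda>i. ennreal (norm (f x - t i x) powr p)) \<longlonglongrightarrow> ennreal 0"
      using p by (intro tendsto_ennrealI) simp
    then show ?thesis by simp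
  qed
  have "(\<lambda>i. \<integral>\<^sup>+x. ennreal (norm (f x - t i x) powr p) \<partial>\<mu>) \<longlonglongrightarrow> (\<integral>\<^sup>+x. 0 \<partial>\<mu>)"
  proof (rule nn_integral_dominated_convergence[where w = "\<lambda>x. ennreal (norm (3 *\<^sub>R f x) powr p)"])
    show "(\<lambda>x. ennreal (norm (f x - t i x) powr p)) \<in> borel_measurable \<mu>" for i
      using borel_measurable_norm_strongly[OF strongly_measurable_diff[OF fs strongly_measurableI_simple[OF t(1)]]]
      by measurable
    show "(\<lambda>x. ennreal (norm (3 *\<^sub>R f x) powr p)) \<in> borel_measurable \<mu>" by simp
  qed (use fin le lim in \<open>auto intro!: ennreal_leI\<close>)
  then have "(\<lambda>i. enn2real (\<integral>\<^sup>+x. ennreal (norm (f x - t i x) powr p) \<partial>\<mu>)) \<longlonglongrightarrow> enn2real 0"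
    by (intro tendsto_enn2real) auto
  then have "(\<lambda>i. Lp_norm p \<mu> (\<lambda>x. f x - t i x)) \<longlonglongrightarrow> 0 powr (1 / p)"
    unfolding Lp_norm_def using p by (intro tendsto_powr') auto
  then show ?thesis using t(1) tm by auto
qed

lemma L1_norm_eq: "ennreal (Lp_norm 1 \<mu> f) = (\<integral>\<^sup>+x. ennreal (norm (f x)) \<partial>\<mu>)"
  if "f \<in> Lp_fun 1 \<mu>"
  using that by (simp add: Lp_norm_def Lp_fun_def)

abbreviation simple_int :: "'b measure \<Rightarrow> ('b \<Rightarrow> 'y::real_vector) \<Rightarrow> 'y" where
  "simple_int \<equiv> Bochner_Integration.simple_bochner_integral"

abbreviation simple_integrable :: "'b measure \<Rightarrow> ('b \<Rightarrow> 'y::real_vector) \<Rightarrow> bool" where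
  "simple_integrable \<equiv> Bochner_Integration.simple_bochner_integrable"

lemma simple_bochner_integrable_L1:
  assumes "simple_function \<mu> s" "s \<in> Lp_fun 1 \<mu>"
  shows "simple_integrable \<mu> s"
  using assms by (intro simple_bochner_integrableI_bounded) (simp_all add: Lp_fun_def)

lemma norm_simple_bochner_integral_le:
  fixes s :: "'b \<Rightarrow> 'y::real_normed_vector"
  assumes "simple_function \<mu> s" "s \<in> Lp_fun 1 \<mu>"
  shows "norm (simple_int \<mu> s) \<le> Lp_norm 1 \<mu> s"
proof -
  have i: "simple_integrable \<mu> s" by (rule simple_bochner_integrable_L1[OF assms])
  then have "simple_integrable \<mu> (\<lambda>x. norm (s x))"
    by (auto intro: simple_bochner_integrable_compose2[where p="\<lambda>x y. norm x", OF _ i])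
  then have "ennreal (simple_int \<mu> (\<lambda>x. norm (s x))) = ennreal (Lp_norm 1 \<mu> s)"
    using L1_norm_eq[OF assms(2)] by (simp add: simple_bochner_integral_eq_nn_integral)
  then show ?thesis
    using simple_bochner_integral_norm_bound[OF i] by (simp add: Lp_norm_def)
qed

definition approximates :: "'b measure \<Rightarrow> (nat \<Rightarrow> 'b \<Rightarrow> 'y::real_normed_vector) \<Rightarrow> ('b \<Rightarrow> 'y) \<Rightarrow> bool" where
  "approximates \<mu> s f \<longleftrightarrow> (\<forall>i. simple_function \<mu> (s i) \<and> s i \<in> Lp_fun 1 \<mu>) \<and>
     (\<lambda>i. Lp_norm 1 \<mu> (\<lambda>x. f x - s i x)) \<longlonglongrightarrow> 0"

text \<open>
  The library's Bochner integral is restricted to second countable spaces. On strongly measurable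
  functions the same limit of simple integrals exists in every Banach space.
\<close>

definition strong_integral :: "'b measure \<Rightarrow> ('b \<Rightarrow> 'y::banach) \<Rightarrow> 'y" where
  "strong_integral \<mu> f =
     (SOME y. \<forall>s. approximates \<mu> s f \<longrightarrow> (\<lambda>i. simple_int \<mu> (s i)) \<longlonglongrightarrow> y)"

text \<open>The simple integrals of any two approximating sequences differ by at most the sum of
  their L_1 errors. For a sequence compared with itself this gives the Cauchy property, for two
  sequences a common limit, which justifies the choice in \<open>strong_integral\<close>.\<close>

lemma strong_integral_tendsto:
  fixes f :: "'b \<Rightarrow> 'y::banach"
  assumes f: "f \<in> Lp_fun 1 \<mu>" and s: "approximates \<mu> s f"
  shows "(\<lambda>i. simple_int \<mu> (s i)) \<longlonglongrightarrow> strong_integral \<mu> f"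
proof -
  interpret fun_space "Lp_fun 1 \<mu> :: ('b \<Rightarrow> 'y) set" "Lp_norm 1 \<mu>" by (rule fun_space_Lp) simp
  let ?I = "simple_int \<mu>"
  have le: "norm (?I (s i) - ?I (t j)) \<le>
      Lp_norm 1 \<mu> (\<lambda>x. f x - s i x) + Lp_norm 1 \<mu> (\<lambda>x. f x - t j x)"
    if st: "approximates \<mu> s f" "approximates \<mu> t f" for s t i j
  proof -
    have m: "simple_function \<mu> (s i)" "s i \<in> Lp_fun 1 \<mu>" "simple_function \<mu> (t j)" "t j \<in> Lp_fun 1 \<mu>"
      using st by (auto simp: approximates_def)
    have "?I (s i) - ?I (t j) = ?I (\<lambda>x. s i x - t j x)"
      by (rule simple_bochner_integral_diff[OF simple_bochner_integrable_L1[OF m(1,2)]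
            simple_bochner_integrable_L1[OF m(3,4)], symmetric])
    also have "norm \<dots> \<le> Lp_norm 1 \<mu> (\<lambda>x. s i x - t j x)"
      by (intro norm_simple_bochner_integral_le diff_mem simple_function_compose2[of _ _ _ "(-)"] m)
    also have "\<dots> \<le> Lp_norm 1 \<mu> (\<lambda>x. s i x - f x) + Lp_norm 1 \<mu> (\<lambda>x. f x - t j x)"
      by (rule N_diff_triangle[OF m(2) f m(4)])
    also have "Lp_norm 1 \<mu> (\<lambda>x. s i x - f x) = Lp_norm 1 \<mu> (\<lambda>x. f x - s i x)"
      by (rule N_minus_commute[OF m(2) f])
    finally show ?thesis .
  qed
  have "Cauchy (\<lambda>i. ?I (s i))"
  proof (rule metric_CauchyI)
    fix e :: real assume "0 < e"
    then have "\<forall>\<^sub>F i in sequentially. Lp_norm 1 \<mu> (\<lambda>x. f x - s i x) < e / 2"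
      using s by (intro order_tendstoD(2)) (auto simp: approximates_def)
    then obtain k where k: "\<And>i. i \<ge> k \<Longrightarrow> Lp_norm 1 \<mu> (\<lambda>x. f x - s i x) < e / 2"
      unfolding eventually_sequentially by blast
    have "dist (?I (s m)) (?I (s n)) < e" if "m \<ge> k" "n \<ge> k" for m n
      using le[OF s s, of m n] k[OF that(1)] k[OF that(2)] by (simp add: dist_norm)
    then show "\<exists>M. \<forall>m\<ge>M. \<forall>n\<ge>M. dist (?I (s m)) (?I (s n)) < e" by blast
  qed
  then obtain y where y: "(\<lambda>i. ?I (s i)) \<longlonglongrightarrow> y"
    using Cauchy_convergent convergent_def by blast
  have "\<forall>t. approximates \<mu> t f \<longrightarrow> (\<lambda>i. ?I (t i)) \<longlonglongrightarrow> y"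
  proof (intro allI impI)
    fix t assume t: "approximates \<mu> t f"
    have "(\<lambda>i. Lp_norm 1 \<mu> (\<lambda>x. f x - t i x) + Lp_norm 1 \<mu> (\<lambda>x. f x - s i x)) \<longlonglongrightarrow> 0"
      using s t by (intro tendsto_add_zero) (auto simp: approximates_def)
    then have "(\<lambda>i. norm (?I (t i) - ?I (s i))) \<longlonglongrightarrow> 0"
      by (rule LIMSEQ_0_sandwich) (use le[OF t s] in auto)
    then have "(\<lambda>i. ?I (t i) - ?I (s i)) \<longlonglongrightarrow> 0" by (rule tendsto_norm_zero_cancel)
    then have "(\<lambda>i. (?I (t i) - ?I (s i)) + ?I (s i)) \<longlonglongrightarrow> 0 + y" using y by (rule tendsto_add)
    then show "(\<lambda>i. ?I (t i)) \<longlonglongrightarrow> y" by simp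
  qed
  then have "\<forall>s. approximates \<mu> s f \<longrightarrow> (\<lambda>i. ?I (s i)) \<longlonglongrightarrow> strong_integral \<mu> f"
    unfolding strong_integral_def by (rule someI)
  then show ?thesis using s by blast
qed

lemma approximates_ex: "f \<in> Lp_fun 1 \<mu> \<Longrightarrow> \<exists>s. approximates \<mu> s f"
  using Lp_simple_approx[of 1 f \<mu>] by (simp add: approximates_def)

lemma norm_strong_integral_le:
  fixes f :: "'b \<Rightarrow> 'y::banach"
  assumes f: "f \<in> Lp_fun 1 \<mu>"
  shows "norm (strong_integral \<mu> f) \<le> Lp_norm 1 \<mu> f"
proof -
  interpret fun_space "Lp_fun 1 \<mu> :: ('b \<Rightarrow> 'y) set" "Lp_norm 1 \<mu>" by (rule fun_space_Lp) simp
  obtain s where s: "approximates \<mu> s f" using approximates_ex[OF f] by blast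
  have m: "simple_function \<mu> (s i)" "s i \<in> Lp_fun 1 \<mu>" for i using s by (auto simp: approximates_def)
  have "norm (simple_int \<mu> (s i)) \<le> Lp_norm 1 \<mu> f + Lp_norm 1 \<mu> (\<lambda>x. f x - s i x)" for i
    using norm_simple_bochner_integral_le[OF m, of i] N_le_add_diff[OF m(2) f, of i] N_minus_commute[OF m(2) f, of i]
    by linarith
  moreover have "(\<lambda>i. Lp_norm 1 \<mu> f + Lp_norm 1 \<mu> (\<lambda>x. f x - s i x)) \<longlonglongrightarrow> Lp_norm 1 \<mu> f + 0"
    using s by (intro tendsto_intros) (simp add: approximates_def)
  ultimately show ?thesis
    using tendsto_norm[OF strong_integral_tendsto[OF f s]]
    by (intro LIMSEQ_le[where X = "\<lambda>i. norm (simple_int \<mu> (s i))"]) auto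
qed

lemma strong_integral_scale_diff:
  fixes f g :: "'b \<Rightarrow> 'y::banach"
  assumes f: "f \<in> Lp_fun 1 \<mu>" and g: "g \<in> Lp_fun 1 \<mu>"
  shows "strong_integral \<mu> (\<lambda>x. c *\<^sub>R (f x - g x)) = c *\<^sub>R (strong_integral \<mu> f - strong_integral \<mu> g)"
proof -
  interpret fun_space "Lp_fun 1 \<mu> :: ('b \<Rightarrow> 'y) set" "Lp_norm 1 \<mu>" by (rule fun_space_Lp) simp
  obtain s t where s: "approximates \<mu> s f" and t: "approximates \<mu> t g"
    using approximates_ex[OF f] approximates_ex[OF g] by blast
  have m: "simple_function \<mu> (s i)" "s i \<in> Lp_fun 1 \<mu>" "simple_function \<mu> (t i)" "t i \<in> Lp_fun 1 \<mu>" for i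
    using s t by (auto simp: approximates_def)
  have "approximates \<mu> (\<lambda>i x. c *\<^sub>R (s i x - t i x)) (\<lambda>x. c *\<^sub>R (f x - g x))"
    unfolding approximates_def
  proof (intro conjI allI)
    show "simple_function \<mu> (\<lambda>x. c *\<^sub>R (s i x - t i x))" for i
      by (rule simple_function_compose2[of _ _ _ "\<lambda>a b. c *\<^sub>R (a - b)"]) (auto intro: m)
    show "(\<lambda>x. c *\<^sub>R (s i x - t i x)) \<in> Lp_fun 1 \<mu>" for i by (intro scale_mem diff_mem m)
    have lim: "(\<lambda>i. \<bar>c\<bar> * (Lp_norm 1 \<mu> (\<lambda>x. f x - s i x) + Lp_norm 1 \<mu> (\<lambda>x. g x - t i x))) \<longlonglongrightarrow> 0"
      using s t by (intro tendsto_mult_right_zero tendsto_add_zero) (auto simp: approximates_def)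
    have "Lp_norm 1 \<mu> (\<lambda>x. c *\<^sub>R (f x - g x) - c *\<^sub>R (s i x - t i x)) \<le>
        \<bar>c\<bar> * (Lp_norm 1 \<mu> (\<lambda>x. f x - s i x) + Lp_norm 1 \<mu> (\<lambda>x. g x - t i x))" for i
    proof -
      have eq: "(\<lambda>x. c *\<^sub>R (f x - g x) - c *\<^sub>R (s i x - t i x)) = (\<lambda>x. c *\<^sub>R ((f x - s i x) - (g x - t i x)))"
        by (simp add: algebra_simps)
      show ?thesis
        unfolding eq N_scale[OF diff_mem[OF diff_mem[OF f m(2)] diff_mem[OF g m(4)]]]
        by (intro mult_left_mono N_diff_le diff_mem f g m) simp
    qed
    then show "(\<lambda>i. Lp_norm 1 \<mu> (\<lambda>x. c *\<^sub>R (f x - g x) - c *\<^sub>R (s i x - t i x))) \<longlonglongrightarrow> 0"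
      by (rule LIMSEQ_0_sandwich[OF lim]) (simp add: Lp_norm_def)
  qed
  then have "(\<lambda>i. simple_int \<mu> (\<lambda>x. c *\<^sub>R (s i x - t i x))) \<longlonglongrightarrow>
      strong_integral \<mu> (\<lambda>x. c *\<^sub>R (f x - g x))"
    by (rule strong_integral_tendsto[OF scale_mem[OF diff_mem[OF f g]]])
  moreover have "simple_int \<mu> (\<lambda>x. c *\<^sub>R (s i x - t i x)) =
      c *\<^sub>R (simple_int \<mu> (s i) - simple_int \<mu> (t i))" for i
  proof -
    have i: "simple_integrable \<mu> (s i)" "simple_integrable \<mu> (t i)"
      using m simple_bochner_integrable_L1 by blast+
    then have d: "simple_integrable \<mu> (\<lambda>x. s i x - t i x)"
      by (intro simple_bochner_integrable_compose2[of "(-)"]) auto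
    have "linear ((*\<^sub>R) c :: 'y \<Rightarrow> 'y)" by (rule linear_scaleR)
    then show ?thesis
      using simple_bochner_integral_linear[OF _ d, of "(*\<^sub>R) c"] simple_bochner_integral_diff[OF i] by simp
  qed
  moreover have "(\<lambda>i. c *\<^sub>R (simple_int \<mu> (s i) - simple_int \<mu> (t i))) \<longlonglongrightarrow>
      c *\<^sub>R (strong_integral \<mu> f - strong_integral \<mu> g)"
    by (intro tendsto_intros strong_integral_tendsto f g s t)
  ultimately show ?thesis using LIMSEQ_unique by auto
qed

lemma L1_indicator:
  assumes "A \<in> sets \<mu>" "emeasure \<mu> A < \<infinity>"
  shows "(\<lambda>x. indicator A x *\<^sub>R v) \<in> Lp_fun 1 \<mu>" "Lp_norm 1 \<mu> (\<lambda>x. indicator A x *\<^sub>R v) = measure \<mu> A * norm v"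
proof -
  have eq: "(\<integral>\<^sup>+x. ennreal (norm (indicator A x *\<^sub>R v)) \<partial>\<mu>) = ennreal (measure \<mu> A * norm v)"
  proof -
    have "(\<integral>\<^sup>+x. ennreal (norm (indicator A x *\<^sub>R v)) \<partial>\<mu>) = (\<integral>\<^sup>+x. ennreal (norm v) * indicator A x \<partial>\<mu>)"
      by (intro nn_integral_cong) (auto simp: indicator_def)
    also have "\<dots> = ennreal (norm v) * emeasure \<mu> A" using assms(1) by (rule nn_integral_cmult_indicator)
    also have "\<dots> = ennreal (measure \<mu> A * norm v)"
      using assms(2) by (simp add: emeasure_eq_ennreal_measure ennreal_mult' mult.commute)
    finally show ?thesis .
  qed
  have "strongly_measurable \<mu> (\<lambda>x. indicator A x *\<^sub>R v)"
    by (rule strongly_measurable_indicator[OF assms(1) strongly_measurable_const])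
  then show "(\<lambda>x. indicator A x *\<^sub>R v) \<in> Lp_fun 1 \<mu>" using eq by (simp add: Lp_fun_def)
  then show "Lp_norm 1 \<mu> (\<lambda>x. indicator A x *\<^sub>R v) = measure \<mu> A * norm v"
    using L1_norm_eq[of "\<lambda>x. indicator A x *\<^sub>R v" \<mu>] eq by (simp add: Lp_norm_def)
qed

lemma strong_integral_indicator:
  fixes v :: "'y::banach"
  assumes A: "A \<in> sets \<mu>" "emeasure \<mu> A < \<infinity>"
  shows "strong_integral \<mu> (\<lambda>x. indicator A x *\<^sub>R v) = measure \<mu> A *\<^sub>R v"
proof -
  let ?f = "\<lambda>x. indicator A x *\<^sub>R v"
  have "simple_function \<mu> ?f"
    by (rule simple_function_compose2[of _ _ _ "(*\<^sub>R)"]) (auto intro: A)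
  then have "approximates \<mu> (\<lambda>_. ?f) ?f"
    using L1_indicator(1)[OF A, of v] by (simp add: approximates_def Lp_norm_def)
  then have "(\<lambda>i::nat. simple_int \<mu> ?f) \<longlonglongrightarrow> strong_integral \<mu> ?f"
    by (rule strong_integral_tendsto[OF L1_indicator(1)[OF A]])
  then have "strong_integral \<mu> ?f = simple_int \<mu> ?f"
    by (rule LIMSEQ_unique) (rule tendsto_const)
  also have "\<dots> = simple_int \<mu> (indicator A :: _ \<Rightarrow> real) *\<^sub>R v"
  proof (rule simple_bochner_integral_linear)
    show "linear (\<lambda>r::real. r *\<^sub>R v)" by (rule linear_scaleR_left)
    show "simple_integrable \<mu> (indicator A :: _ \<Rightarrow> real)"
      using simple_bochner_integrable_L1[of \<mu> "indicator A :: _ \<Rightarrow> real"] L1_indicator(1)[OF A, of "1::real"] A by simp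
  qed
  also have "simple_int \<mu> (indicator A :: _ \<Rightarrow> real) = measure \<mu> A"
  proof -
    have "simple_integrable \<mu> (indicator A :: _ \<Rightarrow> real)"
      using simple_bochner_integrable_L1[of \<mu> "indicator A :: _ \<Rightarrow> real"] L1_indicator(1)[OF A, of "1::real"] A by simp
    then have "ennreal (simple_int \<mu> (indicator A :: _ \<Rightarrow> real)) = (\<integral>\<^sup>+x. ennreal (indicator A x) \<partial>\<mu>)"
      by (rule simple_bochner_integral_eq_nn_integral) simp
    also have "\<dots> = ennreal (measure \<mu> A)"
      using A by (simp add: ennreal_indicator emeasure_eq_ennreal_measure)
    finally show ?thesis by simp
  qed
  finally show ?thesis .
qed

text \<open>Hoelder's inequality against the indicator of \<open>A\<close>, obtained by integrating
  the tangent inequality at a constant \<tau>. The best \<tau> is the p-th mean of the norm of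
  \<open>f\<close> over \<open>A\<close>.\<close>

lemma L1_norm_le_Lp:
  fixes f :: "'b \<Rightarrow> 'y::real_normed_vector"
  assumes p: "1 \<le> p" and f: "f \<in> Lp_fun p \<mu>"
    and A: "A \<in> sets \<mu>" "emeasure \<mu> A < \<infinity>" "0 < measure \<mu> A"
  shows "(on_set A f) \<in> Lp_fun 1 \<mu>"
    "Lp_norm 1 \<mu> (on_set A f) powr p \<le>
      measure \<mu> A powr (p - 1) * Lp_norm p \<mu> (on_set A f) powr p"
proof -
  let ?f = "on_set A f"
  define m where "m = measure \<mu> A"
  have m: "0 < m" "emeasure \<mu> A = ennreal m" using A by (auto simp: m_def emeasure_eq_ennreal_measure)
  have fs: "strongly_measurable \<mu> ?f"
    by (rule strongly_measurable_indicator[OF A(1)]) (use f in \<open>simp add: Lp_fun_def\<close>)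
  note [measurable] = borel_measurable_norm_strongly[OF fs] A(1)
  have fL: "?f \<in> Lp_fun p \<mu>"
    by (rule Lp_fun_mono[OF p f fs]) (auto simp: indicator_def)
  then obtain K where K: "0 \<le> K" "(\<integral>\<^sup>+x. ennreal (norm (?f x) powr p) \<partial>\<mu>) = ennreal K"
    by (cases "\<integral>\<^sup>+x. ennreal (norm (?f x) powr p) \<partial>\<mu>") (auto simp: Lp_fun_def)
  have NK: "Lp_norm p \<mu> ?f powr p = K" using K p by (simp add: Lp_norm_def powr_powr)
  have bound: "(\<integral>\<^sup>+x. ennreal (norm (?f x)) \<partial>\<mu>) \<le> ennreal (\<tau> * m)"
    if \<tau>: "0 < \<tau>" "K \<le> \<tau> powr p * m" for \<tau>
  proof -
    define c0 where "c0 = \<tau> powr (p - 1)"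
    define c1 where "c1 = (p - 1) / p * \<tau> powr p"
    define c2 where "c2 = 1 / p"
    have c: "0 < c0" "0 \<le> c1" "0 \<le> c2" using \<tau> p by (auto simp: c0_def c1_def c2_def)
    have "ennreal c0 * (\<integral>\<^sup>+x. ennreal (norm (?f x)) \<partial>\<mu>) = (\<integral>\<^sup>+x. ennreal c0 * ennreal (norm (?f x)) \<partial>\<mu>)"
      by (rule nn_integral_cmult[symmetric]) measurable
    also have "\<dots> \<le> (\<integral>\<^sup>+x. ennreal c1 * indicator A x + ennreal c2 * ennreal (norm (?f x) powr p) \<partial>\<mu>)"
    proof (rule nn_integral_mono)
      fix x
      show "ennreal c0 * ennreal (norm (?f x)) \<le>
          ennreal c1 * indicator A x + ennreal c2 * ennreal (norm (?f x) powr p)"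
      proof (cases "x \<in> A")
        case True
        have "c0 * norm (f x) \<le> c1 + c2 * norm (f x) powr p"
          using powr_minus_one_mult_le[OF p, of \<tau> "norm (f x)"] \<tau>(1) by (simp add: c0_def c1_def c2_def)
        then have "ennreal (c0 * norm (f x)) \<le> ennreal (c1 + c2 * norm (f x) powr p)" by (rule ennreal_leI)
        then show ?thesis using True c by (simp add: ennreal_mult ennreal_plus)
      qed simp
    qed
    also have "\<dots> = (\<integral>\<^sup>+x. ennreal c1 * indicator A x \<partial>\<mu>) + (\<integral>\<^sup>+x. ennreal c2 * ennreal (norm (?f x) powr p) \<partial>\<mu>)"
      by (rule nn_integral_add) measurable
    also have "(\<integral>\<^sup>+x. ennreal c1 * indicator A x \<partial>\<mu>) = ennreal c1 * ennreal m"
      using nn_integral_cmult_indicator[OF A(1), of "ennreal c1"] by (simp only: m(2))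
    also have "(\<integral>\<^sup>+x. ennreal c2 * ennreal (norm (?f x) powr p) \<partial>\<mu>) = ennreal c2 * ennreal K"
      unfolding K(2)[symmetric] by (rule nn_integral_cmult) measurable
    also have "ennreal c1 * ennreal m + ennreal c2 * ennreal K = ennreal (c1 * m + c2 * K)"
      unfolding ennreal_mult[OF c(2) less_imp_le[OF m(1)], symmetric] ennreal_mult[OF c(3) K(1), symmetric]
      by (rule ennreal_plus[symmetric]) (use c K(1) m(1) in auto)
    also have "\<dots> \<le> ennreal (\<tau> powr p * m)"
    proof (rule ennreal_leI)
      have "c2 * K \<le> c2 * (\<tau> powr p * m)" using \<tau>(2) c(3) by (rule mult_left_mono)
      moreover have "c1 * m + c2 * (\<tau> powr p * m) = \<tau> powr p * m"
        using p by (simp add: c1_def c2_def field_simps)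
      ultimately show "c1 * m + c2 * K \<le> \<tau> powr p * m" by linarith
    qed
    also have "\<tau> powr p * m = c0 * (\<tau> * m)"
      using powr_mult_base[of \<tau> "p - 1"] \<tau>(1) by (simp add: c0_def mult_ac)
    also have "ennreal (c0 * (\<tau> * m)) = ennreal c0 * ennreal (\<tau> * m)"
      by (rule ennreal_mult) (use c \<tau>(1) m(1) in auto)
    finally show ?thesis using c(1) by (subst (asm) ennreal_mult_le_mult_iff) auto
  qed
  \<comment> \<open>The optimal constant. It vanishes when \<open>K = 0\<close>, whereas
    \<open>bound\<close> divides by a power of \<tau>, so it is approached from above by
    \<open>t + \<eta>\<close>.\<close>
  define t where "t = (K / m) powr (1 / p)"
  have t: "t powr p * m = K" "0 \<le> t" using K(1) m(1) p by (auto simp: t_def powr_powr)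
  have tb: "(\<integral>\<^sup>+x. ennreal (norm (?f x)) \<partial>\<mu>) \<le> ennreal ((t + \<eta>) * m)" if "0 < \<eta>" for \<eta>
  proof (rule bound)
    show "K \<le> (t + \<eta>) powr p * m"
      unfolding t(1)[symmetric] using t(2) that p m(1) by (intro mult_right_mono powr_mono2) auto
  qed (use t(2) that in simp)
  show L1: "?f \<in> Lp_fun 1 \<mu>"
    using le_less_trans[OF tb[of 1]] fs by (simp add: Lp_fun_def)
  have le: "Lp_norm 1 \<mu> ?f \<le> (t + \<eta>) * m" if "0 < \<eta>" for \<eta>
    using tb[OF that] that t(2) m(1) unfolding L1_norm_eq[OF L1, symmetric] by (simp add: ennreal_le_iff)
  have "Lp_norm 1 \<mu> ?f \<le> t * m"
  proof (rule field_le_epsilon)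
    fix \<epsilon> :: real assume "0 < \<epsilon>"
    then show "Lp_norm 1 \<mu> ?f \<le> t * m + \<epsilon>" using le[of "\<epsilon> / m"] m(1) by (simp add: distrib_right)
  qed
  then have "Lp_norm 1 \<mu> ?f powr p \<le> (t * m) powr p"
    using p by (intro powr_mono2) (auto simp: Lp_norm_def)
  also have "\<dots> = t powr p * m * m powr (p - 1)"
    using t(2) m(1) powr_mult_base[of m "p - 1"] by (simp add: powr_mult mult.assoc)
  finally show "Lp_norm 1 \<mu> ?f powr p \<le> measure \<mu> A powr (p - 1) * Lp_norm p \<mu> ?f powr p"
    unfolding NK t(1) by (simp add: m_def mult.commute)
qed

text \<open>The average of \<open>h\<close> minus \<open>v\<close> is the average of
  \<open>h - v\<close>. With \<open>v = 0\<close> this bounds the averaging operator, with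
  \<open>v\<close> an approximate value of \<open>h\<close> it measures its accuracy.\<close>

lemma average_near_const:
  fixes h :: "'b \<Rightarrow> 'y::banach"
  assumes A: "A \<in> sets \<mu>" "emeasure \<mu> A < \<infinity>" "0 < measure \<mu> A"
    and h: "strongly_measurable \<mu> h" and \<delta>: "0 \<le> \<delta>" "AE x in \<mu>. x \<in> A \<longrightarrow> norm (h x - v) \<le> \<delta>"
  shows "(on_set A h) \<in> Lp_fun 1 \<mu>"
    "norm ((1 / measure \<mu> A) *\<^sub>R strong_integral \<mu> (on_set A h) - v) \<le> \<delta>"
proof -
  interpret fun_space "Lp_fun 1 \<mu> :: ('b \<Rightarrow> 'y) set" "Lp_norm 1 \<mu>" by (rule fun_space_Lp) simp
  let ?k = "\<lambda>x. indicator A x *\<^sub>R (h x - v)"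
  have ks: "strongly_measurable \<mu> ?k"
    by (intro strongly_measurable_indicator A(1) strongly_measurable_diff h strongly_measurable_const)
  have le: "AE x in \<mu>. norm (?k x) \<le> norm (indicator A x *\<^sub>R \<delta>)"
    using \<delta>(2) by eventually_elim (use \<delta>(1) in \<open>auto simp: indicator_def\<close>)
  have k: "?k \<in> Lp_fun 1 \<mu>" by (rule Lp_fun_mono[OF order_refl L1_indicator(1)[OF A(1,2)] ks le])
  have kn: "Lp_norm 1 \<mu> ?k \<le> measure \<mu> A * \<delta>"
    using Lp_norm_mono[OF order_refl L1_indicator(1)[OF A(1,2)] le] L1_indicator(2)[OF A(1,2), of \<delta>] \<delta>(1)
    by simp
  have v: "(\<lambda>x. indicator A x *\<^sub>R v) \<in> Lp_fun 1 \<mu>" by (rule L1_indicator(1)[OF A(1,2)])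
  have "(\<lambda>x. ?k x + indicator A x *\<^sub>R v) \<in> Lp_fun 1 \<mu>" by (rule add_mem[OF k v])
  then show h1: "(on_set A h) \<in> Lp_fun 1 \<mu>" by (simp add: algebra_simps)
  have "strong_integral \<mu> ?k = strong_integral \<mu> (on_set A h) - measure \<mu> A *\<^sub>R v"
    using strong_integral_scale_diff[OF h1 v, of 1] strong_integral_indicator[OF A(1,2), of v]
    by (simp add: scaleR_diff_right)
  then have "(1 / measure \<mu> A) *\<^sub>R strong_integral \<mu> (on_set A h) - v =
      (1 / measure \<mu> A) *\<^sub>R strong_integral \<mu> ?k"
    using A(3) by (simp add: scaleR_diff_right)
  then have "norm ((1 / measure \<mu> A) *\<^sub>R strong_integral \<mu> (on_set A h) - v) =
      norm (strong_integral \<mu> ?k) / measure \<mu> A"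
    using A(3) by simp
  also have "\<dots> \<le> \<delta>"
    using norm_strong_integral_le[OF k] kn A(3) by (simp add: divide_le_eq mult.commute)
  finally show "norm ((1 / measure \<mu> A) *\<^sub>R strong_integral \<mu> (on_set A h) - v) \<le> \<delta>" .
qed

section \<open>Density for essentially bounded functions\<close>

text \<open>The values of the approximating simple functions form a countable set whose
  \<open>e\<close>-balls cover the values of \<open>f\<close>. Countably many preimages therefore
  cover \<open>A\<close>, and they cannot all be null. This takes the place of separability of the
  value space.\<close>

lemma strongly_measurable_near_const:
  assumes f: "strongly_measurable \<mu> f" and A: "A \<in> sets \<mu>" "emeasure \<mu> A \<noteq> 0" and e: "(0::real) < e"
  shows "\<exists>B v. B \<in> sets \<mu> \<and> B \<subseteq> A \<and> emeasure \<mu> B \<noteq> 0 \<and> (\<forall>x\<in>B. norm (f x - v) \<le> e)"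
proof (rule ccontr)
  assume neg: "\<not> ?thesis"
  obtain s where s: "\<And>i::nat. simple_function \<mu> (s i)" "\<And>x. x \<in> space \<mu> \<Longrightarrow> (\<lambda>i. s i x) \<longlonglongrightarrow> f x"
    using f unfolding strongly_measurable_def by blast
  define D where "D = (\<Union>i. s i ` space \<mu>)"
  have "countable (s i ` space \<mu>)" for i
    by (rule countable_finite[OF simple_functionD(1)[OF s(1)]])
  then have D: "countable D" by (simp add: D_def)
  define B where "B = (\<lambda>v. A \<inter> {x \<in> space \<mu>. norm (f x - v) \<le> e})"
  have B: "B v \<in> sets \<mu>" for v
    unfolding B_def
    using A(1) borel_measurable_norm_strongly[OF strongly_measurable_diff[OF f strongly_measurable_const]]
    by measurable
  have "emeasure \<mu> (B v) = 0" for v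
  proof (rule ccontr)
    assume "emeasure \<mu> (B v) \<noteq> 0"
    then show False using neg B[of v] by (auto simp: B_def)
  qed
  then have "(\<Union>v\<in>D. B v) \<in> null_sets \<mu>"
    using B by (intro null_sets_UN' D) auto
  moreover have "A \<subseteq> (\<Union>v\<in>D. B v)"
  proof
    fix x assume x: "x \<in> A"
    then have xs: "x \<in> space \<mu>" using A(1) sets.sets_into_space by blast
    obtain i where "norm (s i x - f x) < e"
      using LIMSEQ_D[OF s(2)[OF xs] e] by blast
    then show "x \<in> (\<Union>v\<in>D. B v)"
      using x xs by (intro UN_I[of "s i x"]) (auto simp: B_def D_def norm_minus_commute)
  qed
  ultimately have "A \<in> null_sets \<mu>" using A(1) null_sets_subset by blast
  then show False using A(2) by auto
qed

lemma strongly_measurable_near_const_finite: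
  assumes "finite T" "\<And>f. f \<in> T \<Longrightarrow> strongly_measurable \<mu> f" "A \<in> sets \<mu>" "emeasure \<mu> A \<noteq> 0" "(0::real) < e"
  shows "\<exists>B. B \<in> sets \<mu> \<and> B \<subseteq> A \<and> emeasure \<mu> B \<noteq> 0 \<and> (\<forall>f\<in>T. \<exists>v. \<forall>x\<in>B. norm (f x - v) \<le> e)"
  using assms(1,2)
proof (induction T)
  case empty
  then show ?case using assms(3,4) by auto
next
  case (insert f T)
  then obtain B where B: "B \<in> sets \<mu>" "B \<subseteq> A" "emeasure \<mu> B \<noteq> 0"
    "\<And>g. g \<in> T \<Longrightarrow> \<exists>v. \<forall>x\<in>B. norm (g x - v) \<le> e" by auto
  have "strongly_measurable \<mu> f" using insert.prems by simp
  then obtain C v where C: "C \<in> sets \<mu>" "C \<subseteq> B" "emeasure \<mu> C \<noteq> 0" "\<forall>x\<in>C. norm (f x - v) \<le> e"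
    using strongly_measurable_near_const[OF _ B(1,3) assms(5)] by blast
  have "\<exists>v. \<forall>x\<in>C. norm (g x - v) \<le> e" if "g \<in> insert f T" for g
    using that B(4) C(2,4) by (metis insert_iff subsetD)
  then show ?case using B(2) C by (intro exI[of _ C]) auto
qed

text \<open>Averages require a set of finite positive measure. A set that is not null cannot meet
  every member of a countable exhaustion in a null set.\<close>

lemma (in sigma_finite_measure) finite_positive_subset:
  assumes A: "A \<in> sets M" "emeasure M A \<noteq> 0"
  shows "\<exists>B. B \<in> sets M \<and> B \<subseteq> A \<and> emeasure M B < \<infinity> \<and> 0 < measure M B"
proof -
  obtain F :: "nat \<Rightarrow> 'a set" where F: "range F \<subseteq> sets M" "(\<Union>i. F i) = space M" "\<And>i. emeasure M (F i) \<noteq> \<infinity>"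
    using sigma_finite by blast
  have "\<exists>i. emeasure M (A \<inter> F i) \<noteq> 0"
  proof (rule ccontr)
    assume "\<not> ?thesis"
    then have "(\<Union>i. A \<inter> F i) \<in> null_sets M" using F(1) A(1) by (intro null_sets_UN) auto
    moreover have "(\<Union>i. A \<inter> F i) = A" using F(2) sets.sets_into_space[OF A(1)] by auto
    ultimately show False using A(2) by auto
  qed
  then obtain i where i: "emeasure M (A \<inter> F i) \<noteq> 0" by blast
  have "emeasure M (A \<inter> F i) \<le> emeasure M (F i)" using F(1) by (intro emeasure_mono) auto
  then have fin: "emeasure M (A \<inter> F i) < \<infinity>" using F(3)[of i] by (auto simp: less_top intro: le_less_trans)
  then have "0 < measure M (A \<inter> F i)" using i by (simp add: measure_def enn2real_positive_iff zero_less_iff_neq_zero)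
  then show ?thesis using fin F(1) A(1) by (intro exI[of _ "A \<inter> F i"]) auto
qed

text \<open>\<open>A\<close> is chosen so that \<open>s0\<close> is almost maximal on it and every
  member of \<open>T\<close> almost constant. \<open>R\<close> overwrites \<open>f\<close> on
  \<open>A\<close> by the constant \<open>w\<close>; as \<open>A\<close> is not null, the essential
  supremum sees \<open>w\<close>.\<close>

theorem dense_attaining_Linf:
  fixes \<mu> :: "'b measure"
  assumes \<sigma>: "sigma_finite_measure \<mu>"
    and "dense_attaining TYPE('m::metric_space) UNIV (\<lambda>w. norm (w () :: 'y::banach))"
  shows "dense_attaining TYPE('m) (Linf_fun \<mu> :: ('b \<Rightarrow> 'y) set) (Linf_norm \<mu>)"
proof (rule dense_attaining_compression[OF fun_space_Linf
      fun_space_repr.axioms(1)[OF fun_space_repr_of_type] assms(2)])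
  let ?U = "Linf_fun \<mu> :: ('b \<Rightarrow> 'y) set"
  fix T :: "('b \<Rightarrow> 'y) set" and s0 and e :: real
  assume T: "finite T" "T \<subseteq> ?U" "s0 \<in> T" and s0: "0 < Linf_norm \<mu> s0" and e: "0 < e"
  have sm: "strongly_measurable \<mu> f" if "f \<in> ?U" for f using that by (simp add: Linf_fun_def)
  have Tm: "f \<in> ?U" if "f \<in> T" for f using that T(2) by blast
  \<comment> \<open>One third of \<open>e\<close> is the gap allowed here; the other two are spent
    in passing from \<open>s0 x\<close> to the constant \<open>v\<close> and from \<open>v\<close>
    to the average.\<close>
  define A0 where "A0 = {x \<in> space \<mu>. Linf_norm \<mu> s0 - e / 3 < norm (s0 x)}"
  have A0: "A0 \<in> sets \<mu>"
    unfolding A0_def using borel_measurable_norm_strongly[OF sm[OF Tm[OF T(3)]]] by measurable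
  have "emeasure \<mu> A0 \<noteq> 0"
  proof
    assume "emeasure \<mu> A0 = 0"
    then have "AE x in \<mu>. x \<notin> A0" using A0 by (intro AE_not_in) auto
    then have "AE x in \<mu>. norm (s0 x) \<le> max 0 (Linf_norm \<mu> s0 - e / 3)"
      using AE_space by eventually_elim (auto simp: A0_def)
    then have "Linf_norm \<mu> s0 \<le> max 0 (Linf_norm \<mu> s0 - e / 3)"
      by (intro Linf_leI(2) sm Tm T(3)) auto
    then show False using s0 e by auto
  qed
  then obtain A1 where A1: "A1 \<in> sets \<mu>" "A1 \<subseteq> A0" "emeasure \<mu> A1 \<noteq> 0"
    "\<And>f. f \<in> T \<Longrightarrow> \<exists>v. \<forall>x\<in>A1. norm (f x - v) \<le> e / 3"
    using strongly_measurable_near_const_finite[OF T(1) sm[OF Tm] A0, of "e / 3"] e by auto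
  obtain A where A: "A \<in> sets \<mu>" "A \<subseteq> A1" "emeasure \<mu> A < \<infinity>" "0 < measure \<mu> A"
    using sigma_finite_measure.finite_positive_subset[OF \<sigma> A1(1,3)] by blast
  have Ane: "A \<noteq> {}" using A(4) by auto
  have near: "\<exists>v. \<forall>x\<in>A. norm (f x - v) \<le> e / 3" if "f \<in> T" for f
    using A1(4)[OF that] A(2) by blast
  define E where "E = (\<lambda>(f::'b \<Rightarrow> 'y) (i::unit). (1 / measure \<mu> A) *\<^sub>R strong_integral \<mu> (on_set A f))"
  define R where "R = (\<lambda>(f::'b \<Rightarrow> 'y) (w::unit \<Rightarrow> 'y) x. f x - indicator A x *\<^sub>R f x + indicator A x *\<^sub>R w ())"
  have bdA: "AE x in \<mu>. x \<in> A \<longrightarrow> norm (f x - 0) \<le> Linf_norm \<mu> f" if "f \<in> ?U" for f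
    using AE_le_Linf_norm[OF that] by eventually_elim simp
  have L1: "(on_set A f) \<in> Lp_fun 1 \<mu>" if "f \<in> ?U" for f
    by (rule average_near_const(1)[OF A(1,3,4) sm[OF that] Linf_norm_nonneg bdA[OF that]])
  have E_le: "norm (E f ()) \<le> Linf_norm \<mu> f" if "f \<in> ?U" for f
    using average_near_const(2)[OF A(1,3,4) sm[OF that] Linf_norm_nonneg bdA[OF that]] by (simp add: E_def)
  have E_near: "norm (E f () - v) \<le> \<delta>" if "f \<in> ?U" "0 \<le> \<delta>" "\<forall>x\<in>A. norm (f x - v) \<le> \<delta>" for f v \<delta>
    unfolding E_def by (rule average_near_const(2)[OF A(1,3,4) sm[OF that(1)] that(2)]) (use that(3) in auto)
  have E_lin: "diff_linear ?U E"
    unfolding diff_linear_def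
  proof (intro ballI allI)
    fix f g c assume fg: "f \<in> ?U" "g \<in> ?U"
    have "(\<lambda>x. indicator A x *\<^sub>R (c *\<^sub>R (f x - g x))) =
        (\<lambda>x. c *\<^sub>R (indicator A x *\<^sub>R f x - indicator A x *\<^sub>R g x))"
      by (simp add: algebra_simps)
    then have "strong_integral \<mu> (\<lambda>x. indicator A x *\<^sub>R (c *\<^sub>R (f x - g x))) =
        c *\<^sub>R (strong_integral \<mu> (on_set A f) - strong_integral \<mu> (on_set A g))"
      using strong_integral_scale_diff[OF L1[OF fg(1)] L1[OF fg(2)], of c] by (simp only:)
    then show "E (\<lambda>x. c *\<^sub>R (f x - g x)) = (\<lambda>i. c *\<^sub>R (E f i - E g i))"
      unfolding E_def by (intro ext) (simp add: scaleR_diff_right mult.commute)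
  qed
  have R_in: "x \<in> A \<Longrightarrow> R f w x = w ()" and R_out: "x \<notin> A \<Longrightarrow> R f w x = f x" for f w x
    by (simp_all add: R_def)
  have Rs: "strongly_measurable \<mu> (R f w)" if "f \<in> ?U" for f w
    unfolding R_def
    by (intro strongly_measurable_add strongly_measurable_diff strongly_measurable_indicator A(1)
        strongly_measurable_const sm[OF that])
  have "AE x in \<mu>. norm (R f w x) \<le> max (Linf_norm \<mu> f) (norm (w ()))" if "f \<in> ?U" for f w
    using AE_le_Linf_norm[OF that]
  proof eventually_elim
    fix x assume "norm (f x) \<le> Linf_norm \<mu> f"
    then show "norm (R f w x) \<le> max (Linf_norm \<mu> f) (norm (w ()))"
      by (cases "x \<in> A") (simp_all add: R_in R_out le_max_iff_disj)
  qed
  then have R: "R f w \<in> ?U" "Linf_norm \<mu> (R f w) \<le> max (Linf_norm \<mu> f) (norm (w ()))" if "f \<in> ?U" for f w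
    using Linf_leI[OF Rs[OF that], of "max (Linf_norm \<mu> f) (norm (w ()))"] that by (auto simp: le_max_iff_disj)
  have R_ge: "norm (w ()) \<le> Linf_norm \<mu> (R f w)" if "f \<in> ?U" for f w
  proof (rule ccontr)
    assume less: "\<not> norm (w ()) \<le> Linf_norm \<mu> (R f w)"
    have "AE x in \<mu>. x \<notin> A"
      using AE_le_Linf_norm[OF R(1)[OF that, of w]] by eventually_elim (use less R_in in force)
    then have "emeasure \<mu> A = 0" using A(1) sets.sets_into_space[OF A(1)] by (subst (asm) AE_iff_measurable[of A]) auto
    then show False using A(4) by (simp add: measure_def)
  qed
  have R_lin: "R (\<lambda>x. c *\<^sub>R (f x - g x)) (\<lambda>i. c *\<^sub>R (w i - v i)) = (\<lambda>x. c *\<^sub>R (R f w x - R g v x))"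
    for f g w v c unfolding R_def by (auto simp: algebra_simps)
  have Es0: "Linf_norm \<mu> s0 - e \<le> norm (E s0 ())"
  proof -
    obtain x where x: "x \<in> A" using Ane by blast
    obtain v where v: "\<forall>x\<in>A. norm (s0 x - v) \<le> e / 3" using near[OF T(3)] by blast
    have "norm (E s0 () - v) \<le> e / 3" using E_near[OF Tm[OF T(3)] _ v] e by simp
    moreover have "norm (s0 x - v) \<le> e / 3" using v x by blast
    moreover have "Linf_norm \<mu> s0 - e / 3 < norm (s0 x)" using x A(2) A1(2) by (auto simp: A0_def)
    ultimately show ?thesis
      using norm_triangle_ineq2[of "s0 x" v] norm_triangle_ineq2[of v "E s0 ()"] norm_minus_commute[of v "E s0 ()"]
      by linarith
  qed
  have net: "Linf_norm \<mu> (\<lambda>x. s x - R s (E s) x) \<le> e" if s: "s \<in> T" for s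
  proof (rule Linf_leI(2))
    show "strongly_measurable \<mu> (\<lambda>x. s x - R s (E s) x)"
      by (intro strongly_measurable_diff sm Tm s R(1))
    obtain v where v: "\<forall>x\<in>A. norm (s x - v) \<le> e / 3" using near[OF s] by blast
    have Ev: "norm (E s () - v) \<le> e / 3" using E_near[OF Tm[OF s] _ v] e by simp
    have "norm (s x - R s (E s) x) \<le> e" for x
    proof (cases "x \<in> A")
      case True
      have "norm (s x - E s ()) \<le> norm (s x - v) + norm (v - E s ())"
        using norm_triangle_ineq[of "s x - v" "v - E s ()"] by simp
      then show ?thesis using True v Ev e norm_minus_commute[of v "E s ()"] by (fastforce simp: R_in)
    qed (use e in \<open>simp add: R_out\<close>)
    then show "AE x in \<mu>. norm (s x - R s (E s) x) \<le> e" by simp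
  qed (use e in simp)
  show "\<exists>(E :: ('b \<Rightarrow> 'y) \<Rightarrow> unit \<Rightarrow> 'y) R. compression ?U (Linf_norm \<mu>) UNIV (\<lambda>w. norm (w ())) E R \<and>
      Linf_norm \<mu> s0 - e \<le> norm (E s0 ()) \<and> (\<forall>s\<in>T. Linf_norm \<mu> (\<lambda>x. s x - R s (E s) x) \<le> e)"
    unfolding compression_def
    by (rule exI[of _ E], rule exI[of _ R])
      (intro conjI ballI allI E_lin UNIV_I E_le R R_ge R_lin Es0 net)
qed

section \<open>Density for p-integrable functions\<close>

lemma powr_inject: "0 < p \<Longrightarrow> 0 \<le> x \<Longrightarrow> 0 \<le> y \<Longrightarrow> x powr p = y powr p \<Longrightarrow> x = (y::real)"
  by (metis less_irrefl linorder_less_linear powr_less_mono2)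

lemma powr_le_cancel: "0 < p \<Longrightarrow> 0 \<le> x \<Longrightarrow> 0 \<le> y \<Longrightarrow> x powr p \<le> y powr p \<Longrightarrow> x \<le> (y::real)"
  by (meson linorder_not_less powr_less_mono2)

lemma Lp_norm_powr:
  assumes "1 \<le> p" "f \<in> Lp_fun p \<mu>"
  shows "ennreal (Lp_norm p \<mu> f powr p) = (Lp_int p \<mu> f)"
  using assms by (simp add: Lp_norm_def powr_powr Lp_fun_def)

section \<open>Step functions over finitely many blocks\<close>

definition step_fun :: "nat \<Rightarrow> (nat \<Rightarrow> 'b set) \<Rightarrow> (nat \<Rightarrow> 'y::real_vector) \<Rightarrow> 'b \<Rightarrow> 'y" where
  "step_fun n A c = (\<lambda>x. \<Sum>k<n. indicator (A k) x *\<^sub>R c k)"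

definition finite_blocks :: "'b measure \<Rightarrow> nat \<Rightarrow> (nat \<Rightarrow> 'b set) \<Rightarrow> bool" where
  "finite_blocks \<mu> n A \<longleftrightarrow> disjoint_family_on A {..<n} \<and>
     (\<forall>k<n. A k \<in> sets \<mu> \<and> emeasure \<mu> (A k) < \<infinity> \<and> 0 < measure \<mu> (A k))"

lemma step_fun_on:
  assumes "disjoint_family_on A {..<n}" "j < n" "x \<in> A j"
  shows "step_fun n A c x = c j"
proof -
  have "indicator (A k) x *\<^sub>R c k = (if k = j then c j else 0)" if "k < n" for k
    using assms that by (auto simp: disjoint_family_on_def indicator_def)
  then have "step_fun n A c x = (\<Sum>k<n. if k = j then c j else 0)"
    unfolding step_fun_def by (intro sum.cong) auto
  then show ?thesis using assms(2) by simp
qed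

lemma step_fun_off: "(\<And>j. j < n \<Longrightarrow> x \<notin> A j) \<Longrightarrow> step_fun n A c x = 0"
  unfolding step_fun_def by (rule sum.neutral) auto

text \<open>At most one block contains \<open>x\<close>, so the power passes inside the sum and
  integrals can be computed block by block.\<close>

lemma norm_step_fun_powr:
  fixes c :: "nat \<Rightarrow> 'y::real_normed_vector"
  assumes "disjoint_family_on A {..<n}"
  shows "ennreal (norm (step_fun n A c x) powr p) = (\<Sum>k<n. ennreal (norm (c k) powr p) * indicator (A k) x)"
proof (cases "\<exists>j<n. x \<in> A j")
  case True
  then obtain j where j: "j < n" "x \<in> A j" by blast
  have "ennreal (norm (c k) powr p) * indicator (A k) x = (if k = j then ennreal (norm (c j) powr p) else 0)"
    if "k < n" for k
    using assms that j by (auto simp: disjoint_family_on_def indicator_def)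
  then have "(\<Sum>k<n. ennreal (norm (c k) powr p) * indicator (A k) x) =
      (\<Sum>k<n. if k = j then ennreal (norm (c j) powr p) else 0)"
    by (intro sum.cong) auto
  then show ?thesis using j(1) step_fun_on[OF assms j, of c] by simp
next
  case False
  then have "step_fun n A c x = 0" by (intro step_fun_off) auto
  then show ?thesis using False by (simp add: indicator_def)
qed

lemma Lp_step_fun:
  fixes c :: "nat \<Rightarrow> 'y::real_normed_vector"
  assumes p: "1 \<le> p" and A: "finite_blocks \<mu> n A"
  shows "step_fun n A c \<in> Lp_fun p \<mu>"
    "Lp_norm p \<mu> (step_fun n A c) powr p = (\<Sum>k<n. measure \<mu> (A k) * norm (c k) powr p)"
proof -
  have d: "disjoint_family_on A {..<n}" and As: "\<And>k. k < n \<Longrightarrow> A k \<in> sets \<mu>"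
    and fin: "\<And>k. k < n \<Longrightarrow> emeasure \<mu> (A k) = ennreal (measure \<mu> (A k))"
    using A by (auto simp: finite_blocks_def emeasure_eq_ennreal_measure)
  have "(\<integral>\<^sup>+x. ennreal (norm (step_fun n A c x) powr p) \<partial>\<mu>) =
      (\<Sum>k<n. \<integral>\<^sup>+x. ennreal (norm (c k) powr p) * indicator (A k) x \<partial>\<mu>)"
    unfolding norm_step_fun_powr[OF d] by (rule nn_integral_sum) (use As in auto)
  also have "\<dots> = (\<Sum>k<n. ennreal (measure \<mu> (A k) * norm (c k) powr p))"
  proof (intro sum.cong refl)
    fix k assume "k \<in> {..<n}"
    then have k: "k < n" by simp
    show "(\<integral>\<^sup>+x. ennreal (norm (c k) powr p) * indicator (A k) x \<partial>\<mu>) =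
        ennreal (measure \<mu> (A k) * norm (c k) powr p)"
      unfolding nn_integral_cmult_indicator[OF As[OF k]] fin[OF k] by (simp add: ennreal_mult mult.commute)
  qed
  also have "\<dots> = ennreal (\<Sum>k<n. measure \<mu> (A k) * norm (c k) powr p)"
    by (rule sum_ennreal) simp
  finally have eq: "(\<integral>\<^sup>+x. ennreal (norm (step_fun n A c x) powr p) \<partial>\<mu>) =
      ennreal (\<Sum>k<n. measure \<mu> (A k) * norm (c k) powr p)" .
  have "strongly_measurable \<mu> (step_fun n A c)"
    unfolding step_fun_def
    by (intro strongly_measurable_sum strongly_measurable_indicator strongly_measurable_const) (use As in auto)
  then show mem: "step_fun n A c \<in> Lp_fun p \<mu>" using eq by (simp add: Lp_fun_def)
  have "0 \<le> (\<Sum>k<n. measure \<mu> (A k) * norm (c k) powr p)" by (intro sum_nonneg) auto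
  then show "Lp_norm p \<mu> (step_fun n A c) powr p = (\<Sum>k<n. measure \<mu> (A k) * norm (c k) powr p)"
    using Lp_norm_powr[OF p mem] eq by simp
qed

text \<open>
  The atoms of a finite family \<open>T\<close> of simple functions are its joint level sets. An atom of infinite
  measure carries the value 0 of every function in \<open>T\<close>, because these are \<open>p\<close>-integrable.
\<close>

lemma Lp_simple_blocks:
  fixes T :: "('b \<Rightarrow> 'y::real_normed_vector) set"
  assumes p: "1 \<le> p" and T: "finite T" "\<And>t. t \<in> T \<Longrightarrow> simple_function \<mu> t" "\<And>t. t \<in> T \<Longrightarrow> t \<in> Lp_fun p \<mu>"
  shows "\<exists>n A. finite_blocks \<mu> n A \<and> (\<forall>t\<in>T. \<exists>c. AE x in \<mu>. t x = step_fun n A c x)"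
proof -
  define atom where "atom = (\<lambda>g. {y \<in> space \<mu>. \<forall>t\<in>T. t y = g t})"
  \<comment> \<open>The joint level sets of \<open>T\<close>. They are indexed by tuples of values
    of simple functions, hence finite in number, and two of them that meet are equal.\<close>
  define P where "P = (\<lambda>x. atom (\<lambda>t. t x)) ` space \<mu>"
  have P_sub: "P \<subseteq> atom ` (PiE T (\<lambda>t. t ` space \<mu>))"
  proof
    fix B assume "B \<in> P"
    then obtain x where x: "x \<in> space \<mu>" "B = atom (\<lambda>t. t x)" by (auto simp: P_def)
    have "B = atom (restrict (\<lambda>t. t x) T)" using x(2) by (auto simp: atom_def)
    moreover have "restrict (\<lambda>t. t x) T \<in> PiE T (\<lambda>t. t ` space \<mu>)" using x(1) by auto
    ultimately show "B \<in> atom ` (PiE T (\<lambda>t. t ` space \<mu>))" by blast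
  qed
  have finP: "finite P"
    by (rule finite_subset[OF P_sub], rule finite_imageI, rule finite_PiE[OF T(1)])
      (use T(2) simple_functionD(1) in blast)
  have atom_sets: "atom g \<in> sets \<mu>" for g
  proof -
    have "{y \<in> space \<mu>. t y = g t} \<in> sets \<mu>" if "t \<in> T" for t
    proof -
      have "t -` {g t} \<inter> space \<mu> \<in> sets \<mu>" by (rule simple_functionD(2)[OF T(2)[OF that]])
      moreover have "t -` {g t} \<inter> space \<mu> = {y \<in> space \<mu>. t y = g t}" by auto
      ultimately show ?thesis by simp
    qed
    then show ?thesis unfolding atom_def by (intro sets.sets_Collect_finite_All T(1)) auto
  qed
  have P_sets: "B \<in> sets \<mu>" if "B \<in> P" for B using that atom_sets by (auto simp: P_def)
  have P_const: "t x = t y" if "B \<in> P" "x \<in> B" "y \<in> B" "t \<in> T" for B x y t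
    using that by (auto simp: P_def atom_def)
  have P_eq: "B = atom (\<lambda>t. t x)" if "B \<in> P" "x \<in> B" for B x
  proof -
    obtain x0 where x0: "B = atom (\<lambda>t. t x0)" using \<open>B \<in> P\<close> by (auto simp: P_def)
    then have tx: "t x = t x0" if "t \<in> T" for t using \<open>x \<in> B\<close> that by (simp add: atom_def)
    have "(\<forall>t\<in>T. t y = t x0) \<longleftrightarrow> (\<forall>t\<in>T. t y = t x)" for y by (rule ball_cong) (simp_all add: tx)
    then show ?thesis unfolding x0 atom_def by simp
  qed
  have P_disj: "B = C" if "B \<in> P" "C \<in> P" "x \<in> B" "x \<in> C" for B C x
    using P_eq[OF that(1,3)] P_eq[OF that(2,4)] by simp
  \<comment> \<open>Only these atoms become blocks: null atoms disappear almost everywhere, and on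
    atoms of infinite measure every member of \<open>T\<close> is 0.\<close>
  define Q where "Q = {B \<in> P. emeasure \<mu> B \<noteq> 0 \<and> emeasure \<mu> B < \<infinity>}"
  have finQ: "finite Q" using finP by (simp add: Q_def)
  obtain A where A: "bij_betw A {..<card Q} Q"
    using ex_bij_betw_nat_finite[OF finQ] by (auto simp: lessThan_atLeast0)
  let ?n = "card Q"
  have AQ: "A k \<in> Q" if "k < ?n" for k using bij_betwE[OF A] that by auto
  have AP: "A k \<in> P" if "k < ?n" for k using AQ[OF that] by (simp add: Q_def)
  have disj: "disjoint_family_on A {..<?n}"
    unfolding disjoint_family_on_def
  proof (intro ballI impI)
    fix i j assume ij: "i \<in> {..<?n}" "j \<in> {..<?n}" "i \<noteq> j"
    then have "A i \<noteq> A j" using A by (auto simp: bij_betw_def inj_on_def)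
    then show "A i \<inter> A j = {}" using P_disj[OF AP AP, of i j] ij by auto
  qed
  have blocks: "finite_blocks \<mu> ?n A"
    unfolding finite_blocks_def
  proof (intro conjI disj allI impI)
    fix k assume "k < ?n"
    from AQ[OF this] show "A k \<in> sets \<mu>" "emeasure \<mu> (A k) < \<infinity>" "0 < measure \<mu> (A k)"
      using P_sets by (auto simp: Q_def measure_def enn2real_positive_iff zero_less_iff_neq_zero)
  qed
  have null: "AE x in \<mu>. \<forall>B\<in>{B \<in> P. emeasure \<mu> B = 0}. x \<notin> B"
    by (rule AE_finite_allI) (use finP P_sets in \<open>auto intro!: AE_not_in null_setsI\<close>)
  have "\<exists>c. AE x in \<mu>. t x = step_fun ?n A c x" if t: "t \<in> T" for t
  proof -
    define c where "c = (\<lambda>k. t (SOME x. x \<in> A k))"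
    have "t x = step_fun ?n A c x" if x: "x \<in> space \<mu>" and nn: "\<forall>B\<in>{B \<in> P. emeasure \<mu> B = 0}. x \<notin> B" for x
    proof (cases "\<exists>k<?n. x \<in> A k")
      case True
      then obtain k where k: "k < ?n" "x \<in> A k" by blast
      have "(SOME x. x \<in> A k) \<in> A k" using k(2) by (rule someI)
      then have "t x = c k" unfolding c_def using P_const[OF AP[OF k(1)] k(2) _ t] by blast
      then show ?thesis by (simp only: step_fun_on[OF disj k])
    next
      case False
      define B where "B = atom (\<lambda>t. t x)"
      have B: "B \<in> P" "x \<in> B" using x by (auto simp: B_def P_def atom_def)
      have "B \<notin> Q"
      proof
        assume "B \<in> Q"
        then obtain k where "k < ?n" "A k = B" using A by (metis bij_betw_imp_surj_on imageE lessThan_iff)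
        then show False using False B(2) by blast
      qed
      then have inf: "emeasure \<mu> B = \<infinity>" using B nn by (auto simp: Q_def less_top)
      have "t x = 0"
      proof (rule ccontr)
        assume nz: "t x \<noteq> 0"
        \<comment> \<open>Chebyshev's argument: a nonzero constant value on a set of infinite
          measure would make the integral infinite.\<close>
        have "ennreal (norm (t x) powr p) * emeasure \<mu> B = (\<integral>\<^sup>+y. ennreal (norm (t x) powr p) * indicator B y \<partial>\<mu>)"
          by (rule nn_integral_cmult_indicator[symmetric, OF P_sets[OF B(1)]])
        also have "\<dots> \<le> (\<integral>\<^sup>+y. ennreal (norm (t y) powr p) \<partial>\<mu>)"
        proof (rule nn_integral_mono)
          fix y show "ennreal (norm (t x) powr p) * indicator B y \<le> ennreal (norm (t y) powr p)"
            using P_const[OF B(1) B(2) _ t, of y] by (cases "y \<in> B") auto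
        qed
        also have "\<dots> < \<infinity>" using T(3)[OF t] by (simp add: Lp_fun_def)
        finally show False using nz inf by (simp add: ennreal_mult_top)
      qed
      moreover have "step_fun ?n A c x = 0" using False by (intro step_fun_off) auto
      ultimately show ?thesis by simp
    qed
    then have "AE x in \<mu>. t x = step_fun ?n A c x"
      using null AE_space by (auto elim: eventually_elim2)
    then show ?thesis by blast
  qed
  then show ?thesis using blocks by blast
qed

lemma Lp_step_approx:
  fixes T :: "('b \<Rightarrow> 'y::real_normed_vector) set"
  assumes p: "1 \<le> p" and T: "finite T" "T \<subseteq> Lp_fun p \<mu>" and e: "(0::real) < e"
  shows "\<exists>n A. finite_blocks \<mu> n A \<and> (\<forall>s\<in>T. \<exists>c. Lp_norm p \<mu> (\<lambda>x. s x - step_fun n A c x) \<le> e)"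
proof -
  have "\<exists>t. simple_function \<mu> t \<and> t \<in> Lp_fun p \<mu> \<and> Lp_norm p \<mu> (\<lambda>x. s x - t x) \<le> e" if "s \<in> T" for s
  proof -
    have "s \<in> Lp_fun p \<mu>" using that T(2) by blast
    then obtain t where t: "\<forall>i. simple_function \<mu> (t i) \<and> t i \<in> Lp_fun p \<mu>"
      "(\<lambda>i. Lp_norm p \<mu> (\<lambda>x. s x - t i x)) \<longlonglongrightarrow> 0"
      using Lp_simple_approx[OF p] by blast
    have "\<forall>\<^sub>F i in sequentially. Lp_norm p \<mu> (\<lambda>x. s x - t i x) < e"
      by (rule order_tendstoD(2)[OF t(2) e])
    then obtain i where "Lp_norm p \<mu> (\<lambda>x. s x - t i x) < e"
      using eventually_happens'[OF sequentially_bot] by blast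
    then show ?thesis using t(1) by (intro exI[of _ "t i"]) auto
  qed
  then obtain t where t: "\<And>s. s \<in> T \<Longrightarrow> simple_function \<mu> (t s)" "\<And>s. s \<in> T \<Longrightarrow> t s \<in> Lp_fun p \<mu>"
    "\<And>s. s \<in> T \<Longrightarrow> Lp_norm p \<mu> (\<lambda>x. s x - t s x) \<le> e" by metis
  obtain n A where A: "finite_blocks \<mu> n A" "\<forall>g\<in>t ` T. \<exists>c. AE x in \<mu>. g x = step_fun n A c x"
    using Lp_simple_blocks[OF p, of "t ` T" \<mu>] T(1) t(1,2) by blast
  have "\<exists>c. Lp_norm p \<mu> (\<lambda>x. s x - step_fun n A c x) \<le> e" if s: "s \<in> T" for s
  proof -
    obtain c where c: "AE x in \<mu>. t s x = step_fun n A c x" using A(2) s by blast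
    then have "Lp_norm p \<mu> (\<lambda>x. s x - step_fun n A c x) = Lp_norm p \<mu> (\<lambda>x. s x - t s x)"
      by (intro Lp_norm_cong_AE) (auto elim: eventually_mono)
    then show ?thesis using t(3)[OF s] by (intro exI[of _ c]) simp
  qed
  then show ?thesis using A(1) by blast
qed

lemma lp_finite_support:
  fixes w :: "nat \<Rightarrow> 'y::real_normed_vector"
  assumes p: "1 \<le> p" and w: "\<And>k. n \<le> k \<Longrightarrow> w k = 0"
  shows "w \<in> lp_fun p" "lp_norm p w powr p = (\<Sum>k<n. norm (w k) powr p)"
proof -
  have z: "norm (w k) powr p = 0" if "k \<notin> {..<n}" for k using w[of k] that by simp
  show "w \<in> lp_fun p"
    unfolding lp_fun_iff by (rule summable_finite[of "{..<n}"]) (use z in auto)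
  moreover have "(\<Sum>k. norm (w k) powr p) = (\<Sum>k<n. norm (w k) powr p)"
    by (rule suminf_finite) (use z in auto)
  ultimately show "lp_norm p w powr p = (\<Sum>k<n. norm (w k) powr p)"
    by (simp only: lp_norm_powr[OF p])
qed

lemma sum_Lp_norm_blocks_le:
  fixes f :: "'b \<Rightarrow> 'y::real_normed_vector"
  assumes p: "1 \<le> p" and A: "finite_blocks \<mu> n A" and f: "f \<in> Lp_fun p \<mu>"
  shows "(\<Sum>k<n. Lp_norm p \<mu> (on_set (A k) f) powr p) \<le> Lp_norm p \<mu> f powr p"
proof -
  have As: "\<And>k. k < n \<Longrightarrow> A k \<in> sets \<mu>" and d: "disjoint_family_on A {..<n}"
    using A by (auto simp: finite_blocks_def)
  have fs: "strongly_measurable \<mu> f" using f by (simp add: Lp_fun_def)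
  have m: "(on_set (A k) f) \<in> Lp_fun p \<mu>" if "k < n" for k
    by (rule Lp_fun_mono[OF p f strongly_measurable_indicator[OF As[OF that] fs]]) (auto simp: indicator_def)
  have bm: "(\<lambda>x. ennreal (norm (indicator (A k) x *\<^sub>R f x) powr p)) \<in> borel_measurable \<mu>" if "k < n" for k
    using borel_measurable_norm_strongly[OF strongly_measurable_indicator[OF As[OF that] fs]] by measurable
  have "ennreal (\<Sum>k<n. Lp_norm p \<mu> (on_set (A k) f) powr p) =
      (\<Sum>k<n. ennreal (Lp_norm p \<mu> (on_set (A k) f) powr p))"
    by (rule sum_ennreal[symmetric]) simp
  also have "\<dots> = (\<Sum>k<n. \<integral>\<^sup>+x. ennreal (norm (indicator (A k) x *\<^sub>R f x) powr p) \<partial>\<mu>)"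
    using Lp_norm_powr[OF p m] by (intro sum.cong) auto
  also have "\<dots> = (\<integral>\<^sup>+x. (\<Sum>k<n. ennreal (norm (indicator (A k) x *\<^sub>R f x) powr p)) \<partial>\<mu>)"
    by (rule nn_integral_sum[symmetric]) (use bm in auto)
  also have "\<dots> \<le> (Lp_int p \<mu> f)"
  proof (rule nn_integral_mono)
    fix x
    \<comment> \<open>For fixed \<open>x\<close> the sum is the power of a step function with the
      single value \<open>f x\<close>, which at \<open>x\<close> is either \<open>f x\<close> or
      0.\<close>
    have "(\<Sum>k<n. ennreal (norm (indicator (A k) x *\<^sub>R f x) powr p)) =
        (\<Sum>k<n. ennreal (norm (f x) powr p) * indicator (A k) x)"
      using p by (intro sum.cong) (auto simp: indicator_def)
    also have "\<dots> = ennreal (norm (step_fun n A (\<lambda>_. f x) x) powr p)"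
      by (rule norm_step_fun_powr[OF d, symmetric])
    also have "\<dots> \<le> ennreal (norm (f x) powr p)"
    proof (cases "\<exists>k<n. x \<in> A k")
      case True
      then obtain k where k: "k < n" "x \<in> A k" by blast
      show ?thesis using step_fun_on[OF d k, of "\<lambda>_. f x"] by simp
    next
      case False
      then have "step_fun n A (\<lambda>_. f x) x = 0" by (intro step_fun_off) auto
      then show ?thesis by simp
    qed
    finally show "(\<Sum>k<n. ennreal (norm (indicator (A k) x *\<^sub>R f x) powr p)) \<le> ennreal (norm (f x) powr p)" .
  qed
  also have "\<dots> = ennreal (Lp_norm p \<mu> f powr p)" by (rule Lp_norm_powr[OF p f, symmetric])
  finally show ?thesis by (simp add: ennreal_le_iff)
qed

text \<open>\<open>J\<close> sends the k-th coordinate to a multiple of the indicator of the k-th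
  block, and \<open>J\<close> after \<open>E\<close> averages over the blocks. This averaging fixes
  step functions and is a contraction by Hoelder's inequality on each block.\<close>

theorem dense_attaining_Lp:
  assumes p: "1 \<le> p"
    and "dense_attaining TYPE('m::metric_space) (lp_fun p :: (nat \<Rightarrow> 'y::banach) set) (lp_norm p)"
  shows "dense_attaining TYPE('m) (Lp_fun p \<mu> :: ('b \<Rightarrow> 'y) set) (Lp_norm p \<mu>)"
proof (rule dense_attaining_sequence_compression[OF fun_space_Lp[OF p] fun_space_Lp[OF p] assms(2) p
      lp_head_tail[OF p]])
  let ?U = "Lp_fun p \<mu> :: ('b \<Rightarrow> 'y) set" and ?W = "lp_fun p :: (nat \<Rightarrow> 'y) set"
  interpret U: fun_space ?U "Lp_norm p \<mu>" by (rule fun_space_Lp[OF p])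
  interpret W: fun_space ?W "lp_norm p" by (rule fun_space_Lp[OF p])
  have p0: "0 < p" using p by simp
  fix T :: "('b \<Rightarrow> 'y) set" and e :: real
  assume T: "finite T" "T \<subseteq> ?U" and e: "0 < e"
  \<comment> \<open>Half of \<open>e\<close> is used because the distance to a step function counts
    twice: once for \<open>s\<close>, once for its image under the contraction \<open>J\<close>
    after \<open>E\<close>.\<close>
  obtain n A where A: "finite_blocks \<mu> n A"
    "\<forall>s\<in>T. \<exists>c. Lp_norm p \<mu> (\<lambda>x. s x - step_fun n A c x) \<le> e / 2"
    using Lp_step_approx[OF p T, of "e / 2"] e by auto
  have d: "disjoint_family_on A {..<n}" using A(1) by (simp add: finite_blocks_def)
  have Ak: "A k \<in> sets \<mu>" "emeasure \<mu> (A k) < \<infinity>" "0 < measure \<mu> (A k)" if "k < n" for k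
    using A(1) that by (auto simp: finite_blocks_def)
  define m where "m = (\<lambda>k. measure \<mu> (A k))"
  have m: "0 < m k" if "k < n" for k using Ak(3)[OF that] by (simp add: m_def)
  \<comment> \<open>The indicator of block k has norm \<open>m k powr (1 / p)\<close>, so
    \<open>J\<close> divides by this to be isometric. The power \<open>1 / p - 1\<close> in
    \<open>E\<close> leaves the total factor \<open>1 / m k\<close> of an average.\<close>
  define E where "E = (\<lambda>(f::'b \<Rightarrow> 'y) k. if k < n
    then m k powr (1 / p - 1) *\<^sub>R strong_integral \<mu> (on_set (A k) f) else 0)"
  define J where "J = (\<lambda>w::nat \<Rightarrow> 'y. step_fun n A (\<lambda>k. m k powr (- (1 / p)) *\<^sub>R w k))"
  note L1 = L1_norm_le_Lp[OF p _ Ak]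
  have EW: "E f \<in> ?W" "lp_norm p (E f) powr p = (\<Sum>k<n. norm (E f k) powr p)" for f
    using lp_finite_support[OF p, of n "E f"] by (auto simp: E_def)
  have E_le: "lp_norm p (E f) \<le> Lp_norm p \<mu> f" if f: "f \<in> ?U" for f
  proof (rule powr_le_cancel[OF p0])
    have "norm (E f k) powr p \<le> Lp_norm p \<mu> (on_set (A k) f) powr p" if k: "k < n" for k
    proof -
      let ?f = "on_set (A k) f"
      have "norm (E f k) powr p = (m k powr (1 / p - 1) * norm (strong_integral \<mu> ?f)) powr p"
        using k by (simp add: E_def)
      also have "\<dots> = m k powr (1 - p) * norm (strong_integral \<mu> ?f) powr p"
        using p by (simp add: powr_mult powr_powr algebra_simps)
      also have "\<dots> \<le> m k powr (1 - p) * Lp_norm 1 \<mu> ?f powr p"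
        using p norm_strong_integral_le[OF L1(1)[OF f k k k]] by (intro mult_left_mono powr_mono2) auto
      also have "\<dots> \<le> m k powr (1 - p) * (m k powr (p - 1) * Lp_norm p \<mu> ?f powr p)"
        using L1(2)[OF f k k k] by (intro mult_left_mono) (auto simp: m_def)
      also have "\<dots> = Lp_norm p \<mu> ?f powr p"
        using m[OF k] by (simp flip: powr_add mult.assoc)
      finally show ?thesis .
    qed
    then have "lp_norm p (E f) powr p \<le> (\<Sum>k<n. Lp_norm p \<mu> (on_set (A k) f) powr p)"
      unfolding EW(2) by (intro sum_mono) auto
    also have "\<dots> \<le> Lp_norm p \<mu> f powr p" by (rule sum_Lp_norm_blocks_le[OF p A(1) f])
    finally show "lp_norm p (E f) powr p \<le> Lp_norm p \<mu> f powr p" .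
  qed (auto simp: W.N_nonneg EW U.N_nonneg f)
  have E_lin: "diff_linear ?U E"
    unfolding diff_linear_def
  proof (intro ballI allI ext)
    fix f g c k assume fg: "f \<in> ?U" "g \<in> ?U"
    show "E (\<lambda>x. c *\<^sub>R (f x - g x)) k = c *\<^sub>R (E f k - E g k)"
    proof (cases "k < n")
      case k: True
      have "(\<lambda>x. indicator (A k) x *\<^sub>R (c *\<^sub>R (f x - g x))) =
          (\<lambda>x. c *\<^sub>R (indicator (A k) x *\<^sub>R f x - indicator (A k) x *\<^sub>R g x))"
        by (simp add: algebra_simps)
      then have "strong_integral \<mu> (\<lambda>x. indicator (A k) x *\<^sub>R (c *\<^sub>R (f x - g x))) =
          c *\<^sub>R (strong_integral \<mu> (on_set (A k) f) - strong_integral \<mu> (on_set (A k) g))"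
        using strong_integral_scale_diff[OF L1(1)[OF fg(1) k k k] L1(1)[OF fg(2) k k k], of c] by (simp only:)
      then show ?thesis using k by (simp add: E_def scaleR_diff_right mult.commute)
    qed (simp add: E_def)
  qed
  have head_E: "seq_head n (E f) = E f" and tail_E: "seq_tail n (E f) = (\<lambda>k. 0)" for f
    by (auto simp: seq_head_def seq_tail_def E_def)
  have J_lin: "diff_linear ?W J"
    unfolding diff_linear_def J_def step_fun_def
    by (auto simp: scaleR_diff_right scaleR_sum_right sum_subtractf mult_ac)
  have J: "J w \<in> ?U" for w unfolding J_def by (rule Lp_step_fun(1)[OF p A(1)])
  have NJ: "Lp_norm p \<mu> (J w) = lp_norm p (seq_head n w)" if "w \<in> ?W" for w
  proof (rule powr_inject[OF p0])
    have "Lp_norm p \<mu> (J w) powr p = (\<Sum>k<n. m k * norm (m k powr (- (1 / p)) *\<^sub>R w k) powr p)"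
      unfolding J_def Lp_step_fun(2)[OF p A(1)] m_def ..
    also have "\<dots> = (\<Sum>k<n. norm (seq_head n w k) powr p)"
    proof (intro sum.cong refl)
      fix k assume "k \<in> {..<n}"
      then have k: "k < n" by simp
      have "(m k powr (- (1 / p))) powr p = inverse (m k)"
      proof -
        have "(m k powr (- (1 / p))) powr p = m k powr (- (1 / p) * p)" by (rule powr_powr)
        also have "- (1 / p) * p = - 1" using p by simp
        finally show ?thesis using m[OF k] by (simp add: powr_minus)
      qed
      then show "m k * norm (m k powr (- (1 / p)) *\<^sub>R w k) powr p = norm (seq_head n w k) powr p"
        using m[OF k] k by (simp add: powr_mult seq_head_def)
    qed
    also have "\<dots> = lp_norm p (seq_head n w) powr p"
      by (rule lp_finite_support(2)[OF p, symmetric]) (simp add: seq_head_def)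
    finally show "Lp_norm p \<mu> (J w) powr p = lp_norm p (seq_head n w) powr p" .
  qed (auto simp: U.N_nonneg J W.N_nonneg lp_head_tail[OF p that])
  have JE_step: "J (E (step_fun n A c)) = step_fun n A c" for c
  proof -
    have "m k powr (- (1 / p)) *\<^sub>R E (step_fun n A c) k = c k" if k: "k < n" for k
    proof -
      have "(\<lambda>x. indicator (A k) x *\<^sub>R step_fun n A c x) = (\<lambda>x. indicator (A k) x *\<^sub>R c k)"
      proof
        fix x show "indicator (A k) x *\<^sub>R step_fun n A c x = indicator (A k) x *\<^sub>R c k"
          by (cases "x \<in> A k") (simp_all add: step_fun_on[OF d k])
      qed
      then have "E (step_fun n A c) k = m k powr (1 / p - 1) *\<^sub>R (m k *\<^sub>R c k)"
        using strong_integral_indicator[OF Ak(1,2)[OF k], of "c k"] k by (simp add: E_def m_def)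
      moreover have "m k powr (- (1 / p)) * (m k powr (1 / p - 1) * m k) = 1"
        using m[OF k] by (simp add: powr_diff powr_minus)
      ultimately show ?thesis by (simp add: mult.assoc)
    qed
    then show ?thesis unfolding J_def step_fun_def by (intro ext sum.cong) auto
  qed
  have net: "Lp_norm p \<mu> (\<lambda>x. s x - J (E s) x) \<le> e" if s: "s \<in> T" for s
  proof -
    have sU: "s \<in> ?U" using s T(2) by blast
    obtain c where c: "Lp_norm p \<mu> (\<lambda>x. s x - step_fun n A c x) \<le> e / 2" using A(2) s by blast
    let ?g = "step_fun n A c"
    have gU: "?g \<in> ?U" by (rule Lp_step_fun(1)[OF p A(1)])
    have dU: "(\<lambda>x. ?g x - s x) \<in> ?U" by (rule U.diff_mem[OF gU sU])
    \<comment> \<open>Since \<open>?g\<close> is fixed by \<open>J\<close> after \<open>E\<close>,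
      its distance from the image of \<open>s\<close> is the norm of the image of
      \<open>?g - s\<close>.\<close>
    have "(\<lambda>x. ?g x - J (E s) x) = J (E (\<lambda>x. ?g x - s x))"
      unfolding diff_linear_diff[OF E_lin gU sU] diff_linear_diff[OF J_lin EW(1) EW(1)] JE_step ..
    then have "Lp_norm p \<mu> (\<lambda>x. ?g x - J (E s) x) = lp_norm p (E (\<lambda>x. ?g x - s x))"
      using NJ[OF EW(1)] head_E by simp
    also have "\<dots> \<le> Lp_norm p \<mu> (\<lambda>x. ?g x - s x)" by (rule E_le[OF dU])
    also have "\<dots> = Lp_norm p \<mu> (\<lambda>x. s x - ?g x)" by (rule U.N_minus_commute[OF gU sU])
    finally show ?thesis using U.N_diff_triangle[OF sU gU J, of "E s"] c by linarith
  qed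
  show "\<exists>n E J. diff_linear ?U E \<and> (\<forall>f\<in>?U. E f \<in> ?W \<and> lp_norm p (E f) \<le> Lp_norm p \<mu> f \<and> seq_tail n (E f) = (\<lambda>k. 0)) \<and>
        diff_linear ?W J \<and> (\<forall>w\<in>?W. J w \<in> ?U \<and> Lp_norm p \<mu> (J w) = lp_norm p (seq_head n w)) \<and>
        (\<forall>s\<in>T. Lp_norm p \<mu> (\<lambda>x. s x - J (E s) x) \<le> e)"
    by (rule exI[of _ n], rule exI[of _ E], rule exI[of _ J])
      (intro conjI ballI E_lin EW E_le tail_E J_lin J NJ net)
qed

section \<open>Return from presented functions to the given target spaces\<close>

theorem corollary3p19:
  fixes z :: "'m::complete_space"
  assumes "LipSNAK_dense z (ns_of_type :: 'y::banach normed_sp)"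
  shows "(\<forall>K :: 'k topology. compact_space K \<and> Hausdorff_space K \<longrightarrow>
            LipSNAK_dense z (C_space K :: ('k \<Rightarrow> 'y) normed_sp)) \<and>
         (\<forall>p::real. 1 \<le> p \<longrightarrow> LipSNAK_dense z (lp_space p :: (nat \<Rightarrow> 'y) normed_sp) \<longrightarrow>
            (\<forall>\<mu> :: 'b measure. LipSNAK_dense z (Lp_space p \<mu> :: ('b \<Rightarrow> 'y) set normed_sp))) \<and>
         (\<forall>\<nu> :: 'c measure. sigma_finite_measure \<nu> \<longrightarrow>
            LipSNAK_dense z (Linf_space \<nu> :: ('c \<Rightarrow> 'y) set normed_sp))"
  proof (intro conjI allI impI)
  note dense_iff = fun_space_repr.LipSNAK_dense_iff
  have Y: "dense_attaining TYPE('m) UNIV (\<lambda>w. norm (w () :: 'y))"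
    by (rule dense_iff[OF fun_space_repr_of_type, THEN iffD1, OF assms])
  show "LipSNAK_dense z (C_space K :: ('k \<Rightarrow> 'y) normed_sp)"
    if K: "compact_space K \<and> Hausdorff_space K" for K :: "'k topology"
    by (rule dense_iff[OF fun_space_repr_C, THEN iffD2]) (use K dense_attaining_C[OF _ _ Y] in auto)
  show "LipSNAK_dense z (Lp_space p \<mu> :: ('b \<Rightarrow> 'y) set normed_sp)"
    if p: "1 \<le> p" and lp: "LipSNAK_dense z (lp_space p :: (nat \<Rightarrow> 'y) normed_sp)" for p and \<mu> :: "'b measure"
  proof (rule dense_iff[OF fun_space_repr_Lp[OF p], THEN iffD2])
    show "dense_attaining TYPE('m) (Lp_fun p \<mu> :: ('b \<Rightarrow> 'y) set) (Lp_norm p \<mu>)"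
      by (rule dense_attaining_Lp[OF p dense_iff[OF fun_space_repr_lp[OF p], THEN iffD1, OF lp]])
  qed
  show "LipSNAK_dense z (Linf_space \<nu> :: ('c \<Rightarrow> 'y) set normed_sp)"
    if "sigma_finite_measure \<nu>" for \<nu> :: "'c measure"
    by (rule dense_iff[OF fun_space_repr_Linf, THEN iffD2]) (rule dense_attaining_Linf[OF that Y])
qed

end
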